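(* Let $p$ be a fixed prime. For a positive integer $n$, the number of isomorphism classes of rings of cardinality $p^{n}$ is $p^{\delta}$, where $\delta=\delta(n)$ satisfies $\delta = \frac{4}{27}n^{3} + O(n^{5/2})$.
   Context: Rings are associative but are not assumed to have a multiplicative identity (nor to be commutative). The prime $p$ is fixed and $n$ varies; $g(n)=O(h(n))$ means $|g(n)|\le C\,h(n)$ for all $n\ge 1$ for some constant $C$ not depending on $n$ ($C$ may depend on $p$). *)

theory Defs
  imports Complex_Main "HOL-Computational_Algebra.Primes" "HOL-Algebra.Ring"
begin

text \<open>
  Associative rings without the requirement of a multiplicative identity, on the record type of
  HOL-Algebra.  That record has a field for the multiplicative unit; nothing below mentions it,
  so its value is irrelevant.
\<close>

locale nonunital_ring = abelian_group R for R (structure) +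
  assumes mult_closed: "\<lbrakk>x \<in> carrier R; y \<in> carrier R\<rbrakk> \<Longrightarrow> x \<otimes> y \<in> carrier R"
    and mult_assoc: "\<lbrakk>x \<in> carrier R; y \<in> carrier R; z \<in> carrier R\<rbrakk>
      \<Longrightarrow> (x \<otimes> y) \<otimes> z = x \<otimes> (y \<otimes> z)"
    and left_distrib: "\<lbrakk>x \<in> carrier R; y \<in> carrier R; z \<in> carrier R\<rbrakk>
      \<Longrightarrow> (x \<oplus> y) \<otimes> z = x \<otimes> z \<oplus> y \<otimes> z"
    and right_distrib: "\<lbrakk>x \<in> carrier R; y \<in> carrier R; z \<in> carrier R\<rbrakk>
      \<Longrightarrow> z \<otimes> (x \<oplus> y) = z \<otimes> x \<oplus> z \<otimes> y"

text \<open>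
  A bijection of the carriers preserving addition and multiplication.  The set \<open>ring_iso\<close> of
  HOL-Algebra is not suitable, since it also requires the unit field to be preserved.
\<close>

definition nonunital_ring_isomorphic ::
    "('a, 'm) ring_scheme \<Rightarrow> ('b, 'n) ring_scheme \<Rightarrow> bool" where
  "nonunital_ring_isomorphic R S \<longleftrightarrow>
     (\<exists>h. h \<in> iso (add_monoid R) (add_monoid S) \<and> h \<in> iso R S)"

text \<open>
  The rings of cardinality \<open>m\<close> whose underlying set consists of natural numbers.  Up to isomorphism
  these are all the rings of cardinality \<open>m\<close>, by \<open>ex_rings_of_card_isomorphic\<close> below.
\<close>

definition rings_of_card :: "nat \<Rightarrow> nat ring set" where
  "rings_of_card m = {R. nonunital_ring R \<and> finite (carrier R) \<and> card (carrier R) = m}"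

definition ring_iso_rel :: "nat \<Rightarrow> (nat ring \<times> nat ring) set" where
  "ring_iso_rel m = {(R, S). R \<in> rings_of_card m \<and> S \<in> rings_of_card m
     \<and> nonunital_ring_isomorphic R S}"

definition num_rings :: "nat \<Rightarrow> nat" where
  "num_rings m = card (rings_of_card m // ring_iso_rel m)"

lemma equiv_ring_iso_rel: "equiv (rings_of_card m) (ring_iso_rel m)"
proof (rule equivI)
  show "ring_iso_rel m \<subseteq> rings_of_card m \<times> rings_of_card m"
    by (auto simp: ring_iso_rel_def)
  show "refl_on (rings_of_card m) (ring_iso_rel m)"
    by (auto simp: refl_on_def ring_iso_rel_def nonunital_ring_isomorphic_def
        intro!: exI[of _ id] id_iso)
  show "sym (ring_iso_rel m)"
  proof (rule symI)
    fix R S assume "(R, S) \<in> ring_iso_rel m"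
    then obtain h where mem: "R \<in> rings_of_card m" "S \<in> rings_of_card m"
      and h: "h \<in> iso (add_monoid R) (add_monoid S)" "h \<in> iso R S"
      by (auto simp: ring_iso_rel_def nonunital_ring_isomorphic_def)
    interpret R: nonunital_ring R
      using mem by (simp add: rings_of_card_def)
    let ?g = "inv_into (carrier R) h"
    have bij: "bij_betw h (carrier R) (carrier S)"
      using h by (simp add: iso_def)
    have g: "?g y \<in> carrier R" "h (?g y) = y" if "y \<in> carrier S" for y
      using that bij by (auto simp: bij_betw_def inv_into_into f_inv_into_f)
    have hm: "h (x \<otimes>\<^bsub>R\<^esub> y) = h x \<otimes>\<^bsub>S\<^esub> h y" "h (x \<oplus>\<^bsub>R\<^esub> y) = h x \<oplus>\<^bsub>S\<^esub> h y"
      if "x \<in> carrier R" "y \<in> carrier R" for x y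
      using that h by (auto simp: iso_def hom_def)
    have inv: "?g (h x) = x" if "x \<in> carrier R" for x
      using that bij by (simp add: bij_betw_def)
    have "?g (x \<otimes>\<^bsub>S\<^esub> y) = ?g x \<otimes>\<^bsub>R\<^esub> ?g y" "?g (x \<oplus>\<^bsub>S\<^esub> y) = ?g x \<oplus>\<^bsub>R\<^esub> ?g y"
      if xy: "x \<in> carrier S" "y \<in> carrier S" for x y
      using inv[of "?g x \<otimes>\<^bsub>R\<^esub> ?g y"] inv[of "?g x \<oplus>\<^bsub>R\<^esub> ?g y"]
        hm[of "?g x" "?g y"] g[OF xy(1)] g[OF xy(2)]
        R.mult_closed[of "?g x" "?g y"] R.a_closed[of "?g x" "?g y"] by simp_all
    then have "?g \<in> iso (add_monoid S) (add_monoid R)" "?g \<in> iso S R"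
      using g bij_betw_inv_into[OF bij] by (auto simp: iso_def hom_def)
    then show "(S, R) \<in> ring_iso_rel m"
      using mem by (auto simp: ring_iso_rel_def nonunital_ring_isomorphic_def)
  qed
  show "trans (ring_iso_rel m)"
    by (rule transI) (auto simp: ring_iso_rel_def nonunital_ring_isomorphic_def
        intro: iso_set_trans)
qed

lemma ex_rings_of_card_isomorphic:
  fixes R :: "('a, 'm) ring_scheme"
  assumes "nonunital_ring R" "finite (carrier R)"
  shows "\<exists>S \<in> rings_of_card (card (carrier R)). nonunital_ring_isomorphic R S"
proof -
  interpret R: nonunital_ring R by fact
  obtain h where h: "bij_betw h (carrier R) {..<card (carrier R)}"
    using ex_bij_betw_finite_nat[OF assms(2)] by (auto simp: atLeast0LessThan)
  define g where "g = inv_into (carrier R) h"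
  define S :: "nat ring" where "S = \<lparr>carrier = {..<card (carrier R)},
    mult = (\<lambda>x y. h (g x \<otimes>\<^bsub>R\<^esub> g y)), one = 0,
    zero = h \<zero>\<^bsub>R\<^esub>, add = (\<lambda>x y. h (g x \<oplus>\<^bsub>R\<^esub> g y))\<rparr>"
  have S: "carrier S = {..<card (carrier R)}" "zero S = h \<zero>\<^bsub>R\<^esub>"
    "x \<otimes>\<^bsub>S\<^esub> y = h (g x \<otimes>\<^bsub>R\<^esub> g y)" "x \<oplus>\<^bsub>S\<^esub> y = h (g x \<oplus>\<^bsub>R\<^esub> g y)" for x y
    by (simp_all add: S_def)
  have g: "g y \<in> carrier R" "h (g y) = y" if "y \<in> carrier S" for y
    using that h by (auto simp: S g_def bij_betw_def inv_into_into f_inv_into_f)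
  have gh: "g (h x) = x" if "x \<in> carrier R" for x
    using that h by (simp add: g_def bij_betw_def)
  have hc: "h x \<in> carrier S" if "x \<in> carrier R" for x
    using that h by (auto simp: S bij_betw_def)
  have "abelian_group S"
  proof (rule abelian_groupI)
    fix x assume x: "x \<in> carrier S"
    show "\<exists>y \<in> carrier S. y \<oplus>\<^bsub>S\<^esub> x = \<zero>\<^bsub>S\<^esub>"
      using g[OF x] by (intro bexI[of _ "h (\<ominus>\<^bsub>R\<^esub> g x)"]) (simp_all add: S(2-) gh hc R.l_neg)
  qed (use g gh hc in \<open>simp_all add: S(2-) R.a_ac\<close>)
  then have "nonunital_ring S"
    by (intro nonunital_ring.intro nonunital_ring_axioms.intro)
      (use g gh hc in \<open>simp_all add: S(2-) R.mult_closed R.mult_assoc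
        R.left_distrib R.right_distrib\<close>)
  then have "S \<in> rings_of_card (card (carrier R))"
    by (simp add: rings_of_card_def S)
  moreover have "h \<in> iso (add_monoid R) (add_monoid S)" "h \<in> iso R S"
    using h gh hc by (auto simp: iso_def hom_def S)
  ultimately show ?thesis
    by (auto simp: nonunital_ring_isomorphic_def)
qed

end

theory Submission
  imports Defs "HOL-Library.FuncSet"
begin

text \<open>
  Lower bound: bilinear maps \<open>V \<times> V \<rightarrow> W\<close> with \<open>dim V = 2n/3\<close> and \<open>dim W = n/3\<close> give rings with
  \<open>R\<^sup>3 = 0\<close>, and each isomorphism class contains at most \<open>p\<^bsup>n\<^sup>2\<^esup>\<close> of them.

  Upper bound: there are at most \<open>p\<^bsup>n\<^sup>2\<^esup>\<close> abelian groups of order \<open>p\<^sup>n\<close>, so count the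
  multiplications on a fixed group \<open>G\<close>, in digits to the base \<open>p\<close>, up to \<open>O(n\<^bsup>5/2\<^esup>)\<close> digits.
  First let the ring be nilpotent. Choose greedily a set \<open>A\<close> of \<open>O(\<surd>n)\<close> elements such that for
  all \<open>x\<close> the images of \<open>x G\<close> modulo \<open>A G\<close> and of \<open>G x\<close> modulo \<open>G A\<close> have dimension \<open>O(\<surd>n)\<close>. It
  takes \<open>O(n\<^bsup>5/2\<^esup>)\<close> digits to describe the multiplications by elements of \<open>A\<close> and the product
  modulo \<open>Q = A G \<inter> G A\<close>. Two multiplications \<open>m, m'\<close> with these data in common have a difference
  \<open>\<Delta>\<close> that is a map of bimodules over the ring generated by \<open>A\<close>, so if \<open>\<Delta>\<close> vanishes on
  generators of \<open>G\<close> modulo \<open>Q\<close>, then the span \<open>D\<close> of its values satisfies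
  \<open>D \<subseteq> G D + D G\<close>, hence \<open>D = 0\<close>. With \<open>q = dim Q\<close> this leaves \<open>q (n - q)\<^sup>2 \<le> 4 n\<^sup>3 / 27\<close> digits.

  In general a ring is generated by its radical and a family of elements \<open>x\<close> for which the ranks of
  the multiplications by \<open>x\<close> add up to \<open>O(n log n)\<close>, because primitive idempotents occurring in an
  orthogonal family have ranks with sum at most \<open>2n\<close>. These multiplications are described by
  \<open>O(n\<^sup>2 log n)\<close> digits, and together with the multiplication of the radical they determine the ring.
\<close>

section \<open>Subgroups of prime power order\<close>

text \<open>Two costs balance at \<surd>n. The products by one element cost O(n^2) digits and a map
  of rank k costs O(n k), so the elements of A and the n maps modulo A G and G A cost O(n^(5/2))
  each when |A| and k are O(\<surd>n). The greedy choice attains this: a new element raises the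
  length of A G or G A by more than k, and neither exceeds n. Q is an intersection because an
  element of Q has to be absorbed in the left factor through A G and in the right factor through G
  A. The maximum of q (n - q)^2 is at q = n/3, the dimension of W in the lower bound, so the leading
  constants agree. Without nilpotency the comparison of m and m' breaks down: for an idempotent e
  \<noteq> 0 the multiples of e form a group D with D \<subseteq> G D. So it is applied to the
  radical only, and the rest is paid for by generators of small rank. Few are enough because in a
  local ring each new generator at least squares a lower bound for the order modulo the radical, so
  O(log log |G|) = O(log n) generators suffice for each primitive idempotent. The additive group is
  arbitrary, so dimension means composition length.\<close>

definition add_subgroup :: "'a::ab_group_add set \<Rightarrow> bool" where
  "add_subgroup U \<longleftrightarrow> 0 \<in> U \<and> (\<forall>x\<in>U. \<forall>y\<in>U. x - y \<in> U)"

abbreviation gen :: "'a::ab_group_add set \<Rightarrow> 'a set" where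
  "gen S \<equiv> add_subgroup hull S"

definition coset :: "'a::ab_group_add set \<Rightarrow> 'a \<Rightarrow> 'a set" where
  "coset U x = (+) x ` U"

lemma add_subgroupI:
  assumes "0 \<in> U" "\<And>x y. x \<in> U \<Longrightarrow> y \<in> U \<Longrightarrow> x - y \<in> U"
  shows "add_subgroup U"
  using assms by (auto simp: add_subgroup_def)

lemma add_subgroup_zero: "add_subgroup U \<Longrightarrow> 0 \<in> U"
  by (simp add: add_subgroup_def)

lemma add_subgroup_diff: "add_subgroup U \<Longrightarrow> x \<in> U \<Longrightarrow> y \<in> U \<Longrightarrow> x - y \<in> U"
  by (simp add: add_subgroup_def)

lemma add_subgroup_uminus: "add_subgroup U \<Longrightarrow> x \<in> U \<Longrightarrow> - x \<in> U"
  using add_subgroup_diff[of U 0 x] by (simp add: add_subgroup_zero)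

lemma add_subgroup_add: "add_subgroup U \<Longrightarrow> x \<in> U \<Longrightarrow> y \<in> U \<Longrightarrow> x + y \<in> U"
  using add_subgroup_diff[of U x "- y"] by (simp add: add_subgroup_uminus)

lemma add_subgroup_diff_iff:
  assumes "add_subgroup U" "y \<in> U"
  shows "x - y \<in> U \<longleftrightarrow> x \<in> U" "y - x \<in> U \<longleftrightarrow> x \<in> U" "x + y \<in> U \<longleftrightarrow> x \<in> U" "y + x \<in> U \<longleftrightarrow> x \<in> U"
proof -
  have "x \<in> U" if "x - y \<in> U"
    using add_subgroup_add[OF assms(1) that assms(2)] by simp
  moreover have "x \<in> U" if "y - x \<in> U"
    using add_subgroup_diff[OF assms(1) assms(2) that] by simp
  moreover have "x \<in> U" if "x + y \<in> U"
    using add_subgroup_diff[OF assms(1) that assms(2)] by simp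
  ultimately show "x - y \<in> U \<longleftrightarrow> x \<in> U" "y - x \<in> U \<longleftrightarrow> x \<in> U"
    "x + y \<in> U \<longleftrightarrow> x \<in> U" "y + x \<in> U \<longleftrightarrow> x \<in> U"
    using add_subgroup_add[OF assms(1), of x y] add_subgroup_diff[OF assms(1), of x y]
      add_subgroup_diff[OF assms(1), of y x] assms(2) by (metis add.commute)+
qed

lemma add_subgroup_Int: "add_subgroup U \<Longrightarrow> add_subgroup V \<Longrightarrow> add_subgroup (U \<inter> V)"
  by (auto simp: add_subgroup_def)

lemma add_subgroup_singleton_0: "add_subgroup {0}"
  by (auto simp: add_subgroup_def)

lemma add_subgroup_gen: "add_subgroup (gen S)"
  by (rule hull_in) (auto simp: add_subgroup_def)

lemma gen_least: "S \<subseteq> U \<Longrightarrow> add_subgroup U \<Longrightarrow> gen S \<subseteq> U"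
  by (rule hull_minimal)

lemma gen_eq: "add_subgroup U \<Longrightarrow> gen U = U"
  by (rule hull_same)

lemma add_subgroup_vimage:
  assumes "add_subgroup G" "add_subgroup U" "\<And>x y. x \<in> G \<Longrightarrow> y \<in> G \<Longrightarrow> f (x - y) = f x - f y"
  shows "add_subgroup {x\<in>G. f x \<in> U}"
proof (rule add_subgroupI)
  have "f 0 = f 0 - f 0"
    using assms(3)[of 0 0] add_subgroup_zero[OF assms(1)] by simp
  then show "0 \<in> {x\<in>G. f x \<in> U}"
    using assms(1,2) by (simp add: add_subgroup_zero)
qed (use assms in \<open>auto simp: add_subgroup_diff\<close>)

lemma add_subgroup_image:
  assumes "add_subgroup G" "\<And>x y. x \<in> G \<Longrightarrow> y \<in> G \<Longrightarrow> f (x - y) = f x - f y"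
  shows "add_subgroup (f ` G)"
proof (rule add_subgroupI)
  have "f 0 = f 0 - f 0"
    using assms(2)[of 0 0] add_subgroup_zero[OF assms(1)] by simp
  then have "f 0 = 0"
    by simp
  then show "0 \<in> f ` G"
    using add_subgroup_zero[OF assms(1)] by force
next
  fix u v assume "u \<in> f ` G" "v \<in> f ` G"
  then obtain x y where "x \<in> G" "y \<in> G" "u = f x" "v = f y"
    by blast
  then show "u - v \<in> f ` G"
    using assms add_subgroup_diff by (metis imageI)
qed

lemma gen_additive_mem:
  assumes "add_subgroup G" "add_subgroup U" "\<And>x y. x \<in> G \<Longrightarrow> y \<in> G \<Longrightarrow> f (x - y) = f x - f y"
    and "S \<subseteq> G" "\<And>s. s \<in> S \<Longrightarrow> f s \<in> U" "x \<in> gen S"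
  shows "f x \<in> U"
proof -
  have "gen S \<subseteq> {x\<in>G. f x \<in> U}"
    by (rule gen_least) (use assms add_subgroup_vimage[OF assms(1-3)] in auto)
  then show ?thesis
    using assms by auto
qed

lemma gen_Un_subset: "gen S \<subseteq> gen (S \<union> T)"
  by (rule hull_mono) simp

lemma gen_Un_gen: "gen (gen S \<union> T) = gen (S \<union> T)"
proof
  show "gen (gen S \<union> T) \<subseteq> gen (S \<union> T)"
    using gen_Un_subset[of S T] hull_subset[of "S \<union> T" add_subgroup]
    by (intro gen_least add_subgroup_gen) blast
  show "gen (S \<union> T) \<subseteq> gen (gen S \<union> T)"
    using hull_subset[of S add_subgroup] by (intro hull_mono) blast
qed

section \<open>Cosets and Lagrange's theorem\<close>

lemma mem_coset_self: "add_subgroup U \<Longrightarrow> x \<in> coset U x"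
  by (force simp: coset_def add_subgroup_zero image_iff)

lemma mem_coset_iff: "y \<in> coset U x \<longleftrightarrow> y - x \<in> U"
  by (force simp: coset_def image_iff algebra_simps)

lemma coset_eq_iff:
  assumes "add_subgroup U"
  shows "coset U x = coset U y \<longleftrightarrow> x - y \<in> U"
proof
  assume "coset U x = coset U y"
  then show "x - y \<in> U"
    using mem_coset_self[OF assms, of x] by (simp add: mem_coset_iff)
next
  assume xy: "x - y \<in> U"
  have "z - x \<in> U \<longleftrightarrow> z - y \<in> U" for z
    using add_subgroup_diff_iff(3)[OF assms xy, of "z - x"] by simp
  then show "coset U x = coset U y"
    by (auto simp: mem_coset_iff)
qed

lemma card_coset: "card (coset U x) = card U"
  unfolding coset_def by (rule card_image) auto

lemma card_cosets:
  assumes "add_subgroup U" "add_subgroup W" "U \<subseteq> W" "finite W"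
  shows "card U * card (coset U ` W) = card W"
proof -
  have U: "\<Union> (coset U ` W) = W"
  proof
    show "\<Union> (coset U ` W) \<subseteq> W"
      using assms by (auto simp: coset_def add_subgroup_add)
    show "W \<subseteq> \<Union> (coset U ` W)"
      using mem_coset_self[OF assms(1)] by blast
  qed
  have "card U * card (coset U ` W) = card (\<Union> (coset U ` W))"
  proof (rule card_partition)
    fix c1 c2 assume c: "c1 \<in> coset U ` W" "c2 \<in> coset U ` W" "c1 \<noteq> c2"
    then obtain x y where xy: "c1 = coset U x" "c2 = coset U y" by blast
    show "c1 \<inter> c2 = {}"
    proof (rule ccontr)
      assume "c1 \<inter> c2 \<noteq> {}"
      then obtain z where "z - x \<in> U" "z - y \<in> U"
        by (auto simp: xy mem_coset_iff)
      then have "x - y \<in> U"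
        using add_subgroup_diff[OF assms(1), of "z - y" "z - x"] by simp
      then show False
        using c coset_eq_iff[OF assms(1)] xy by blast
    qed
  qed (use assms U card_coset in auto)
  then show ?thesis
    by (simp add: U)
qed

lemma card_subgroup_dvd:
  assumes "add_subgroup U" "add_subgroup W" "U \<subseteq> W" "finite W"
  shows "card U dvd card W"
  using card_cosets[OF assms] by (metis dvd_triv_left)

section \<open>Finite abelian p-groups and their composition length\<close>

locale prime_power_group =
  fixes p n :: nat and G :: "'a::ab_group_add set"
  assumes prime: "prime p" and subgroup_G: "add_subgroup G" and finite_G: "finite G"
    and card_G: "card G = p ^ n"
begin

abbreviation sub :: "'a set \<Rightarrow> bool" where
  "sub U \<equiv> add_subgroup U \<and> U \<subseteq> G"

text \<open>The composition length, that is log_p of the order by \<open>card_sub\<close>. It takes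
  the place of a dimension, as \<open>G\<close> need not be a vector space over the field with
  \<open>p\<close> elements.\<close>

definition dm :: "'a set \<Rightarrow> nat" where
  "dm U = multiplicity p (card U)"

lemma p_gt_1: "p > 1"
  using prime prime_gt_1_nat by blast

lemma finite_sub: "U \<subseteq> G \<Longrightarrow> finite U"
  using finite_G finite_subset by blast

lemma card_sub: assumes "sub U" shows "card U = p ^ dm U"
proof -
  have "card U dvd p ^ n"
    using card_subgroup_dvd[of U G] assms subgroup_G finite_G card_G by auto
  then obtain i where "card U = p ^ i"
    using divides_primepow_nat prime by blast
  then show ?thesis
    using prime by (simp add: dm_def multiplicity_same_power)
qed

lemma dm_G: "dm G = n"
  using card_sub[of G] card_G subgroup_G p_gt_1 by simp

lemma dm_mono: assumes "sub U" "sub V" "U \<subseteq> V" shows "dm U \<le> dm V"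
proof -
  have "p ^ dm U \<le> p ^ dm V"
    using assms card_sub card_mono[of V U] finite_sub by metis
  then show ?thesis
    using p_gt_1 by simp
qed

lemma dm_le: "sub U \<Longrightarrow> dm U \<le> n"
  using dm_mono[of U G] dm_G subgroup_G by auto

lemma dm_strict: assumes "sub U" "sub V" "U \<subset> V" shows "dm U < dm V"
proof -
  have "p ^ dm U < p ^ dm V"
    using assms card_sub psubset_card_mono[of V U] finite_sub by metis
  then show ?thesis
    using p_gt_1 by simp
qed

lemma sub_gen: "S \<subseteq> G \<Longrightarrow> sub (gen S)"
  using add_subgroup_gen gen_least subgroup_G by blast

lemma sub_G: "sub G"
  using subgroup_G by simp

lemma sub_0: "sub {0}"
  using subgroup_G by (auto simp: add_subgroup_singleton_0 add_subgroup_zero)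

lemma sub_Int: "sub U \<Longrightarrow> sub V \<Longrightarrow> sub (U \<inter> V)"
  by (auto simp: add_subgroup_Int)

text \<open>Every element taken outside the subgroup reached so far raises its length by at least
  one, so \<open>d\<close> elements suffice. Surplus places are filled with 0, which gives codes of
  a fixed length.\<close>

lemma ex_generators:
  assumes "sub U" "sub V" "U \<subseteq> V" "dm V \<le> dm U + d"
  shows "\<exists>f. f ` {..<d} \<subseteq> V \<and> V = gen (U \<union> f ` {..<d})"
  using assms
proof (induction d arbitrary: U)
  case 0
  then have "U = V"
    using dm_strict[of U V] by auto
  then show ?case
    using 0 by (auto simp: gen_eq)
next
  case (Suc d)
  show ?case
  proof (cases "U = V")
    case True
    have "(\<lambda>_. 0) ` {..<Suc d} \<subseteq> U"
      using Suc by (auto simp: add_subgroup_zero)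
    moreover from this have "U \<union> (\<lambda>_. 0) ` {..<Suc d} = U"
      by blast
    ultimately show ?thesis
      using True Suc by (intro exI[of _ "\<lambda>_. 0"]) (auto simp: gen_eq)
  next
    case False
    then obtain x where x: "x \<in> V" "x \<notin> U"
      using Suc by blast
    let ?U = "gen (insert x U)"
    have U: "sub ?U"
      using sub_gen[of "insert x U"] Suc x by blast
    have "U \<subset> ?U"
      using x hull_inc[of x "insert x U" add_subgroup] hull_subset[of "insert x U" add_subgroup] by blast
    then have "dm U < dm ?U"
      using dm_strict Suc U by blast
    moreover have UV: "?U \<subseteq> V"
      using Suc x gen_least[of "insert x U" V] by blast
    ultimately obtain f where f: "f ` {..<d} \<subseteq> V" "V = gen (?U \<union> f ` {..<d})"
      using Suc.IH[of ?U] U Suc.prems by auto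
    let ?f = "f(d := x)"
    have "?f ` {..<Suc d} = insert x (f ` {..<d})"
      by (auto simp: lessThan_Suc)
    then show ?thesis
      using f x by (intro exI[of _ ?f]) (simp add: gen_Un_gen)
  qed
qed

end

lemma card_le_fibers:
  assumes "finite B" "f ` S \<subseteq> B"
    and "\<And>b. b \<in> B \<Longrightarrow> finite {s\<in>S. f s = b} \<and> card {s\<in>S. f s = b} \<le> c"
  shows "finite S \<and> card S \<le> card B * c"
proof -
  have S: "S = (\<Union>b\<in>B. {s\<in>S. f s = b})"
    using assms(2) by blast
  have "finite (\<Union>b\<in>B. {s\<in>S. f s = b})"
    using assms by blast
  moreover have "card (\<Union>b\<in>B. {s\<in>S. f s = b}) \<le> (\<Sum>b\<in>B. card {s\<in>S. f s = b})"
    by (rule card_UN_le) (use assms in simp)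
  moreover have "(\<Sum>b\<in>B. card {s\<in>S. f s = b}) \<le> card B * c"
    using sum_bounded_above[of B "\<lambda>b. card {s\<in>S. f s = b}" c] assms(3) by simp
  ultimately show ?thesis
    using S by auto
qed

lemma card_PiE_lessThan_le:
  assumes "\<And>i. i < N \<Longrightarrow> finite (T i)" "\<And>i. i < N \<Longrightarrow> card (T i) \<le> c"
  shows "finite (PiE {..<N} T) \<and> card (PiE {..<N::nat} T) \<le> c ^ N"
proof -
  have "(\<Prod>i<N. card (T i)) \<le> (\<Prod>i<N. c)"
    by (rule prod_mono) (use assms in auto)
  then show ?thesis
    using assms by (auto simp: card_PiE intro!: finite_PiE)
qed

section \<open>Counting homomorphisms of small rank\<close>

context prime_power_group
begin

lemma card_coset_image:
  assumes "sub U" "sub W" "U \<subseteq> W"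
  shows "card (coset U ` W) = p ^ (dm W - dm U)"
proof -
  have "dm U \<le> dm W"
    using assms dm_mono by blast
  have "p ^ dm U * card (coset U ` W) = p ^ dm W"
    using card_cosets[of U W] assms finite_sub card_sub by metis
  also have "\<dots> = p ^ dm U * p ^ (dm W - dm U)"
    using \<open>dm U \<le> dm W\<close> by (simp flip: power_add)
  finally show ?thesis
    using p_gt_1 by simp
qed

text \<open>Contains the homomorphisms from \<open>G\<close> to G/U whose image has length at most
  \<open>k\<close>, each written as the table of its values on \<open>n\<close> generators of
  \<open>G\<close>; W/U is a group that contains the image.\<close>

definition low_rank_maps :: "'a set \<Rightarrow> nat \<Rightarrow> (nat \<Rightarrow> 'a set) set" where
  "low_rank_maps U k = {\<phi> \<in> {..<n} \<rightarrow>\<^sub>E coset U ` G.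
     \<exists>W. sub W \<and> U \<subseteq> W \<and> dm W \<le> dm U + k \<and> (\<forall>l<n. \<phi> l \<in> coset U ` W)}"

text \<open>\<open>W\<close> is given by \<open>k\<close> elements of \<open>G\<close> that generate
  it over \<open>U\<close>, at a cost of \<open>n * k\<close> digits; each of the \<open>n\<close>
  values is then one of at most \<open>p ^ k\<close> cosets.\<close>

lemma card_low_rank_maps:
  assumes "sub U"
  shows "finite (low_rank_maps U k) \<and> card (low_rank_maps U k) \<le> p ^ (2 * n * k)"
proof -
  let ?W = "\<lambda>f. gen (U \<union> f ` {..<k})"
  define F where "F = {f \<in> {..<k} \<rightarrow>\<^sub>E G. dm (?W f) \<le> dm U + k}"
  have G: "finite ({..<k} \<rightarrow>\<^sub>E G) \<and> card ({..<k} \<rightarrow>\<^sub>E G) \<le> (p ^ n) ^ k"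
    by (rule card_PiE_lessThan_le) (use finite_G card_G in auto)
  have F: "finite F" "card F \<le> (p ^ n) ^ k"
    using G card_mono[of "{..<k} \<rightarrow>\<^sub>E G" F] by (auto simp: F_def)
  have sub: "low_rank_maps U k \<subseteq> (\<Union>f\<in>F. {..<n} \<rightarrow>\<^sub>E coset U ` ?W f)"
  proof
    fix \<phi> assume "\<phi> \<in> low_rank_maps U k"
    then obtain W where W: "sub W" "U \<subseteq> W" "dm W \<le> dm U + k" "\<And>l. l < n \<Longrightarrow> \<phi> l \<in> coset U ` W"
      and \<phi>: "\<phi> \<in> {..<n} \<rightarrow>\<^sub>E coset U ` G"
      by (auto simp: low_rank_maps_def)
    obtain f where f: "f ` {..<k} \<subseteq> W" "W = gen (U \<union> f ` {..<k})"
      using ex_generators[of U W k] W assms by blast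
    define f' where "f' = restrict f {..<k}"
    have f': "f' ` {..<k} = f ` {..<k}"
      by (auto simp: f'_def)
    have W': "?W f' = W"
      using f(2) unfolding f' by (rule sym)
    have "f' \<in> {..<k} \<rightarrow>\<^sub>E G"
      unfolding f'_def restrict_PiE_iff using f(1) W(1) by blast
    then have "f' \<in> F"
      using W(3) by (simp add: F_def W')
    moreover have "\<phi> \<in> {..<n} \<rightarrow>\<^sub>E coset U ` ?W f'"
      unfolding W' using W(4) \<phi> by (auto simp: PiE_iff)
    ultimately show "\<phi> \<in> (\<Union>f\<in>F. {..<n} \<rightarrow>\<^sub>E coset U ` ?W f)"
      by blast
  qed
  have *: "finite ({..<n} \<rightarrow>\<^sub>E coset U ` ?W f)
      \<and> card ({..<n} \<rightarrow>\<^sub>E coset U ` ?W f) \<le> (p ^ k) ^ n" if "f \<in> F" for f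
  proof (rule card_PiE_lessThan_le)
    have W: "sub (?W f)"
      by (rule sub_gen) (use that assms in \<open>auto simp: F_def\<close>)
    then show "finite (coset U ` ?W f)"
      using finite_sub by blast
    have "U \<subseteq> ?W f"
      using hull_subset[of "U \<union> f ` {..<k}" add_subgroup] by blast
    then have "card (coset U ` ?W f) = p ^ (dm (?W f) - dm U)"
      using card_coset_image W assms by blast
    also have "\<dots> \<le> p ^ k"
    proof (rule power_increasing)
      have "dm (?W f) \<le> dm U + k"
        using that by (simp add: F_def)
      then show "dm (?W f) - dm U \<le> k"
        by arith
    qed (use p_gt_1 in simp)
    finally show "card (coset U ` ?W f) \<le> p ^ k" .
  qed
  have "card (\<Union>f\<in>F. {..<n} \<rightarrow>\<^sub>E coset U ` ?W f) \<le> (\<Sum>f\<in>F. (p ^ k) ^ n)"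
    by (rule order_trans[OF card_UN_le[OF F(1)] sum_mono]) (use * in blast)
  also have "(\<Sum>f\<in>F. (p ^ k) ^ n) \<le> (p ^ n) ^ k * (p ^ k) ^ n"
    using F by simp
  also have "(p ^ n) ^ k * (p ^ k) ^ n = p ^ (2 * n * k)"
  proof -
    have "n * k + k * n = 2 * n * k"
      by simp
    then show ?thesis
      by (simp only: flip: power_mult power_add)
  qed
  finally have le: "card (\<Union>f\<in>F. {..<n} \<rightarrow>\<^sub>E coset U ` ?W f) \<le> p ^ (2 * n * k)" .
  have fin: "finite (\<Union>f\<in>F. {..<n} \<rightarrow>\<^sub>E coset U ` ?W f)"
    using F(1) * by blast
  show ?thesis
    using finite_subset[OF sub fin] order_trans[OF card_mono[OF fin sub] le] by simp
qed

end

section \<open>Nilpotent multiplications on a fixed group\<close>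

lemma gen_insert_0: "gen (insert 0 S) = gen S"
proof
  show "gen (insert 0 S) \<subseteq> gen S"
    using hull_subset[of S add_subgroup] add_subgroup_zero[OF add_subgroup_gen]
    by (intro gen_least add_subgroup_gen) blast
qed (auto intro: hull_mono[THEN subsetD])

lemma additive_diff_mem:
  assumes "add_subgroup G" "G = gen S" "add_subgroup U"
    and "\<And>x y. x \<in> G \<Longrightarrow> y \<in> G \<Longrightarrow> f (x - y) = f x - f y"
    and "\<And>x y. x \<in> G \<Longrightarrow> y \<in> G \<Longrightarrow> h (x - y) = h x - h y"
    and "\<And>s. s \<in> S \<Longrightarrow> f s - h s \<in> U" "x \<in> G"
  shows "f x - h x \<in> U"
  by (rule gen_additive_mem[where f = "\<lambda>x. f x - h x" and G = G and S = S])
     (use assms hull_subset[of S add_subgroup] in auto)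

lemma additive_eq:
  fixes f h :: "'a::ab_group_add \<Rightarrow> 'b::ab_group_add"
  assumes "add_subgroup G" "G = gen S"
    and "\<And>x y. x \<in> G \<Longrightarrow> y \<in> G \<Longrightarrow> f (x - y) = f x - f y"
    and "\<And>x y. x \<in> G \<Longrightarrow> y \<in> G \<Longrightarrow> h (x - y) = h x - h y"
    and "\<And>s. s \<in> S \<Longrightarrow> f s = h s" "x \<in> G"
  shows "f x = h x"
proof -
  have "f x - h x \<in> {0}"
    by (rule additive_diff_mem[OF assms(1,2) add_subgroup_singleton_0])
       (use assms(3-6) in auto)
  then show ?thesis
    by simp
qed

text \<open>The normalisation outside \<open>G\<close> makes the multiplications on \<open>G\<close> a finite set of functions.\<close>

locale ring_on =
  fixes G :: "'a::ab_group_add set" and m :: "'a \<Rightarrow> 'a \<Rightarrow> 'a" (infixl "\<odot>" 70)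
  assumes subgroup: "add_subgroup G" and fin: "finite G"
    and closed_on: "x \<in> G \<Longrightarrow> y \<in> G \<Longrightarrow> x \<odot> y \<in> G"
    and outside: "x \<notin> G \<or> y \<notin> G \<Longrightarrow> x \<odot> y = 0"
    and diff_left: "x \<in> G \<Longrightarrow> y \<in> G \<Longrightarrow> z \<in> G \<Longrightarrow> (x - y) \<odot> z = x \<odot> z - y \<odot> z"
    and diff_right: "x \<in> G \<Longrightarrow> y \<in> G \<Longrightarrow> z \<in> G \<Longrightarrow> z \<odot> (x - y) = z \<odot> x - z \<odot> y"
    and assoc_on: "x \<in> G \<Longrightarrow> y \<in> G \<Longrightarrow> z \<in> G \<Longrightarrow> (x \<odot> y) \<odot> z = x \<odot> (y \<odot> z)"
begin

lemma zero_mem [simp]: "0 \<in> G"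
  using subgroup by (rule add_subgroup_zero)

lemma diff_mem [simp]: "x \<in> G \<Longrightarrow> y \<in> G \<Longrightarrow> x - y \<in> G"
  using subgroup by (rule add_subgroup_diff)

lemma add_mem [simp]: "x \<in> G \<Longrightarrow> y \<in> G \<Longrightarrow> x + y \<in> G"
  using subgroup by (rule add_subgroup_add)

lemma closed [simp]: "x \<odot> y \<in> G"
  using closed_on outside by (cases "x \<in> G \<and> y \<in> G") auto

lemma mult_zero_right [simp]: "x \<odot> 0 = 0"
  using diff_right[of 0 0 x] outside[of x 0] by (cases "x \<in> G") auto

lemma mult_zero_left [simp]: "0 \<odot> x = 0"
  using diff_left[of 0 0 x] outside[of 0 x] by (cases "x \<in> G") auto

lemma assoc: "(x \<odot> y) \<odot> z = x \<odot> (y \<odot> z)"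
  using assoc_on outside by (cases "x \<in> G \<and> y \<in> G \<and> z \<in> G") auto

lemma add_left: "x \<in> G \<Longrightarrow> y \<in> G \<Longrightarrow> z \<in> G \<Longrightarrow> (x + y) \<odot> z = x \<odot> z + y \<odot> z"
  using diff_left[of "x + y" y z] by simp

lemma add_right: "x \<in> G \<Longrightarrow> y \<in> G \<Longrightarrow> z \<in> G \<Longrightarrow> z \<odot> (x + y) = z \<odot> x + z \<odot> y"
  using diff_right[of "x + y" y z] by simp

end

section \<open>Products with a subset, and the comparison of two multiplications\<close>

text \<open>The groups A G and, below, G A of the overview; the side in the name is the side of
  \<open>A\<close>.\<close>

definition left_span :: "'a::ab_group_add set \<Rightarrow> ('a \<Rightarrow> 'a \<Rightarrow> 'a) \<Rightarrow> 'a set \<Rightarrow> 'a set" where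
  "left_span G m A = gen (\<Union>a\<in>A. m a ` G)"

definition right_span :: "'a::ab_group_add set \<Rightarrow> ('a \<Rightarrow> 'a \<Rightarrow> 'a) \<Rightarrow> 'a set \<Rightarrow> 'a set" where
  "right_span G m A = gen (\<Union>a\<in>A. (\<lambda>y. m y a) ` G)"

text \<open>
  For a finite ring this condition, a form of Nakayama's lemma, is equivalent to nilpotency.
\<close>

definition nilp :: "'a::ab_group_add set \<Rightarrow> ('a \<Rightarrow> 'a \<Rightarrow> 'a) \<Rightarrow> bool" where
  "nilp G m \<longleftrightarrow> (\<forall>D. add_subgroup D \<and> D \<subseteq> G \<and>
     D \<subseteq> gen ((\<Union>x\<in>G. m x ` D) \<union> (\<Union>x\<in>G. (\<lambda>y. m y x) ` D)) \<longrightarrow> D = {0})"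

text \<open>A factor \<open>a\<close> from \<open>A\<close> moves out of \<Delta>: as
  \<open>m\<close> and \<open>m'\<close> agree on products with \<open>a\<close>, associativity
  gives \<Delta>(a z, y) = a \<Delta>(z, y) and \<Delta>(y, z a) = \<Delta>(y, z) a. Hence \<Delta>
  has its value in \<open>K\<close>, which is G D + D G, as soon as the first argument lies in A G
  or the second in G A.\<close>

lemma nilp_mult_eqI:
  fixes m m' :: "'a::ab_group_add \<Rightarrow> 'a \<Rightarrow> 'a"
  assumes m: "ring_on G m" "nilp G m" and m': "ring_on G m'"
    and A: "A \<subseteq> G" "\<And>a y. a \<in> A \<Longrightarrow> y \<in> G \<Longrightarrow> m' a y = m a y \<and> m' y a = m y a"
    and G: "G = gen (left_span G m A \<inter> right_span G m A \<union> X)" "X \<subseteq> G"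
    and X: "\<And>x y. x \<in> X \<Longrightarrow> y \<in> X \<Longrightarrow> m x y = m' x y"
  shows "m = m'"
proof -
  interpret R: ring_on G m by fact
  interpret R': ring_on G m' by fact
  define \<Delta> where "\<Delta> x y = m x y - m' x y" for x y
  define D where "D = gen {\<Delta> x y |x y. x \<in> G \<and> y \<in> G}"
  define K where "K = gen ((\<Union>x\<in>G. m x ` D) \<union> (\<Union>x\<in>G. (\<lambda>y. m y x) ` D))"
  have K: "add_subgroup K"
    unfolding K_def by (rule add_subgroup_gen)
  have \<Delta>D: "\<Delta> x y \<in> D" if "x \<in> G" "y \<in> G" for x y
    unfolding D_def by (rule hull_inc) (use that in blast)
  have DG: "D \<subseteq> G"
    unfolding D_def by (rule gen_least) (auto simp: \<Delta>_def R.subgroup)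
  have KL: "m a d \<in> K" "m d a \<in> K" if "a \<in> G" "d \<in> D" for a d
    unfolding K_def by (rule hull_inc, use that in blast)+
  have dl: "\<Delta> (x - y) z = \<Delta> x z - \<Delta> y z" "\<Delta> z (x - y) = \<Delta> z x - \<Delta> z y"
    if "x \<in> G" "y \<in> G" "z \<in> G" for x y z
    using that by (simp_all add: \<Delta>_def R.diff_left R'.diff_left R.diff_right R'.diff_right)
  have left: "\<Delta> x y \<in> K" if x: "x \<in> left_span G m A" and y: "y \<in> G" for x y
  proof (rule gen_additive_mem[where f = "\<lambda>x. \<Delta> x y" and G = G and S = "\<Union>a\<in>A. m a ` G"])
    fix s assume "s \<in> (\<Union>a\<in>A. m a ` G)"
    then obtain a z where az: "a \<in> A" "z \<in> G" "s = m a z" by blast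
    have "\<Delta> s y = m a (m z y) - m' (m' a z) y"
      using az A by (simp add: \<Delta>_def R.assoc)
    also have "\<dots> = m a (m z y) - m a (m' z y)"
      using A(2)[OF az(1), of "m' z y"] by (simp add: R'.assoc)
    also have "\<dots> = m a (\<Delta> z y)"
      using az A by (simp add: \<Delta>_def R.diff_right subset_eq)
    finally show "\<Delta> s y \<in> K"
      using KL(1)[of a "\<Delta> z y"] \<Delta>D az y A by auto
  qed (use x y dl K R.subgroup in \<open>auto simp: left_span_def\<close>)
  have right: "\<Delta> y x \<in> K" if x: "x \<in> right_span G m A" and y: "y \<in> G" for x y
  proof (rule gen_additive_mem[where f = "\<lambda>x. \<Delta> y x" and G = G and S = "\<Union>a\<in>A. (\<lambda>y. m y a) ` G"])
    fix s assume "s \<in> (\<Union>a\<in>A. (\<lambda>y. m y a) ` G)"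
    then obtain a z where az: "a \<in> A" "z \<in> G" "s = m z a" by blast
    have "\<Delta> y s = m (m y z) a - m' y (m' z a)"
      using az A by (simp add: \<Delta>_def R.assoc)
    also have "\<dots> = m (m y z) a - m (m' y z) a"
      using A(2)[OF az(1), of "m' y z"] by (simp flip: R'.assoc)
    also have "\<dots> = m (\<Delta> y z) a"
      using az A by (simp add: \<Delta>_def R.diff_left subset_eq)
    finally show "\<Delta> y s \<in> K"
      using KL(2)[of a "\<Delta> y z"] \<Delta>D az y A by auto
  qed (use x y dl K R.subgroup in \<open>auto simp: right_span_def\<close>)
  have Q: "left_span G m A \<subseteq> G"
    unfolding left_span_def by (rule gen_least) (auto simp: R.subgroup)
  \<comment> \<open>The same generating set serves for both arguments, so its part outside
    \<open>X\<close> has to be absorbed in either place: by \<open>left\<close> in the first and by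
    \<open>right\<close> in the second.\<close>
  have all: "\<Delta> x y \<in> K" if x: "x \<in> G" and y: "y \<in> G" for x y
  proof (rule gen_additive_mem[where f = "\<lambda>x. \<Delta> x y" and G = G
        and S = "left_span G m A \<inter> right_span G m A \<union> X"])
    fix s assume s: "s \<in> left_span G m A \<inter> right_span G m A \<union> X"
    show "\<Delta> s y \<in> K"
    proof (cases "s \<in> left_span G m A")
      case False
      then have sX: "s \<in> X" "s \<in> G"
        using s G(2) by auto
      show ?thesis
      proof (rule gen_additive_mem[where f = "\<lambda>y. \<Delta> s y" and G = G
            and S = "left_span G m A \<inter> right_span G m A \<union> X"])
        fix t assume t: "t \<in> left_span G m A \<inter> right_span G m A \<union> X"
        show "\<Delta> s t \<in> K"
        proof (cases "t \<in> X")
          case True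
          then show ?thesis
            using X sX add_subgroup_zero[OF K] by (simp add: \<Delta>_def)
        qed (use right sX t in auto)
      qed (use sX y dl K R.subgroup Q G(2) G(1)[symmetric] in auto)
    qed (use left y in auto)
  qed (use x y dl K R.subgroup Q G(2) G(1)[symmetric] in auto)
  have "D \<subseteq> K"
    unfolding D_def by (rule gen_least) (use all K in auto)
  moreover have "add_subgroup D"
    unfolding D_def by (rule add_subgroup_gen)
  ultimately have "D = {0}"
    using m(2) DG unfolding nilp_def K_def by blast
  then have "m x y = m' x y" if "x \<in> G" "y \<in> G" for x y
    using \<Delta>D that by (auto simp: \<Delta>_def)
  then show ?thesis
    using R.outside R'.outside by (intro ext) metis
qed

lemma left_span_mono: "A \<subseteq> B \<Longrightarrow> left_span G m A \<subseteq> left_span G m B"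
  unfolding left_span_def by (rule hull_mono) blast

lemma right_span_mono: "A \<subseteq> B \<Longrightarrow> right_span G m A \<subseteq> right_span G m B"
  unfolding right_span_def by (rule hull_mono) blast

section \<open>The greedy choice of A\<close>

context prime_power_group
begin

lemma sub_spans:
  assumes "ring_on G m"
  shows "sub (left_span G m A)" "sub (right_span G m A)"
  unfolding left_span_def right_span_def
  by (intro sub_gen, use ring_on.closed[OF assms] in blast)+

text \<open>An element violating the conclusion would raise the length of A G or of G A by more than
  \<open>k\<close>. Take a largest set in which every element beyond the first has paid
  \<open>k\<close> towards the sum of the two lengths. This sum is at most 2 n \<le> 2 k^2, so at
  most 2 k elements have paid.\<close>

lemma ex_span_saturated:
  assumes m: "ring_on G m" and k: "1 \<le> k" "n \<le> k\<^sup>2"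
  shows "\<exists>A. A \<subseteq> G \<and> A \<noteq> {} \<and> card A \<le> 2 * k + 1 \<and>
    (\<forall>x\<in>G. dm (gen (left_span G m A \<union> m x ` G)) \<le> dm (left_span G m A) + k) \<and>
    (\<forall>x\<in>G. dm (gen (right_span G m A \<union> (\<lambda>y. m y x) ` G)) \<le> dm (right_span G m A) + k)"
proof -
  define L where "L = left_span G m"
  define R where "R = right_span G m"
  \<comment> \<open>The element 0 is the one that pays nothing: it starts the process and keeps
    \<open>A\<close> nonempty.\<close>
  define P where "P A \<longleftrightarrow> 0 \<in> A \<and> A \<subseteq> G \<and> k * (card A - 1) \<le> dm (L A) + dm (R A)" for A
  have "P {0}"
    using add_subgroup_zero[OF subgroup_G] by (simp add: P_def)
  moreover have "\<forall>A. P A \<longrightarrow> card A < Suc (card G)"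
    using card_mono[OF finite_G] by (simp add: P_def le_imp_less_Suc)
  ultimately obtain A where A: "P A" and max: "\<And>B. P B \<Longrightarrow> card B \<le> card A"
    using ex_has_greatest_nat[of P "{0}" card "Suc (card G)"] by blast
  have sub: "sub (L B)" "sub (R B)" for B
    using sub_spans[OF m] by (auto simp: L_def R_def)
  have finA: "finite A"
    using A finite_sub by (auto simp: P_def)
  have cA: "card A > 0"
    using A finA by (auto simp: P_def card_gt_0_iff)
  have False if x: "x \<in> G" "x \<notin> A"
    and gain: "dm (L A) + dm (R A) + k \<le> dm (L (insert x A)) + dm (R (insert x A))" for x
  proof -
    have "k * (card (insert x A) - 1) = k * (card A - 1) + k"
      using x finA cA by (cases "card A") auto
    also have "\<dots> \<le> dm (L (insert x A)) + dm (R (insert x A))"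
      using A gain by (simp add: P_def)
    finally have "P (insert x A)"
      using A x by (auto simp: P_def)
    then show False
      using max[of "insert x A"] x finA by simp
  qed note no_gain = this
  have incl: "L A \<subseteq> L (insert x A)" "R A \<subseteq> R (insert x A)" for x
    unfolding L_def R_def by (intro left_span_mono right_span_mono subset_insertI)+
  have mono: "dm (L A) \<le> dm (L (insert x A))" "dm (R A) \<le> dm (R (insert x A))" for x
    using sub dm_mono incl by blast+
  have left: "dm (gen (L A \<union> m x ` G)) \<le> dm (L A) + k" if x: "x \<in> G" for x
  proof (rule ccontr)
    assume gt: "\<not> ?thesis"
    have mx: "m y ` G \<subseteq> L B" if "y \<in> B" for y B
      using that hull_subset[of "\<Union>a\<in>B. m a ` G" add_subgroup] unfolding L_def left_span_def by blast
    have "x \<notin> A"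
      using mx[of x A] gt gen_eq[of "L A"] sub by (auto simp: Un_absorb2)
    have "gen (L A \<union> m x ` G) \<subseteq> L (insert x A)"
      using mx[of x "insert x A"] sub incl[of x] by (intro gen_least) auto
    moreover have "sub (gen (L A \<union> m x ` G))"
      using sub ring_on.closed[OF m] by (intro sub_gen) blast
    ultimately have "dm (gen (L A \<union> m x ` G)) \<le> dm (L (insert x A))"
      using sub dm_mono by blast
    then show False
      using no_gain[OF x \<open>x \<notin> A\<close>] gt mono[of x] by linarith
  qed
  have right: "dm (gen (R A \<union> (\<lambda>y. m y x) ` G)) \<le> dm (R A) + k" if x: "x \<in> G" for x
  proof (rule ccontr)
    assume gt: "\<not> ?thesis"
    have mx: "(\<lambda>z. m z y) ` G \<subseteq> R B" if "y \<in> B" for y B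
      using that hull_subset[of "\<Union>a\<in>B. (\<lambda>y. m y a) ` G" add_subgroup]
      unfolding R_def right_span_def by blast
    have "x \<notin> A"
      using mx[of x A] gt gen_eq[of "R A"] sub by (auto simp: Un_absorb2)
    have "gen (R A \<union> (\<lambda>y. m y x) ` G) \<subseteq> R (insert x A)"
      using mx[of x "insert x A"] sub incl[of x] by (intro gen_least) auto
    moreover have "sub (gen (R A \<union> (\<lambda>y. m y x) ` G))"
      using sub ring_on.closed[OF m] by (intro sub_gen) blast
    ultimately have "dm (gen (R A \<union> (\<lambda>y. m y x) ` G)) \<le> dm (R (insert x A))"
      using sub dm_mono by blast
    then show False
      using no_gain[OF x \<open>x \<notin> A\<close>] gt mono[of x] by linarith
  qed
  have "k * (card A - 1) \<le> n + n"
    using A dm_le sub by (meson P_def add_mono le_trans)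
  also have "\<dots> \<le> k * (2 * k)"
    using k by (simp add: power2_eq_square)
  finally have "card A - 1 \<le> 2 * k"
    using k by (simp del: mult_le_cancel1 add: mult_le_cancel1)
  then have "card A \<le> 2 * k + 1"
    by simp
  then show ?thesis
    using A left right by (intro exI[of _ A]) (auto simp: P_def L_def R_def)
qed

lemma ex_gens: "\<exists>\<gamma>. \<gamma> ` {..<n} \<subseteq> G \<and> G = gen (\<gamma> ` {..<n})"
proof -
  obtain \<gamma> where "\<gamma> ` {..<n} \<subseteq> G" "G = gen ({0} \<union> \<gamma> ` {..<n})"
    using ex_generators[of "{0}" G n] sub_0 sub_G dm_G by auto
  then show ?thesis
    using gen_insert_0[of "\<gamma> ` {..<n}"] by auto
qed

end

text \<open>Repetitions pad \<open>A\<close> to a tuple of fixed length \<open>K\<close>, so that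
  the choices of \<open>A\<close> can be counted as functions.\<close>

lemma ex_surj_lessThan:
  assumes "finite A" "A \<noteq> {}" "card A \<le> K"
  shows "\<exists>a \<in> {..<K} \<rightarrow>\<^sub>E A. a ` {..<K::nat} = A"
proof -
  obtain h where h: "bij_betw h {0..<card A} A"
    using ex_bij_betw_nat_finite[OF assms(1)] by blast
  have "card A > 0"
    using assms by (simp add: card_gt_0_iff)
  define a where "a = restrict (\<lambda>i. if i < card A then h i else h 0) {..<K}"
  have a: "a i = h i" if "i < card A" for i
    using that assms by (simp add: a_def)
  have "h i \<in> A" if "i < card A" for i
    using h that by (auto simp: bij_betw_def)
  then have aA: "a \<in> {..<K} \<rightarrow>\<^sub>E A"
    using \<open>card A > 0\<close> by (auto simp: a_def)
  moreover have "A \<subseteq> a ` {..<K}"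
  proof
    fix x assume "x \<in> A"
    then have "x \<in> h ` {0..<card A}"
      using h by (simp add: bij_betw_def)
    then obtain i where "i < card A" "x = h i"
      by auto
    then show "x \<in> a ` {..<K}"
      using a assms by (intro image_eqI[of _ _ i]) auto
  qed
  ultimately show ?thesis
    by (intro bexI[of _ a]) auto
qed

text \<open>The difference of the two sides is (d - 2 q)^2 (4 d + q). It vanishes at d = 2 q, the
  proportion used in the lower bound.\<close>

lemma AM_GM_cubic: "27 * (q * d\<^sup>2) \<le> 4 * (q + d :: nat) ^ 3"
proof -
  have "4 * (int q + int d) ^ 3 - 27 * (int q * (int d)\<^sup>2) = (int d - 2 * int q)\<^sup>2 * (4 * int d + int q)"
    by (simp add: power2_eq_square power3_eq_cube algebra_simps)
  also have "\<dots> \<ge> 0"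
    by simp
  finally have "int (27 * (q * d\<^sup>2)) \<le> int (4 * (q + d) ^ 3)"
    by simp
  then show ?thesis
    by (simp only: of_nat_le_iff)
qed

section \<open>Counting nilpotent multiplications\<close>

context prime_power_group
begin

lemma mult_eq_on_gens:
  assumes m: "ring_on G m" and m': "ring_on G m'" and \<gamma>: "G = gen (\<gamma> ` {..<n})"
    and "a \<in> G" "y \<in> G"
  shows "(\<And>l. l < n \<Longrightarrow> m a (\<gamma> l) = m' a (\<gamma> l)) \<Longrightarrow> m a y = m' a y"
    and "(\<And>l. l < n \<Longrightarrow> m (\<gamma> l) a = m' (\<gamma> l) a) \<Longrightarrow> m y a = m' y a"
proof -
  interpret R: ring_on G m by fact
  interpret R': ring_on G m' by fact
  show "m a y = m' a y" if "\<And>l. l < n \<Longrightarrow> m a (\<gamma> l) = m' a (\<gamma> l)"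
    using subgroup_G \<gamma>
    by (rule additive_eq) (use that assms in \<open>auto simp: R.diff_right R'.diff_right\<close>)
  show "m y a = m' y a" if "\<And>l. l < n \<Longrightarrow> m (\<gamma> l) a = m' (\<gamma> l) a"
    using subgroup_G \<gamma>
    by (rule additive_eq[where f = "\<lambda>y. m y a" and h = "\<lambda>y. m' y a"])
       (use that assms in \<open>auto simp: R.diff_left R'.diff_left\<close>)
qed

lemma low_rank_map_mult:
  assumes m: "ring_on G m" and \<gamma>: "\<gamma> ` {..<n} \<subseteq> G" and U: "sub U" and x: "x \<in> G"
  shows "dm (gen (U \<union> m x ` G)) \<le> dm U + k
      \<Longrightarrow> (\<lambda>l\<in>{..<n}. coset U (m x (\<gamma> l))) \<in> low_rank_maps U k"
    and "dm (gen (U \<union> (\<lambda>y. m y x) ` G)) \<le> dm U + k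
      \<Longrightarrow> (\<lambda>l\<in>{..<n}. coset U (m (\<gamma> l) x)) \<in> low_rank_maps U k"
proof -
  have *: "(\<lambda>l\<in>{..<n}. coset U (f (\<gamma> l))) \<in> low_rank_maps U k"
    if f: "\<And>y. f y \<in> G" and "dm (gen (U \<union> f ` G)) \<le> dm U + k" for f
  proof -
    have "sub (gen (U \<union> f ` G))"
      using U f by (intro sub_gen) blast
    moreover have "U \<union> f ` G \<subseteq> gen (U \<union> f ` G)"
      by (rule hull_subset)
    moreover from this have "f (\<gamma> l) \<in> gen (U \<union> f ` G)" if "l < n" for l
      using \<gamma> that by blast
    ultimately show ?thesis
      using that unfolding low_rank_maps_def
      by (auto intro!: exI[of _ "gen (U \<union> f ` G)"])
  qed
  show "dm (gen (U \<union> m x ` G)) \<le> dm U + k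
      \<Longrightarrow> (\<lambda>l\<in>{..<n}. coset U (m x (\<gamma> l))) \<in> low_rank_maps U k"
    using *[of "m x"] ring_on.closed[OF m] by simp
  show "dm (gen (U \<union> (\<lambda>y. m y x) ` G)) \<le> dm U + k
      \<Longrightarrow> (\<lambda>l\<in>{..<n}. coset U (m (\<gamma> l) x)) \<in> low_rank_maps U k"
    using *[of "\<lambda>y. m y x"] ring_on.closed[OF m] by simp
qed

text \<open>By \<open>nilp_mult_eqI\<close> a member of \<open>S\<close> is determined by the
  products of the d = n - dm Q generators of \<open>G\<close> modulo \<open>Q\<close>. Each of these
  d^2 products lies in a fixed coset of \<open>Q\<close>, which leaves \<open>dm Q\<close> digits
  for it.\<close>

lemma card_mult_fibre:
  assumes Q: "sub Q"
    and S: "\<And>m. m \<in> S \<Longrightarrow> ring_on G m \<and> nilp G m"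
    and AQ: "A \<subseteq> G" "\<And>m. m \<in> S \<Longrightarrow> left_span G m A \<inter> right_span G m A = Q"
    and A: "\<And>m m' a y. m \<in> S \<Longrightarrow> m' \<in> S \<Longrightarrow> a \<in> A \<Longrightarrow> y \<in> G \<Longrightarrow> m' a y = m a y \<and> m' y a = m y a"
    and eq: "\<And>m m' x y. m \<in> S \<Longrightarrow> m' \<in> S \<Longrightarrow> x \<in> G \<Longrightarrow> y \<in> G \<Longrightarrow> m x y - m' x y \<in> Q"
  shows "finite S \<and> card S \<le> p ^ (4 * n ^ 3 div 27)"
proof (cases "S = {}")
  case False
  then obtain m0 where m0: "m0 \<in> S" by blast
  define d where "d = n - dm Q"
  have d: "dm Q + d = n"
    using dm_le[OF Q] by (simp add: d_def)
  obtain X where X: "X ` {..<d} \<subseteq> G" "G = gen (Q \<union> X ` {..<d})"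
    using ex_generators[of Q G d] Q sub_G dm_G d by auto
  define B where "B = (\<Pi>\<^sub>E i\<in>{..<d}. \<Pi>\<^sub>E j\<in>{..<d}. coset Q (m0 (X i) (X j)))"
  have fin: "finite (coset Q x)" "card (coset Q x) = p ^ dm Q" for x
    using Q finite_sub by (simp_all add: card_coset card_sub) (simp add: coset_def)
  have *: "finite (\<Pi>\<^sub>E j\<in>{..<d}. coset Q (m0 (X i) (X j)))
     \<and> card (\<Pi>\<^sub>E j\<in>{..<d}. coset Q (m0 (X i) (X j))) \<le> (p ^ dm Q) ^ d" for i
    by (rule card_PiE_lessThan_le) (auto simp: fin)
  have B: "finite B \<and> card B \<le> ((p ^ dm Q) ^ d) ^ d"
    unfolding B_def by (rule card_PiE_lessThan_le) (use * in auto)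
  define f where "f m = (\<lambda>i\<in>{..<d}. \<lambda>j\<in>{..<d}. m (X i) (X j))" for m :: "'a \<Rightarrow> 'a \<Rightarrow> 'a"
  have fB: "f ` S \<subseteq> B"
    using eq[OF _ m0] X(1)
    by (auto simp: f_def B_def mem_coset_iff restrict_PiE_iff image_subset_iff simp del: restrict_apply)
  have "inj_on f S"
  proof (rule inj_onI)
    fix m m' assume m: "m \<in> S" "m' \<in> S" "f m = f m'"
    have "m (X i) (X j) = m' (X i) (X j)" if "i < d" "j < d" for i j
      using fun_cong[OF fun_cong[OF m(3)], of i j] that by (simp add: f_def)
    then show "m = m'"
      using m S X AQ A by (intro nilp_mult_eqI[of G m m' A "X ` {..<d}"]) auto
  qed
  then have "finite S" "card S \<le> card B"
    using fB B by (auto intro: inj_on_finite card_inj_on_le)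
  moreover have "27 * (dm Q * d\<^sup>2) \<le> 4 * n ^ 3"
    using AM_GM_cubic[of "dm Q" d] d by simp
  then have "dm Q * d\<^sup>2 \<le> 4 * n ^ 3 div 27"
    by (simp add: less_eq_div_iff_mult_less_eq mult.commute)
  then have "((p ^ dm Q) ^ d) ^ d \<le> p ^ (4 * n ^ 3 div 27)"
    using p_gt_1 by (simp flip: power_mult add: power2_eq_square mult.assoc)
  ultimately show ?thesis
    using B by simp
qed simp

text \<open>The tuple \<open>a\<close> enumerating A costs n K digits and the products of its
  entries with the generators, on both sides, 2 n^2 K. The products of the generators modulo A G and
  G A are 2 n maps of rank at most \<open>k\<close>, at 2 n k digits each. With K = 2 k + 1 \<le> 3
  k and n \<le> n^2 the sum is at most 13 k n^2.\<close>

theorem card_nilp: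
  assumes k: "1 \<le> k" "n \<le> k\<^sup>2"
  shows "finite {m. ring_on G m \<and> nilp G m} \<and>
    card {m. ring_on G m \<and> nilp G m} \<le> p ^ (13 * k * n\<^sup>2 + 4 * n ^ 3 div 27)"
proof -
  define S where "S = {m. ring_on G m \<and> nilp G m}"
  define K where "K = 2 * k + 1"
  define L where "L m a = left_span G m (a ` {..<K})" for m and a :: "nat \<Rightarrow> 'a"
  define R where "R m a = right_span G m (a ` {..<K})" for m and a :: "nat \<Rightarrow> 'a"
  obtain \<gamma> where \<gamma>: "\<gamma> ` {..<n} \<subseteq> G" "G = gen (\<gamma> ` {..<n})"
    using ex_gens by blast
  have S: "ring_on G m" "nilp G m" if "m \<in> S" for m
    using that by (auto simp: S_def)
  have subLR: "sub (L m a)" "sub (R m a)" if "m \<in> S" for m a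
    using sub_spans[OF S(1)[OF that]] by (simp_all add: L_def R_def)
  have "\<exists>a \<in> {..<K} \<rightarrow>\<^sub>E G. \<forall>x\<in>G. dm (gen (L m a \<union> m x ` G)) \<le> dm (L m a) + k \<and>
     dm (gen (R m a \<union> (\<lambda>y. m y x) ` G)) \<le> dm (R m a) + k" if m: "m \<in> S" for m
  proof -
    obtain A where A: "A \<subseteq> G" "A \<noteq> {}" "card A \<le> K"
      "\<And>x. x \<in> G \<Longrightarrow> dm (gen (left_span G m A \<union> m x ` G)) \<le> dm (left_span G m A) + k"
      "\<And>x. x \<in> G \<Longrightarrow> dm (gen (right_span G m A \<union> (\<lambda>y. m y x) ` G)) \<le> dm (right_span G m A) + k"
      using ex_span_saturated[OF S(1)[OF m] k] unfolding K_def by blast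
    then obtain a where "a \<in> {..<K} \<rightarrow>\<^sub>E A" "a ` {..<K} = A"
      using ex_surj_lessThan[of A K] finite_sub by blast
    then show ?thesis
      using A by (intro bexI[of _ a]) (auto simp: L_def R_def)
  qed
  then obtain a where a: "\<And>m. m \<in> S \<Longrightarrow> a m \<in> {..<K} \<rightarrow>\<^sub>E G"
    and aL: "\<And>m x. m \<in> S \<Longrightarrow> x \<in> G \<Longrightarrow> dm (gen (L m (a m) \<union> m x ` G)) \<le> dm (L m (a m)) + k"
    and aR: "\<And>m x. m \<in> S \<Longrightarrow> x \<in> G \<Longrightarrow>
       dm (gen (R m (a m) \<union> (\<lambda>y. m y x) ` G)) \<le> dm (R m (a m)) + k"
    by metis
  define f where "f m = (a m, (\<lambda>i\<in>{..<K}. \<lambda>l\<in>{..<n}. m (a m i) (\<gamma> l)),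
    (\<lambda>i\<in>{..<K}. \<lambda>l\<in>{..<n}. m (\<gamma> l) (a m i)))" for m
  define B where "B = ({..<K} \<rightarrow>\<^sub>E G) \<times> ({..<K} \<rightarrow>\<^sub>E ({..<n} \<rightarrow>\<^sub>E G)) \<times> ({..<K} \<rightarrow>\<^sub>E ({..<n} \<rightarrow>\<^sub>E G))"
  have fB: "f ` S \<subseteq> B"
    unfolding f_def B_def using a ring_on.closed[OF S(1)]
    by (intro image_subsetI SigmaI restrict_PiE_iff[THEN iffD2] ballI) blast+
  have cG: "finite ({..<N} \<rightarrow>\<^sub>E G)" "card ({..<N} \<rightarrow>\<^sub>E G) = p ^ (n * N)" for N :: nat
    by (simp_all add: finite_PiE finite_G card_PiE card_G power_mult)
  have B: "finite B \<and> card B = p ^ (n * K + n * n * K + n * n * K)"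
    by (simp add: B_def cG finite_PiE card_cartesian_product card_PiE add.assoc flip: power_add power_mult)
  define N where "N = p ^ (2 * n * k * n + 2 * n * k * n) * p ^ (4 * n ^ 3 div 27)"
  have fibre: "finite {m\<in>S. f m = b} \<and> card {m\<in>S. f m = b} \<le> N" for b
  proof (cases "{m\<in>S. f m = b} = {}")
    case False
    then obtain m0 where m0: "m0 \<in> S" "f m0 = b" by blast
    define S1 where "S1 = {m\<in>S. f m = b}"
    define a0 where "a0 = a m0"
    define A where "A = a0 ` {..<K}"
    have AG: "A \<subseteq> G"
      using a[OF m0(1)] by (auto simp: A_def a0_def)
    have a_eq: "a m = a0" if "m \<in> S1" for m
      using that m0 by (auto simp: S1_def f_def a0_def)
    have agree: "m c y = m0 c y" "m y c = m0 y c" if m: "m \<in> S1" and c: "c \<in> A" and y: "y \<in> G" for m c y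
    proof -
      obtain i where i: "i < K" "c = a0 i"
        using c by (auto simp: A_def)
      have "f m = f m0"
        using m m0 by (simp add: S1_def)
      then have l: "(\<lambda>i\<in>{..<K}. \<lambda>l\<in>{..<n}. m (a0 i) (\<gamma> l)) = (\<lambda>i\<in>{..<K}. \<lambda>l\<in>{..<n}. m0 (a0 i) (\<gamma> l))"
        and r: "(\<lambda>i\<in>{..<K}. \<lambda>l\<in>{..<n}. m (\<gamma> l) (a0 i)) = (\<lambda>i\<in>{..<K}. \<lambda>l\<in>{..<n}. m0 (\<gamma> l) (a0 i))"
        using a_eq[OF m] by (simp_all add: f_def a0_def)
      have "m c (\<gamma> l) = m0 c (\<gamma> l)" "m (\<gamma> l) c = m0 (\<gamma> l) c" if "l < n" for l
        using fun_cong[OF fun_cong[OF l], of i l] fun_cong[OF fun_cong[OF r], of i l] i that by simp_all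
      then show "m c y = m0 c y" "m y c = m0 y c"
        using mult_eq_on_gens[OF _ _ \<gamma>(2), of m m0 c y] S m m0 c AG y by (auto simp: S1_def)
    qed
    define L0 where "L0 = left_span G m0 A"
    define R0 where "R0 = right_span G m0 A"
    have LR: "left_span G m A = L0" "right_span G m A = R0" if "m \<in> S1" for m
    proof -
      have "(\<Union>c\<in>A. m c ` G) = (\<Union>c\<in>A. m0 c ` G)"
        "(\<Union>c\<in>A. (\<lambda>y. m y c) ` G) = (\<Union>c\<in>A. (\<lambda>y. m0 y c) ` G)"
        using agree[OF that] by (auto simp: image_iff)
      then show "left_span G m A = L0" "right_span G m A = R0"
        by (simp_all add: left_span_def right_span_def L0_def R0_def)
    qed
    have sub0: "sub L0" "sub R0"
      using subLR[OF m0(1), of a0] by (simp_all add: L_def R_def L0_def R0_def A_def)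
    \<comment> \<open>A second round of coding, because the groups \<open>L0\<close> and
      \<open>R0\<close> modulo which products are recorded are known only after the first. In the
      second component the indices are exchanged, so that each row describes a right
      multiplication.\<close>
    define g where "g m = ((\<lambda>i\<in>{..<n}. \<lambda>l\<in>{..<n}. coset L0 (m (\<gamma> i) (\<gamma> l))),
      (\<lambda>i\<in>{..<n}. \<lambda>l\<in>{..<n}. coset R0 (m (\<gamma> l) (\<gamma> i))))" for m
    define C where "C = ({..<n} \<rightarrow>\<^sub>E low_rank_maps L0 k) \<times> ({..<n} \<rightarrow>\<^sub>E low_rank_maps R0 k)"
    have "g m \<in> C" if m: "m \<in> S1" for m
    proof -
      have mS: "m \<in> S"
        using m by (simp add: S1_def)
      have "dm (gen (L0 \<union> m x ` G)) \<le> dm L0 + k" "dm (gen (R0 \<union> (\<lambda>y. m y x) ` G)) \<le> dm R0 + k"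
        if "x \<in> G" for x
        using aL[OF mS that] aR[OF mS that] LR[OF m] a_eq[OF m]
        by (simp_all add: L_def R_def flip: A_def)
      then show ?thesis
        using low_rank_map_mult[OF S(1)[OF mS] \<gamma>(1)] sub0 \<gamma>(1) by (auto simp: g_def C_def)
    qed
    then have gC: "g ` S1 \<subseteq> C"
      by blast
    have lm: "finite ({..<n} \<rightarrow>\<^sub>E low_rank_maps U k) \<and> card ({..<n} \<rightarrow>\<^sub>E low_rank_maps U k) \<le> (p ^ (2 * n * k)) ^ n"
      if "sub U" for U
      by (rule card_PiE_lessThan_le) (use card_low_rank_maps[OF that] in auto)
    have "card C \<le> (p ^ (2 * n * k)) ^ n * (p ^ (2 * n * k)) ^ n"
      unfolding C_def card_cartesian_product using lm sub0 by (intro mult_le_mono) blast+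
    then have C: "finite C" "card C \<le> p ^ (2 * n * k * n + 2 * n * k * n)"
      using lm sub0 by (auto simp: C_def simp flip: power_add power_mult)
    have "finite {m\<in>S1. g m = c} \<and> card {m\<in>S1. g m = c} \<le> p ^ (4 * n ^ 3 div 27)" for c
    proof (rule card_mult_fibre[OF sub_Int[OF sub0]])
      fix m m' x y assume m: "m \<in> {m\<in>S1. g m = c}" "m' \<in> {m\<in>S1. g m = c}" and xy: "x \<in> G" "y \<in> G"
      have mS: "m \<in> S" "m' \<in> S"
        using m by (auto simp: S1_def)
      interpret M: ring_on G m using S mS by blast
      interpret M': ring_on G m' using S mS by blast
      have "g m = g m'"
        using m by simp
      then have l: "(\<lambda>i\<in>{..<n}. \<lambda>l\<in>{..<n}. coset L0 (m (\<gamma> i) (\<gamma> l)))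
          = (\<lambda>i\<in>{..<n}. \<lambda>l\<in>{..<n}. coset L0 (m' (\<gamma> i) (\<gamma> l)))"
        and r: "(\<lambda>i\<in>{..<n}. \<lambda>l\<in>{..<n}. coset R0 (m (\<gamma> l) (\<gamma> i)))
          = (\<lambda>i\<in>{..<n}. \<lambda>l\<in>{..<n}. coset R0 (m' (\<gamma> l) (\<gamma> i)))"
        by (simp_all add: g_def)
      have "coset L0 (m (\<gamma> i) (\<gamma> l)) = coset L0 (m' (\<gamma> i) (\<gamma> l))"
        "coset R0 (m (\<gamma> i) (\<gamma> l)) = coset R0 (m' (\<gamma> i) (\<gamma> l))" if "i < n" "l < n" for i l
        using fun_cong[OF fun_cong[OF l], of i l] fun_cong[OF fun_cong[OF r], of l i] that by simp_all
      then have gens: "m (\<gamma> i) (\<gamma> l) - m' (\<gamma> i) (\<gamma> l) \<in> L0 \<inter> R0" if "i < n" "l < n" for i l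
        using that sub0 by (auto simp: coset_eq_iff)
      have LR0: "add_subgroup (L0 \<inter> R0)"
        using sub_Int[OF sub0] by simp
      have gen_y: "m (\<gamma> i) y - m' (\<gamma> i) y \<in> L0 \<inter> R0" if "i < n" for i
        using subgroup_G \<gamma>(2) LR0
        by (rule additive_diff_mem) (use that gens \<gamma>(1) xy in \<open>auto simp: M.diff_right M'.diff_right\<close>)
      show "m x y - m' x y \<in> L0 \<inter> R0"
      proof (rule additive_diff_mem[where f = "\<lambda>x. m x y" and h = "\<lambda>x. m' x y", OF subgroup_G \<gamma>(2) LR0])
        show "m s y - m' s y \<in> L0 \<inter> R0" if "s \<in> \<gamma> ` {..<n}" for s
          using that gen_y by blast
      qed (use xy in \<open>simp_all add: M.diff_left M'.diff_left\<close>)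
    next
      show "m' c y = m c y \<and> m' y c = m y c"
        if "m \<in> {m\<in>S1. g m = b}" "m' \<in> {m\<in>S1. g m = b}" "c \<in> A" "y \<in> G" for m m' c y b
        using that agree[of m c y] agree[of m' c y] by simp
      show "left_span G m A \<inter> right_span G m A = L0 \<inter> R0" if "m \<in> {m\<in>S1. g m = b}" for m b
        using that LR by simp
    qed (use S AG in \<open>auto simp: S1_def\<close>)
    then have "finite S1 \<and> card S1 \<le> card C * p ^ (4 * n ^ 3 div 27)"
      by (intro card_le_fibers[OF C(1) gC]) auto
    moreover have "card C * p ^ (4 * n ^ 3 div 27) \<le> N"
      unfolding N_def by (rule mult_le_mono1[OF C(2)])
    ultimately show ?thesis
      by (simp add: S1_def)
  qed (auto simp del: Collect_empty_eq)
  have "finite S \<and> card S \<le> card B * N"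
    by (rule card_le_fibers[OF _ fB]) (use B fibre in auto)
  moreover have "card B * N \<le> p ^ (13 * k * n\<^sup>2 + 4 * n ^ 3 div 27)"
  proof -
    have K: "K \<le> 3 * k"
      using k by (simp add: K_def)
    have nK: "n * K \<le> 3 * (k * (n * n))"
      using mult_le_mono[of n "n * n" K "3 * k"] K by (cases n) (auto simp: algebra_simps)
    have nnK: "n * n * K \<le> 3 * (k * (n * n))"
      using mult_le_mono2[OF K, of "n * n"] by (simp add: algebra_simps)
    have "n * K + n * n * K + n * n * K + (2 * n * k * n + 2 * n * k * n)
        \<le> 13 * k * n\<^sup>2"
    proof -
      have "2 * n * k * n = 2 * (k * (n * n))" "13 * k * n\<^sup>2 = 13 * (k * (n * n))"
        by (simp_all add: power2_eq_square)
      then show ?thesis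
        using nK nnK by linarith
    qed
    then show ?thesis
      using p_gt_1 B by (auto simp: N_def simp flip: power_add)
  qed
  ultimately show ?thesis
    by (simp add: S_def)
qed

end

section \<open>The radical of a finite ring\<close>

context ring_on
begin

declare diff_left [simp] diff_right [simp] add_left [simp] add_right [simp]

lemma uminus_mem [simp]: "x \<in> G \<Longrightarrow> - x \<in> G"
  using subgroup by (rule add_subgroup_uminus)

lemma uminus_left: "x \<in> G \<Longrightarrow> y \<in> G \<Longrightarrow> (- x) \<odot> y = - (x \<odot> y)"
  using diff_left[of 0 x y] by simp

lemma uminus_right: "x \<in> G \<Longrightarrow> y \<in> G \<Longrightarrow> y \<odot> (- x) = - (y \<odot> x)"
  using diff_right[of 0 x y] by simp

text \<open>Without a unit, exponents are shifted by one: this is the power with exponent \<open>i + 1\<close>.\<close>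

definition pw :: "'a \<Rightarrow> nat \<Rightarrow> 'a" where
  "pw x i = (((\<odot>) x) ^^ i) x"

definition nil :: "'a \<Rightarrow> bool" where
  "nil x \<longleftrightarrow> (\<exists>i. pw x i = 0)"

lemma pw_0 [simp]: "pw x 0 = x"
  by (simp add: pw_def)

lemma pw_Suc [simp]: "pw x (Suc i) = x \<odot> pw x i"
  by (simp add: pw_def)

lemma pw_mem [simp]: "x \<in> G \<Longrightarrow> pw x i \<in> G"
  by (cases i) auto

lemma pw_mult: "pw x i \<odot> pw x j = pw x (Suc (i + j))"
  by (induction i) (simp_all add: assoc)

lemma pw_commute: "pw x i \<odot> x = x \<odot> pw x i"
  using pw_mult[of x i 0] by simp

lemma nil_0 [simp]: "nil 0"
  by (auto simp: nil_def intro: exI[of _ 0])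

section \<open>Idempotent powers and nilpotent elements\<close>

lemma ex_idem_pw:
  assumes "x \<in> G"
  shows "\<exists>i. pw x i \<odot> pw x i = pw x i"
proof -
  have "range (pw x) \<subseteq> G"
    using assms by auto
  then have "finite (range (pw x))"
    using fin finite_subset by blast
  then have "\<not> inj (pw x)"
    using finite_imageD infinite_UNIV_nat by blast
  then obtain i j where "pw x i = pw x j" "i < j"
    by (auto simp: inj_on_def) (metis linorder_less_linear)
  define d where "d = j - i"
  have d: "d > 0" "pw x (i + d) = pw x i"
    using \<open>i < j\<close> \<open>pw x i = pw x j\<close> by (simp_all add: d_def)
  have shift: "pw x (i + d + t) = pw x (i + t)" for t
    using d(2) by (induction t) simp_all
  have per: "pw x (i + t + r * d) = pw x (i + t)" for t r
  proof (induction r)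
    case (Suc r)
    have "pw x (i + t + Suc r * d) = pw x (i + d + (t + r * d))"
      by (simp add: algebra_simps)
    also have "\<dots> = pw x (i + t + r * d)"
      using shift[of "t + r * d"] by (simp only: add.assoc)
    finally show ?case
      using Suc by simp
  qed simp
  \<comment> \<open>The exponent of \<open>pw x s\<close> is (i + 1) d, a multiple of the period
    \<open>d\<close> beyond the point where periodicity begins; doubling such an exponent does not
    change the power.\<close>
  define s where "s = Suc i * d - 1"
  have s: "Suc s = Suc i * d"
    using d(1) by (simp add: s_def)
  have "i \<le> s"
    using d(1) mult_le_mono2[of 1 d "Suc i"] by (simp add: s_def)
  have "pw x s \<odot> pw x s = pw x (i + (s - i) + Suc i * d)"
    using \<open>i \<le> s\<close> by (simp only: pw_mult flip: s) simp
  also have "\<dots> = pw x s"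
    using per[of "s - i" "Suc i"] \<open>i \<le> s\<close> by simp
  finally show ?thesis ..
qed

text \<open>With an exponent of at least two a factor \<open>pw x i\<close> is left over, which
  becomes the inverse of \<open>x\<close> when the idempotent is an identity element.\<close>

lemma ex_idem_pw_Suc:
  assumes "x \<in> G"
  shows "\<exists>i. pw x (Suc i) \<odot> pw x (Suc i) = pw x (Suc i)"
proof -
  obtain i where "pw x i \<odot> pw x i = pw x i"
    using ex_idem_pw[OF assms] by blast
  then have "pw x (Suc (i + i)) \<odot> pw x (Suc (i + i)) = pw x (Suc (i + i))"
    by (metis pw_mult)
  then show ?thesis ..
qed

lemma pw_cyclic: "y \<odot> pw (x \<odot> y) i = pw (y \<odot> x) i \<odot> y"
  by (induction i) (simp_all add: assoc)

lemma nil_cyclic: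
  assumes "nil (x \<odot> y)" shows "nil (y \<odot> x)"
proof -
  obtain i where "pw (x \<odot> y) i = 0"
    using assms by (auto simp: nil_def)
  then have "pw (y \<odot> x) i \<odot> y = 0"
    using pw_cyclic[of y x i] by simp
  then have "pw (y \<odot> x) (Suc i) = 0"
    using pw_mult[of "y \<odot> x" i 0] by (simp flip: assoc)
  then show ?thesis
    unfolding nil_def by blast
qed

lemma nil_square:
  assumes "nil (x \<odot> x)" shows "nil x"
proof -
  have "pw (x \<odot> x) i = pw x (Suc (i + i))" for i
    by (induction i) (simp_all add: assoc)
  then show ?thesis
    using assms unfolding nil_def by metis
qed

text \<open>x (s x)^i depends on \<open>s\<close> only through x s x. In the applications
  \<open>c\<close> is a Peirce component of \<open>s\<close>.\<close>

lemma nil_compress: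
  assumes "x \<odot> (s \<odot> x) = x \<odot> (c \<odot> x)" "nil (c \<odot> x)"
  shows "nil (s \<odot> x)"
proof -
  have *: "x \<odot> pw (s \<odot> x) i = x \<odot> pw (c \<odot> x) i" for i
  proof (induction i)
    case (Suc i)
    have "x \<odot> pw (s \<odot> x) (Suc i) = x \<odot> (s \<odot> (x \<odot> pw (s \<odot> x) i))"
      by (simp add: assoc)
    also have "\<dots> = (x \<odot> (s \<odot> x)) \<odot> pw (c \<odot> x) i"
      by (simp add: Suc assoc)
    finally show ?case
      by (simp add: assms(1) assoc)
  qed (use assms in simp)
  obtain i where "pw (c \<odot> x) i = 0"
    using assms by (auto simp: nil_def)
  then have "pw (s \<odot> x) (Suc i) = 0"
    using *[of i] by (simp add: assoc)
  then show ?thesis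
    unfolding nil_def by blast
qed

text \<open>Suppose f \<noteq> 0 and let \<open>y\<close> be the last nonzero term before the
  sequence f, a f, a^2 f, ... reaches 0. Then a y = 0 and f y = y, hence b y = y, which is
  impossible for a nilpotent \<open>b\<close>.\<close>

lemma nil_sum_idem_eq_0:
  assumes "a \<in> G" "b \<in> G" "f \<odot> f = f" "a + b = f" "f \<odot> a = a" "nil a" "nil b"
  shows "f = 0"
proof (rule ccontr)
  assume "f \<noteq> 0"
  have f: "f \<in> G"
    using assms by auto
  define q where "q i = (((\<odot>) a) ^^ i) f" for i
  have q: "q 0 = f" "q (Suc i) = a \<odot> q i" for i
    by (simp_all add: q_def)
  have qpw: "q (Suc i) = pw a i \<odot> f" for i
    by (induction i) (simp_all add: q assoc)
  obtain j where "pw a j = 0"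
    using assms by (auto simp: nil_def)
  then have "q (Suc j) = 0"
    by (simp add: qpw)
  then obtain i where i: "q i = 0" "\<And>j. j < i \<Longrightarrow> q j \<noteq> 0"
    using exists_least_iff[of "\<lambda>i. q i = 0"] by blast
  then obtain i' where i': "i = Suc i'"
    using q(1) \<open>f \<noteq> 0\<close> by (cases i) auto
  define y where "y = q i'"
  have y: "y \<noteq> 0" "a \<odot> y = 0"
    using i i' q(2)[of i'] by (auto simp: y_def)
  have yG: "y \<in> G" "f \<odot> y = y"
    using f assms(3,5) by (cases i'; simp add: y_def q flip: assoc)+
  have "b \<odot> y = (a + b) \<odot> y"
    using assms(1,2) yG y by simp
  then have by_y: "b \<odot> y = y"
    using assms(4) yG by simp
  have "pw b j \<odot> y = y" for j
    by (induction j) (simp_all add: by_y assoc)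
  then have "y = 0"
    using assms(7) mult_zero_left unfolding nil_def by metis
  then show False
    using y by simp
qed

section \<open>Subrings and the radical\<close>

definition subring :: "'a set \<Rightarrow> bool" where
  "subring S \<longleftrightarrow> add_subgroup S \<and> S \<subseteq> G \<and> (\<forall>x\<in>S. \<forall>y\<in>S. x \<odot> y \<in> S)"

lemma subringD:
  assumes "subring S"
  shows "add_subgroup S" "S \<subseteq> G" "x \<in> S \<Longrightarrow> y \<in> S \<Longrightarrow> x \<odot> y \<in> S" "x \<in> S \<Longrightarrow> x \<in> G"
    "x \<in> S \<Longrightarrow> y \<in> S \<Longrightarrow> x + y \<in> S" "x \<in> S \<Longrightarrow> y \<in> S \<Longrightarrow> x - y \<in> S" "0 \<in> S"
    "x \<in> S \<Longrightarrow> - x \<in> S" "finite S"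
  using assms fin finite_subset
  by (auto simp: subring_def add_subgroup_add add_subgroup_diff add_subgroup_zero add_subgroup_uminus)

lemma subring_G: "subring G"
  by (simp add: subring_def subgroup)

lemma subring_pw: "subring S \<Longrightarrow> x \<in> S \<Longrightarrow> pw x i \<in> S"
  by (induction i) (auto simp: subringD)

lemma subring_hull: "A \<subseteq> G \<Longrightarrow> subring (subring hull A)"
proof -
  assume "A \<subseteq> G"
  then have "subring hull A \<subseteq> G"
    by (intro hull_minimal subring_G)
  then show ?thesis
    unfolding subring_def by (auto simp: hull_def subring_def add_subgroup_def)
qed

text \<open>In a finite ring this is the Jacobson radical.\<close>

definition rad :: "'a set \<Rightarrow> 'a set" where
  "rad S = {x\<in>S. \<forall>s\<in>S. nil (s \<odot> x)}"

text \<open>A power of z = s (x + y) is an idempotent \<open>f\<close> and has the form t (x + y).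
  Then f = f t x f + f t y f is a sum of two nilpotent elements of the corner f S f, which forces f
  = 0.\<close>

lemma nil_left_ideal_add:
  assumes S: "subring S" and x: "x \<in> S" "\<And>s. s \<in> S \<Longrightarrow> nil (s \<odot> x)"
    and y: "y \<in> S" "\<And>s. s \<in> S \<Longrightarrow> nil (s \<odot> y)" and s: "s \<in> S"
  shows "nil (s \<odot> (x + y))"
proof -
  define z where "z = s \<odot> (x + y)"
  have z: "z \<in> S"
    using S s x y by (simp add: z_def subringD)
  then obtain i where i: "pw z i \<odot> pw z i = pw z i"
    using ex_idem_pw subringD(4)[OF S] by blast
  define f where "f = pw z i"
  have f: "f \<in> S" "f \<odot> f = f"
    using i z S by (simp_all add: f_def subring_pw)
  \<comment> \<open>\<open>pw z (i + i) \<odot> z\<close> has twice the exponent of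
    \<open>f\<close>, so it equals f f = f; splitting off the factor \<open>s\<close> of the last
    \<open>z\<close> gives f = t (x + y).\<close>
  define t where "t = pw z (i + i) \<odot> s"
  have t: "t \<in> S"
    using z s S by (simp add: t_def subring_pw subringD)
  have "f = pw z (i + i) \<odot> z"
    using f(2) pw_mult[of z i i] pw_mult[of z "i + i" 0] by (simp add: f_def)
  then have ft: "f = t \<odot> (x + y)"
    by (simp add: t_def z_def assoc)
  \<comment> \<open>For u = f t w the identity f u = u gives (u f)^j = u^j f, and \<open>u\<close>
    is nilpotent as a left multiple of \<open>w\<close>.\<close>
  have nilc: "nil ((f \<odot> (t \<odot> w)) \<odot> f)" if w: "w \<in> S" "\<And>s. s \<in> S \<Longrightarrow> nil (s \<odot> w)" for w
  proof -
    let ?u = "f \<odot> (t \<odot> w)"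
    have fu: "f \<odot> pw ?u j = pw ?u j" for j
      using f(2) by (cases j) (simp_all flip: assoc)
    have "pw (?u \<odot> f) j = pw ?u j \<odot> f" for j
      by (induction j) (simp_all add: assoc fu[unfolded assoc] flip: assoc[of f "pw _ _"])
    moreover have "nil ?u"
      using w(2)[of "f \<odot> t"] f t S by (simp add: subringD assoc)
    ultimately show ?thesis
      unfolding nil_def by (metis mult_zero_left)
  qed
  have "f = 0"
  proof (rule nil_sum_idem_eq_0)
    have "(f \<odot> (t \<odot> x)) \<odot> f + (f \<odot> (t \<odot> y)) \<odot> f = (f \<odot> (t \<odot> (x + y))) \<odot> f"
      using f t x y S by (simp add: subringD(4))
    then show "(f \<odot> (t \<odot> x)) \<odot> f + (f \<odot> (t \<odot> y)) \<odot> f = f"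
      using f by (simp flip: ft)
    show "f \<odot> ((f \<odot> (t \<odot> x)) \<odot> f) = (f \<odot> (t \<odot> x)) \<odot> f"
      using f(2) by (simp flip: assoc)
  qed (use f(2) nilc x y in auto)
  then show ?thesis
    by (auto simp: nil_def f_def z_def)
qed

lemma rad_subset: "rad S \<subseteq> S"
  by (auto simp: rad_def)

lemma rad_nil: "x \<in> rad S \<Longrightarrow> nil x"
  unfolding rad_def using nil_square by blast

lemma rad_left: "subring S \<Longrightarrow> x \<in> rad S \<Longrightarrow> r \<in> S \<Longrightarrow> r \<odot> x \<in> rad S"
  by (simp add: rad_def subringD flip: assoc)

lemma rad_right: "subring S \<Longrightarrow> x \<in> rad S \<Longrightarrow> r \<in> S \<Longrightarrow> x \<odot> r \<in> rad S"
proof -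
  assume S: "subring S" and x: "x \<in> rad S" and r: "r \<in> S"
  have "nil ((s \<odot> x) \<odot> r)" if "s \<in> S" for s
    by (rule nil_cyclic) (use S x r that in \<open>simp add: rad_def subringD flip: assoc\<close>)
  then show ?thesis
    using S x r by (simp add: rad_def subringD assoc)
qed

lemma subring_rad:
  assumes S: "subring S"
  shows "subring (rad S)"
proof -
  have "add_subgroup (rad S)"
  proof (rule add_subgroupI)
    show "0 \<in> rad S"
      using S by (simp add: rad_def subringD)
    fix x y assume xy: "x \<in> rad S" "y \<in> rad S"
    have "nil (s \<odot> (- y))" if "s \<in> S" for s
    proof -
      have "nil ((- s) \<odot> y)"
        using xy that S by (simp add: rad_def subringD)
      then show ?thesis
        using xy that S by (simp add: rad_def subringD uminus_left uminus_right)
    qed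
    then have "nil (s \<odot> (x + - y))" if "s \<in> S" for s
      using nil_left_ideal_add[OF S, of x "- y" s] xy that S by (simp add: rad_def subringD)
    then show "x - y \<in> rad S"
      using xy S by (simp add: rad_def subringD)
  qed
  then show ?thesis
    using S rad_subset[of S] rad_left[OF S] by (auto simp: subring_def)
qed

lemma rad_eq_self:
  assumes S: "subring S" and "\<And>f. f \<in> S \<Longrightarrow> f \<odot> f = f \<Longrightarrow> f = 0"
  shows "rad S = S"
proof -
  have "nil x" if "x \<in> S" for x
    using ex_idem_pw[of x] subring_pw[OF S that] assms(2) subringD(4)[OF S that] unfolding nil_def by metis
  then show ?thesis
    using S by (auto simp: rad_def subringD)
qed

section \<open>Ranks of left and right multiplications\<close>

text \<open>If the order of \<open>G\<close> is a power of p, this is p to the sum of the ranks of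
  left and right multiplication by \<open>x\<close>. Cardinalities express it without a prime, which
  this locale does not fix.\<close>

definition rank_prod :: "'a \<Rightarrow> nat" where
  "rank_prod x = card ((\<odot>) x ` G) * card ((\<lambda>y. y \<odot> x) ` G)"

lemma rank_prod_gt_1:
  assumes "x \<in> G" "x \<noteq> 0" "e \<in> G" "e \<odot> x = x \<or> x \<odot> e = x"
  shows "rank_prod x > 1"
proof -
  have pos: "card (f ` G) > 0" for f :: "'a \<Rightarrow> 'a"
    using fin zero_mem by (metis card_gt_0_iff empty_iff finite_imageI image_is_empty)
  have two: "card (f ` G) > 1" if "f 0 = 0" "f e = x" for f :: "'a \<Rightarrow> 'a"
  proof -
    have "{0, x} \<subseteq> f ` G"
      using that assms(3) zero_mem by (metis empty_subsetI imageI insert_subset)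
    then have "card {0, x} \<le> card (f ` G)"
      using fin by (intro card_mono) auto
    then show ?thesis
      using assms(2) by simp
  qed
  have "card ((\<odot>) x ` G) > 1 \<or> card ((\<lambda>y. y \<odot> x) ` G) > 1"
    using two[of "(\<odot>) x"] two[of "\<lambda>y. y \<odot> x"] assms(4) by auto
  then show ?thesis
    unfolding rank_prod_def using pos
    by (metis One_nat_def less_1_mult linorder_neqE_nat mult.commute nat_mult_1 not_less_zero less_one)
qed

text \<open>Multiplication by \<open>x\<close> factors through multiplication by \<open>e\<close>.
  If e x = x, then x G lies in e G, and G x is the image of G e under right multiplication by
  \<open>x\<close>; the other case is its mirror image.\<close>

lemma rank_prod_le:
  assumes "e \<in> G" "x \<in> G" "e \<odot> x = x \<or> x \<odot> e = x"
  shows "rank_prod x \<le> rank_prod e"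
proof -
  have le: "card X \<le> card (f ` Y)" if "X \<subseteq> f ` Y" "Y \<subseteq> G" for X Y and f :: "'a \<Rightarrow> 'a"
    using that fin by (meson card_mono finite_imageI finite_subset)
  have le': "card X \<le> card Y" if "X \<subseteq> f ` Y" "Y \<subseteq> G" for X Y and f :: "'a \<Rightarrow> 'a"
    using le[OF that] card_image_le[of Y f] that fin finite_subset by (meson le_trans)
  show ?thesis
    using assms(3)
  proof
    assume ex: "e \<odot> x = x"
    have "(\<odot>) x ` G \<subseteq> id ` ((\<odot>) e ` G)"
      using ex by (auto simp flip: assoc intro!: image_eqI[of _ _ "x \<odot> _"])
    then have "card ((\<odot>) x ` G) \<le> card ((\<odot>) e ` G)"
      by (rule le') auto
    moreover have "(\<lambda>y. y \<odot> x) ` G \<subseteq> (\<lambda>y. y \<odot> x) ` ((\<lambda>y. y \<odot> e) ` G)"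
      using ex by (auto simp: image_image assoc)
    then have "card ((\<lambda>y. y \<odot> x) ` G) \<le> card ((\<lambda>y. y \<odot> e) ` G)"
      by (rule le') auto
    ultimately show ?thesis
      unfolding rank_prod_def by (rule mult_le_mono)
  next
    assume xe: "x \<odot> e = x"
    have "(\<odot>) x ` G \<subseteq> (\<odot>) x ` ((\<odot>) e ` G)"
      using xe by (auto simp: image_image simp flip: assoc)
    then have "card ((\<odot>) x ` G) \<le> card ((\<odot>) e ` G)"
      by (rule le') auto
    moreover have "(\<lambda>y. y \<odot> x) ` G \<subseteq> id ` ((\<lambda>y. y \<odot> e) ` G)"
      using xe by (auto simp: assoc intro!: image_eqI[of _ _ "_ \<odot> x"])
    then have "card ((\<lambda>y. y \<odot> x) ` G) \<le> card ((\<lambda>y. y \<odot> e) ` G)"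
      by (rule le') auto
    ultimately show ?thesis
      unfolding rank_prod_def by (rule mult_le_mono)
  qed
qed

text \<open>The sum of e G and f G is direct, since multiplication by \<open>e\<close> recovers the
  first summand, and it is contained in (e + f) G. The same holds on the right.\<close>

lemma rank_prod_orthogonal:
  assumes "e \<in> G" "f \<in> G" "e \<odot> e = e" "f \<odot> f = f" "e \<odot> f = 0" "f \<odot> e = 0"
  shows "rank_prod e * rank_prod f \<le> rank_prod (e + f)"
proof -
  have "card ((\<odot>) e ` G) * card ((\<odot>) f ` G) = card ((\<odot>) e ` G \<times> (\<odot>) f ` G)"
    by (simp add: card_cartesian_product)
  also have "\<dots> \<le> card ((\<odot>) (e + f) ` G)"
  proof (rule card_inj_on_le)
    show "inj_on (\<lambda>(y, z). y + z) ((\<odot>) e ` G \<times> (\<odot>) f ` G)"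
    proof (rule inj_onI, clarsimp)
      fix y z y' z' assume G: "y \<in> G" "z \<in> G" "y' \<in> G" "z' \<in> G"
        and eq: "e \<odot> y + f \<odot> z = e \<odot> y' + f \<odot> z'"
      have "e \<odot> (e \<odot> y + f \<odot> z) = e \<odot> y" "e \<odot> (e \<odot> y' + f \<odot> z') = e \<odot> y'"
        using G assms by (simp_all flip: assoc)
      then show "e \<odot> y = e \<odot> y' \<and> f \<odot> z = f \<odot> z'"
        using eq by (metis add_left_cancel)
    qed
    show "(\<lambda>(y, z). y + z) ` ((\<odot>) e ` G \<times> (\<odot>) f ` G) \<subseteq> (\<odot>) (e + f) ` G"
    proof clarsimp
      fix y z assume "y \<in> G" "z \<in> G"
      then have "(e + f) \<odot> (e \<odot> y + f \<odot> z) = e \<odot> y + f \<odot> z"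
        using assms by (simp flip: assoc)
      then show "e \<odot> y + f \<odot> z \<in> (\<odot>) (e + f) ` G"
        by (metis add_mem closed image_eqI)
    qed
  qed (use fin in simp)
  finally have l: "card ((\<odot>) e ` G) * card ((\<odot>) f ` G) \<le> card ((\<odot>) (e + f) ` G)" .
  let ?R = "\<lambda>x y. y \<odot> x"
  have "card (?R e ` G) * card (?R f ` G) = card (?R e ` G \<times> ?R f ` G)"
    by (simp add: card_cartesian_product)
  also have "\<dots> \<le> card (?R (e + f) ` G)"
  proof (rule card_inj_on_le)
    show "inj_on (\<lambda>(y, z). y + z) (?R e ` G \<times> ?R f ` G)"
    proof (rule inj_onI, clarsimp)
      fix y z y' z' assume G: "y \<in> G" "z \<in> G" "y' \<in> G" "z' \<in> G"
        and eq: "y \<odot> e + z \<odot> f = y' \<odot> e + z' \<odot> f"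
      have "(y \<odot> e + z \<odot> f) \<odot> e = y \<odot> e" "(y' \<odot> e + z' \<odot> f) \<odot> e = y' \<odot> e"
        using G assms by (simp_all add: assoc)
      then show "y \<odot> e = y' \<odot> e \<and> z \<odot> f = z' \<odot> f"
        using eq by (metis add_left_cancel)
    qed
    show "(\<lambda>(y, z). y + z) ` (?R e ` G \<times> ?R f ` G) \<subseteq> ?R (e + f) ` G"
    proof clarsimp
      fix y z assume "y \<in> G" "z \<in> G"
      then have "(y \<odot> e + z \<odot> f) \<odot> (e + f) = y \<odot> e + z \<odot> f"
        using assms by (simp add: assoc)
      then show "y \<odot> e + z \<odot> f \<in> ?R (e + f) ` G"
        by (metis (mono_tags, lifting) add_mem closed image_eqI)
    qed
  qed (use fin in simp)
  finally have "card (?R e ` G) * card (?R f ` G) \<le> card (?R (e + f) ` G)" .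
  from mult_le_mono[OF l this] show ?thesis
    by (simp add: rank_prod_def ac_simps)
qed

section \<open>Local rings and their generators\<close>

text \<open>A finite ring with identity \<open>e\<close> \<noteq> 0 is local if and only if 0 and
  \<open>e\<close> are its only idempotents.\<close>

definition local_unit :: "'a set \<Rightarrow> 'a \<Rightarrow> bool" where
  "local_unit B e \<longleftrightarrow> subring B \<and> e \<in> B \<and> e \<noteq> 0 \<and> (\<forall>x\<in>B. e \<odot> x = x \<and> x \<odot> e = x) \<and>
     (\<forall>f\<in>B. f \<odot> f = f \<longrightarrow> f = 0 \<or> f = e)"

lemma local_unitD:
  assumes "local_unit B e"
  shows "subring B" "e \<in> B" "e \<noteq> 0" "x \<in> B \<Longrightarrow> e \<odot> x = x" "x \<in> B \<Longrightarrow> x \<odot> e = x"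
    "f \<in> B \<Longrightarrow> f \<odot> f = f \<Longrightarrow> f = 0 \<or> f = e"
  using assms by (auto simp: local_unit_def)

text \<open>The idempotent power of \<open>x\<close> can only be \<open>e\<close>. So every element
  of \<open>B\<close> is nilpotent or a unit, and the inverse of a unit is one of its own powers; it
  therefore stays in any subring that contains the unit.\<close>

lemma local_pw_eq_unit:
  assumes B: "local_unit B e" and x: "x \<in> B" "\<not> nil x"
  shows "\<exists>i. pw x (Suc i) = e"
proof -
  obtain i where i: "pw x (Suc i) \<odot> pw x (Suc i) = pw x (Suc i)"
    using ex_idem_pw_Suc subringD(4)[OF local_unitD(1)[OF B] x(1)] by blast
  moreover have "pw x (Suc i) \<in> B"
    using subring_pw local_unitD(1)[OF B] x(1) by blast
  moreover have "pw x (Suc i) \<noteq> 0"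
    using x(2) unfolding nil_def by blast
  ultimately show ?thesis
    using local_unitD(6)[OF B] by blast
qed

text \<open>If some s x were not nilpotent, \<open>x\<close> would have a left inverse
  \<open>w\<close>. Multiplying the first vanishing power of \<open>x\<close> by \<open>w\<close>
  would then make the preceding power vanish.\<close>

lemma local_rad_iff_nil:
  assumes B: "local_unit B e" and x: "x \<in> B"
  shows "x \<in> rad B \<longleftrightarrow> nil x"
proof
  assume nx: "nil x"
  have "nil (s \<odot> x)" if s: "s \<in> B" for s
  proof (rule ccontr)
    assume "\<not> ?thesis"
    moreover have "s \<odot> x \<in> B"
      using local_unitD(1)[OF B] s x by (simp add: subringD)
    ultimately obtain i where i: "pw (s \<odot> x) (Suc i) = e"
      using local_pw_eq_unit[OF B] by blast
    define w where "w = pw (s \<odot> x) i \<odot> s"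
    have wx: "w \<odot> x = e"
      using i pw_commute[of "s \<odot> x" i] by (simp add: w_def assoc)
    obtain j where j: "pw x j = 0" "\<And>i. i < j \<Longrightarrow> pw x i \<noteq> 0"
      using nx exists_least_iff[of "\<lambda>i. pw x i = 0"] unfolding nil_def by blast
    show False
    proof (cases j)
      case 0
      then show False
        using j wx local_unitD(3)[OF B] by simp
    next
      case (Suc j')
      have "pw x j' \<in> B"
        using subring_pw local_unitD(1)[OF B] x by blast
      then have "pw x j' = (w \<odot> x) \<odot> pw x j'"
        using wx local_unitD(4)[OF B] by simp
      also have "\<dots> = w \<odot> pw x j"
        by (simp add: Suc assoc)
      finally show False
        using j Suc by simp
    qed
  qed
  then show "x \<in> rad B"
    using x by (simp add: rad_def)
qed (rule rad_nil)

text \<open>If h + k x = h0 + k0 x with k - k0 outside \<open>rad B\<close>, then k - k0 is a unit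
  with its inverse in \<open>H\<close>, and \<open>x\<close> would lie in \<open>H\<close>. So the
  map sending (h, k) to h + k x has fibres of at most |rad B| elements, each determined by its
  \<open>k\<close>.\<close>

lemma card_adjoin:
  assumes B: "local_unit B e" and H: "subring H" "H \<subseteq> B" "rad B \<subseteq> H" and x: "x \<in> B" "x \<notin> H"
    and H': "subring H'" "H \<subseteq> H'" "x \<in> H'"
  shows "card H * card H \<le> card H' * card (rad B)"
proof -
  let ?Z = "\<lambda>b. {z \<in> H \<times> H. (case z of (h, k) \<Rightarrow> h + k \<odot> x) = b}"
  have fibre: "finite (?Z b) \<and>
    card (?Z b) \<le> card (rad B)" for b
  proof (cases "?Z b = {}")
    case False
    then obtain h0 k0 where h0: "h0 \<in> H" "k0 \<in> H" "h0 + k0 \<odot> x = b"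
      by auto
    have xG: "x \<in> G"
      using x B subringD(4) local_unitD(1) by blast
    have k_rad: "k - k0 \<in> rad B" if hk: "h \<in> H" "k \<in> H" "h + k \<odot> x = b" for h k
    proof (rule ccontr)
      assume "k - k0 \<notin> rad B"
      moreover have kH: "k - k0 \<in> H"
        using hk h0 H by (simp add: subringD)
      ultimately have "\<not> nil (k - k0)"
        using local_rad_iff_nil[OF B] H(2) by blast
      then obtain i where i: "pw (k - k0) (Suc i) = e"
        using local_pw_eq_unit[OF B] kH H(2) by blast
      have "(k - k0) \<odot> x = h0 - h"
        using hk h0 xG H(1) by (simp add: subringD(4) algebra_simps)
      then have "(k - k0) \<odot> x \<in> H"
        using hk h0 H(1) by (simp add: subringD)
      then have "pw (k - k0) i \<odot> ((k - k0) \<odot> x) \<in> H"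
        using H(1) kH by (simp add: subringD subring_pw)
      also have "pw (k - k0) i \<odot> ((k - k0) \<odot> x) = pw (k - k0) (Suc i) \<odot> x"
        by (simp add: pw_commute flip: assoc)
      also have "\<dots> = x"
        using i local_unitD(4)[OF B] x by simp
      finally show False
        using x by simp
    qed
    have inj: "inj_on (\<lambda>z. snd z - k0) (?Z b)"
      by (rule inj_onI) auto
    have "finite (?Z b)"
      by (rule finite_subset[of _ "H \<times> H"]) (use subringD(9)[OF H(1)] in auto)
    moreover have "card (?Z b) \<le> card (rad B)"
      using inj by (rule card_inj_on_le)
        (use k_rad subringD(9)[OF subring_rad[OF local_unitD(1)[OF B]]] in auto)
    ultimately show ?thesis ..
  qed (auto simp del: Collect_empty_eq)
  have "card (H \<times> H) \<le> card H' * card (rad B)"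
    using card_le_fibers[of H' "\<lambda>(h, k). h + k \<odot> x" "H \<times> H" "card (rad B)"] fibre H'
    by (auto simp: subringD subset_eq)
  then show ?thesis
    by (simp add: card_cartesian_product)
qed

text \<open>
  Modulo its radical a local ring is a division ring, and the dimension over a division subring
  doubles with each adjoined element; hence few elements generate.
\<close>

lemma local_generators:
  assumes B: "local_unit B e" and c: "card G < 2 ^ (2 ^ c)"
  shows "\<exists>C. finite C \<and> C \<subseteq> B \<and> 0 \<notin> C \<and> card C \<le> c \<and> B \<subseteq> subring hull (rad B \<union> C)"
proof -
  define H where "H C = subring hull (rad B \<union> C)" for C
  \<comment> \<open>The first member \<open>e\<close> of \<open>C\<close> brings the index of
    \<open>rad B\<close> in \<open>H C\<close> to at least 2, and by \<open>card_adjoin\<close> each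
    further member squares this lower bound. Hence the exponent with \<open>card C - 1\<close>, and
    hence \<open>card C \<le> c\<close>.\<close>
  define P where "P C \<longleftrightarrow> finite C \<and> C \<subseteq> B \<and> 0 \<notin> C \<and> e \<in> C \<and>
    2 ^ (2 ^ (card C - 1)) * card (rad B) \<le> card (H C)" for C
  have srB: "subring B"
    using B by (rule local_unitD)
  have H: "subring (H C)" "H C \<subseteq> B" "rad B \<union> C \<subseteq> H C" if "C \<subseteq> B" for C
  proof -
    have sub: "rad B \<union> C \<subseteq> B"
      using that rad_subset by blast
    then show "subring (H C)"
      unfolding H_def using subringD(2)[OF srB] by (intro subring_hull) blast
    show "H C \<subseteq> B"
      unfolding H_def using sub srB by (rule hull_minimal)
    show "rad B \<union> C \<subseteq> H C"
      unfolding H_def by (rule hull_subset)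
  qed
  have radpos: "card (rad B) > 0"
    using subringD(7,9)[OF subring_rad[OF srB]] by (auto simp: card_gt_0_iff)
  have "P {e}"
  proof -
    have e: "{e} \<subseteq> B"
      using local_unitD(2)[OF B] by simp
    have "pw e i = e" for i
      using local_unitD(2,4)[OF B] by (induction i) auto
    then have "e \<notin> rad B"
      using local_rad_iff_nil[OF B local_unitD(2)[OF B]] local_unitD(3)[OF B] by (simp add: nil_def)
    then have "rad B \<subset> H {e}"
      using H(3)[OF e] by auto
    then have lt: "card (rad B) < card (H {e})"
      using subringD(9)[OF H(1)[OF e]] by (rule psubset_card_mono[rotated])
    have "card (rad B) dvd card (H {e})"
      using card_subgroup_dvd subringD(1,9) H[OF e] subring_rad[OF srB] by (metis Un_subset_iff)
    then obtain t where t: "card (H {e}) = card (rad B) * t" ..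
    then have "t \<noteq> 0" "t \<noteq> 1"
      using lt by auto
    then have "2 \<le> t"
      by simp
    then show ?thesis
      using e local_unitD(3)[OF B] t mult_le_mono2[of 2 t "card (rad B)"]
      by (auto simp: P_def mult.commute)
  qed
  have small: "card C \<le> c" if "P C" for C
  proof -
    have "card (H C) \<le> card G"
      using that H(2)[of C] subringD(2)[OF srB] fin by (intro card_mono) (auto simp: P_def)
    moreover have "2 ^ (2 ^ (card C - 1)) \<le> card (H C)"
      using that radpos by (auto simp: P_def intro: order_trans[rotated])
    ultimately have "(2::nat) ^ (2 ^ (card C - 1)) < 2 ^ (2 ^ c)"
      using c by linarith
    then show ?thesis
      by simp
  qed
  obtain C where C: "P C" and max: "\<And>C'. P C' \<Longrightarrow> card C' \<le> card C"
    using ex_has_greatest_nat[of P "{e}" card "Suc c"] \<open>P {e}\<close> small le_imp_less_Suc by metis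
  have CB: "C \<subseteq> B"
    using C by (simp add: P_def)
  have "B \<subseteq> H C"
  proof (rule ccontr)
    assume "\<not> B \<subseteq> H C"
    then obtain x where x: "x \<in> B" "x \<notin> H C" by blast
    have C'B: "insert x C \<subseteq> B"
      using x CB by simp
    have "x \<notin> C" "x \<noteq> 0"
      using x H(3)[OF CB] subringD(7)[OF H(1)[OF CB]] by auto
    then have cC: "card (insert x C) = Suc (card C)"
      using C by (simp add: P_def)
    have "card C > 0"
      using C by (auto simp: P_def card_gt_0_iff)
    have "(2 ^ (2 ^ (card C - 1)) * card (rad B)) * (2 ^ (2 ^ (card C - 1)) * card (rad B))
        \<le> card (H C) * card (H C)"
      using C by (intro mult_le_mono) (simp_all add: P_def)
    also have "\<dots> \<le> card (H (insert x C)) * card (rad B)"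
    proof (rule card_adjoin[OF B H(1,2)[OF CB] _ x H(1)[OF C'B]])
      show "H C \<subseteq> H (insert x C)"
        unfolding H_def by (rule hull_mono) blast
    qed (use H(3)[OF CB] H(3)[OF C'B] in auto)
    finally have "(2 ^ (2 ^ (card C - 1)) * 2 ^ (2 ^ (card C - 1))) * card (rad B) \<le> card (H (insert x C))"
      using radpos by (simp add: mult.assoc mult.left_commute)
    moreover have "(2::nat) ^ (2 ^ (card C - 1)) * 2 ^ (2 ^ (card C - 1)) = 2 ^ (2 ^ card C)"
      using \<open>card C > 0\<close> by (cases "card C") (simp_all add: mult_2 flip: power_add)
    ultimately have "P (insert x C)"
      using C x cC \<open>x \<noteq> 0\<close> by (simp add: P_def)
    then show False
      using max[of "insert x C"] cC by simp
  qed
  then show ?thesis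
    using C small[OF C] by (intro exI[of _ C]) (auto simp: P_def H_def)
qed

section \<open>Splitting off primitive idempotents\<close>

text \<open>Take a nonzero idempotent \<open>e\<close> with the smallest corner e S e. The corner of
  a nonzero idempotent \<open>g\<close> of e S e lies inside it, so by minimality the two coincide;
  then \<open>e\<close> lies in the corner of \<open>g\<close>, and g = e.\<close>

lemma ex_local_unit:
  assumes S: "subring S" and f: "f \<in> S" "f \<odot> f = f" "f \<noteq> 0"
  shows "\<exists>e\<in>S. e \<odot> e = e \<and> local_unit {x\<in>S. e \<odot> x = x \<and> x \<odot> e = x} e"
proof -
  define B where "B e = {x\<in>S. e \<odot> x = x \<and> x \<odot> e = x}" for e
  define P where "P e \<longleftrightarrow> e \<in> S \<and> e \<odot> e = e \<and> e \<noteq> 0" for e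
  have "\<exists>e. P e \<and> (\<forall>f. P f \<longrightarrow> card (B e) \<le> card (B f))"
    using f ex_has_least_nat[of P f "\<lambda>e. card (B e)"] by (auto simp: P_def)
  then obtain e where e: "P e" and min: "\<And>f. P f \<Longrightarrow> card (B e) \<le> card (B f)"
    by blast
  have srB: "subring (B e)"
    unfolding subring_def
  proof (intro conjI ballI)
    have eG: "e \<in> G"
      using e S by (auto simp: P_def subringD(4))
    show "add_subgroup (B e)"
      by (rule add_subgroupI) (use S eG in \<open>auto simp: B_def subringD(4,6,7)\<close>)
    show "B e \<subseteq> G"
      using S by (auto simp: B_def subringD(4))
    fix x y assume "x \<in> B e" "y \<in> B e"
    then show "x \<odot> y \<in> B e"
      using S by (simp add: B_def subringD(3) assoc) (simp flip: assoc)
  qed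
  have "g = 0 \<or> g = e" if g: "g \<in> B e" "g \<odot> g = g" for g
  proof (rule ccontr)
    assume g0: "\<not> ?thesis"
    then have "P g"
      using g by (auto simp: P_def B_def)
    have "B g \<subseteq> B e"
    proof
      fix x assume x: "x \<in> B g"
      then have "e \<odot> x = (e \<odot> g) \<odot> x" "x \<odot> e = x \<odot> (g \<odot> e)"
        unfolding assoc by (simp_all add: B_def flip: assoc)
      then show "x \<in> B e"
        using x g by (simp add: B_def)
    qed
    then have "B g = B e"
      using min[OF \<open>P g\<close>] subringD(9)[OF srB] by (intro card_seteq) auto
    then have "e \<in> B g"
      using e by (auto simp: P_def B_def)
    then show False
      using g g0 by (simp add: B_def)
  qed
  then show ?thesis
    using e srB unfolding local_unit_def P_def B_def by (intro bexI[of _ e]) auto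
qed

text \<open>Split off a primitive idempotent \<open>e\<close> and recurse on (1 - e) S (1 - e). At
  most \<open>c\<close> generators are added, and each satisfies e x = x or x e = x, so its rank is
  at most that of \<open>e\<close>. The witness \<epsilon> is the sum of the idempotents split off;
  they are orthogonal, so its rank controls the sum of theirs. The positive ranks will bound the
  length of the list.\<close>

lemma rad_generators:
  assumes c: "card G < 2 ^ (2 ^ c)" "2 \<le> c"
  shows "subring S \<Longrightarrow> \<exists>E \<epsilon>. set E \<subseteq> S \<and> \<epsilon> \<in> S \<and> \<epsilon> \<odot> \<epsilon> = \<epsilon> \<and> S \<subseteq> subring hull (rad S \<union> set E) \<and>
    (\<forall>x\<in>set E. rank_prod x > 1) \<and> prod_list (map rank_prod E) \<le> rank_prod \<epsilon> ^ c"
proof (induction "card S" arbitrary: S rule: less_induct)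
  case less
  note S = less.prems
  have SG: "x \<in> G" if "x \<in> S" for x
    using subringD(4)[OF S that] .
  note closS = subringD(3,5,6,7)[OF S]
  show ?case
  proof (cases "\<exists>f\<in>S. f \<odot> f = f \<and> f \<noteq> 0")
    case False
    then have "rad S = S"
      using rad_eq_self[OF S] by blast
    moreover have "rank_prod 0 = 1"
    proof -
      have "(\<odot>) 0 ` G = {0}" "(\<lambda>y. y \<odot> 0) ` G = {0}"
        by (auto intro!: image_eqI[of _ _ 0])
      then show ?thesis
        by (simp add: rank_prod_def)
    qed
    ultimately show ?thesis
      using closS hull_subset[of S subring] by (intro exI[of _ "[]"] exI[of _ 0]) auto
  next
    case True
    define B where "B e = {x\<in>S. e \<odot> x = x \<and> x \<odot> e = x}" for e
    obtain e where eS: "e \<in> S" and ee: "e \<odot> e = e" and B: "local_unit (B e) e"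
      using True ex_local_unit[OF S] unfolding B_def by blast
    have eG: "e \<in> G"
      using eS SG by blast
    have eey [simp]: "e \<odot> (e \<odot> y) = e \<odot> y" for y
      using ee by (simp flip: assoc)
    define T where "T = {x\<in>S. e \<odot> x = 0 \<and> x \<odot> e = 0}"
    \<comment> \<open>\<open>U\<close> and \<open>V\<close> are the off-diagonal Peirce components e
      S (1 - e) and (1 - e) S e.\<close>
    define U where "U = {x\<in>S. e \<odot> x = x \<and> x \<odot> e = 0}"
    define V where "V = {x\<in>S. e \<odot> x = 0 \<and> x \<odot> e = x}"
    have compB: "e \<odot> (s \<odot> e) \<in> B e" if "s \<in> S" for s
      using that eS closS ee by (simp add: B_def assoc)
    have compU: "e \<odot> s - e \<odot> (s \<odot> e) \<in> U" if "s \<in> S" for s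
      using that eS closS ee SG by (simp add: U_def assoc)
    have compV: "s \<odot> e - e \<odot> (s \<odot> e) \<in> V" if "s \<in> S" for s
      using that eS closS ee SG by (simp add: V_def assoc)
    have compT: "s - e \<odot> s - s \<odot> e + e \<odot> (s \<odot> e) \<in> T" if "s \<in> S" for s
      using that eS closS ee SG by (simp add: T_def assoc)
    have peirce: "s = e \<odot> (s \<odot> e) + (e \<odot> s - e \<odot> (s \<odot> e)) + (s \<odot> e - e \<odot> (s \<odot> e))
        + (s - e \<odot> s - s \<odot> e + e \<odot> (s \<odot> e))" for s
      by simp
    have zz: "x \<odot> (e \<odot> y) = 0" if "x \<odot> e = 0" for x y
      using that by (simp flip: assoc)
    have xe: "x \<odot> (e \<odot> y) = x \<odot> y" if "x \<odot> e = x" for x y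
      using that by (simp flip: assoc)
    have srB: "subring (B e)"
      using B by (rule local_unitD)
    have srT: "subring T"
      unfolding subring_def
    proof (intro conjI ballI)
      show "add_subgroup T"
        by (rule add_subgroupI) (use closS eG SG in \<open>auto simp: T_def\<close>)
      show "T \<subseteq> G"
        using SG by (auto simp: T_def)
      fix x y assume "x \<in> T" "y \<in> T"
      then show "x \<odot> y \<in> T"
        using closS by (simp add: T_def assoc) (simp flip: assoc)
    qed
    have "e \<notin> T"
      using ee local_unitD(3)[OF B] by (simp add: T_def)
    then have "T \<subset> S"
      using eS by (auto simp: T_def)
    then have "card T < card S"
      using subringD(9)[OF S] by (rule psubset_card_mono[rotated])
    then obtain E' \<epsilon>' where E': "set E' \<subseteq> T" "\<epsilon>' \<in> T" "\<epsilon>' \<odot> \<epsilon>' = \<epsilon>'" "T \<subseteq> subring hull (rad T \<union> set E')"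
      "\<And>x. x \<in> set E' \<Longrightarrow> rank_prod x > 1" "prod_list (map rank_prod E') \<le> rank_prod \<epsilon>' ^ c"
      using less.hyps[of T] srT by blast
    \<comment> \<open>As x = (1 - e) x (1 - e), the product x s x involves only the component of
      \<open>s\<close> in \<open>T\<close>. The same argument with \<open>e\<close> in place of 1 -
      e gives \<open>radB\<close>.\<close>
    have radT: "x \<in> rad S" if x: "x \<in> rad T" for x
    proof -
      have xT: "x \<in> T"
        using x rad_subset by blast
      have "nil (s \<odot> x)" if s: "s \<in> S" for s
      proof (rule nil_compress)
        let ?c = "s - e \<odot> s - s \<odot> e + e \<odot> (s \<odot> e)"
        show "nil (?c \<odot> x)"
          using compT[OF s] x by (simp add: rad_def)
        show "x \<odot> (s \<odot> x) = x \<odot> (?c \<odot> x)"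
          using xT s SG eG by (simp add: T_def assoc zz)
      qed
      then show ?thesis
        using xT by (simp add: rad_def T_def)
    qed
    have radB: "x \<in> rad S" if x: "x \<in> rad (B e)" for x
    proof -
      have xB: "x \<in> B e"
        using x rad_subset by blast
      have "nil (s \<odot> x)" if s: "s \<in> S" for s
      proof (rule nil_compress)
        show "nil ((e \<odot> (s \<odot> e)) \<odot> x)"
          using compB[OF s] x by (simp add: rad_def)
        show "x \<odot> (s \<odot> x) = x \<odot> ((e \<odot> (s \<odot> e)) \<odot> x)"
          using xB s SG eG by (simp add: B_def assoc xe)
      qed
      then show ?thesis
        using xB by (simp add: rad_def B_def)
    qed
    have uvB: "u \<odot> v \<in> B e" if "u \<in> U" "v \<in> V" for u v
      using that closS by (simp add: U_def V_def B_def assoc) (simp flip: assoc)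
    have decomp: "S \<subseteq> Y" if Y: "subring Y" "B e \<subseteq> Y" "U \<subseteq> Y" "V \<subseteq> Y" "T \<subseteq> Y" for Y
    proof
      fix s assume s: "s \<in> S"
      have "e \<odot> (s \<odot> e) + (e \<odot> s - e \<odot> (s \<odot> e)) + (s \<odot> e - e \<odot> (s \<odot> e))
        + (s - e \<odot> s - s \<odot> e + e \<odot> (s \<odot> e)) \<in> Y"
        using subsetD[OF Y(2) compB[OF s]] subsetD[OF Y(3) compU[OF s]]
          subsetD[OF Y(4) compV[OF s]] subsetD[OF Y(5) compT[OF s]]
        by (rule subringD(5)[OF Y(1) subringD(5)[OF Y(1) subringD(5)[OF Y(1)]]])
      then show "s \<in> Y"
        using peirce[of s] by simp
    qed
    \<comment> \<open>Common to both cases below: once a list \<open>C\<close> completes the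
      generation, its ranks are charged to \<open>e\<close> and added to those of the recursive
      call.\<close>
    have step: ?thesis
      if C: "length C \<le> c" "set C \<subseteq> S" "0 \<notin> set C"
        and Ce: "\<And>x. x \<in> set C \<Longrightarrow> e \<odot> x = x \<or> x \<odot> e = x"
        and gen: "\<And>Y. subring Y \<Longrightarrow> rad S \<subseteq> Y \<Longrightarrow> T \<subseteq> Y \<Longrightarrow> set C \<subseteq> Y \<Longrightarrow> S \<subseteq> Y" for C
    proof (intro exI conjI)
      let ?Y = "subring hull (rad S \<union> set (C @ E'))"
      have sub: "rad S \<union> set (C @ E') \<subseteq> G"
        using rad_subset[of S] C(2) E'(1) SG by (auto simp: T_def)
      have Y: "subring ?Y" "rad S \<union> set (C @ E') \<subseteq> ?Y"
        using subring_hull[OF sub] hull_subset[of _ subring] by auto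
      have "subring hull (rad T \<union> set E') \<subseteq> ?Y"
        using radT by (intro hull_mono) auto
      then show "S \<subseteq> ?Y"
        using E'(4) Y by (intro gen) auto
      show "set (C @ E') \<subseteq> S"
        using C(2) E'(1) by (auto simp: T_def)
      have \<epsilon>': "\<epsilon>' \<in> S" "e \<odot> \<epsilon>' = 0" "\<epsilon>' \<odot> e = 0"
        using E'(2) by (auto simp: T_def)
      show "e + \<epsilon>' \<in> S"
        using eS \<epsilon>' closS by simp
      show "(e + \<epsilon>') \<odot> (e + \<epsilon>') = e + \<epsilon>'"
        using eG SG \<epsilon>' ee E'(3) by simp
      show "\<forall>x\<in>set (C @ E'). rank_prod x > 1"
      proof
        fix x assume x: "x \<in> set (C @ E')"
        show "rank_prod x > 1"
        proof (cases "x \<in> set C")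
          case True
          then have "x \<in> G" "x \<noteq> 0"
            using C SG by auto
          then show ?thesis
            using rank_prod_gt_1 eG Ce[OF True] by blast
        qed (use x E'(5) in auto)
      qed
      have "prod_list (map rank_prod C) \<le> rank_prod e ^ length C"
        using C(2) Ce
        by (induction C) (use SG eG in \<open>auto intro!: mult_le_mono rank_prod_le\<close>)
      also have "\<dots> \<le> rank_prod e ^ c"
        using rank_prod_gt_1[of e e] eG ee local_unitD(3)[OF B] C(1)
        by (intro power_increasing) auto
      finally have "prod_list (map rank_prod (C @ E')) \<le> rank_prod e ^ c * rank_prod \<epsilon>' ^ c"
        using E'(6) by (simp add: mult_le_mono)
      also have "\<dots> \<le> rank_prod (e + \<epsilon>') ^ c"
        using rank_prod_orthogonal[of e \<epsilon>'] eG SG \<epsilon>' ee E'(3)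
        by (simp add: power_mono flip: power_mult_distrib)
      finally show "prod_list (map rank_prod (C @ E')) \<le> rank_prod (e + \<epsilon>') ^ c" .
    qed
    show ?thesis
    proof (cases "\<exists>u\<in>U. \<exists>v\<in>V. u \<odot> v \<notin> rad (B e)")
      case False
      then have uv: "u \<odot> v \<in> rad (B e)" if "u \<in> U" "v \<in> V" for u v
        using that by blast
      \<comment> \<open>For x in \<open>U\<close> the product x s x involves only the component c of
        \<open>s\<close> in \<open>V\<close>, and c x is nilpotent because x c lies in
        \<open>rad (B e)\<close>.\<close>
      have radU: "U \<subseteq> rad S"
      proof
        fix x assume x: "x \<in> U"
        have "nil (s \<odot> x)" if s: "s \<in> S" for s
        proof (rule nil_compress)
          let ?c = "s \<odot> e - e \<odot> (s \<odot> e)"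
          show "nil (?c \<odot> x)"
            by (rule nil_cyclic) (use uv[OF x compV[OF s]] rad_nil in blast)
          show "x \<odot> (s \<odot> x) = x \<odot> (?c \<odot> x)"
            using x s SG eG by (simp add: U_def assoc zz)
        qed
        then show "x \<in> rad S"
          using x by (simp add: rad_def U_def)
      qed
      have radV: "V \<subseteq> rad S"
      proof
        fix x assume x: "x \<in> V"
        have "nil (s \<odot> x)" if s: "s \<in> S" for s
        proof (rule nil_compress)
          let ?c = "e \<odot> s - e \<odot> (s \<odot> e)"
          show "nil (?c \<odot> x)"
            using uv[OF compU[OF s] x] rad_nil by blast
          show "x \<odot> (s \<odot> x) = x \<odot> (?c \<odot> x)"
            using x s SG eG by (simp add: V_def assoc xe)
        qed
        then show "x \<in> rad S"
          using x by (simp add: rad_def V_def)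
      qed
      obtain C where C: "finite C" "C \<subseteq> B e" "0 \<notin> C" "card C \<le> c" "B e \<subseteq> subring hull (rad (B e) \<union> C)"
        using local_generators[OF B c(1)] by blast
      obtain Cs where Cs: "set Cs = C" "length Cs = card C"
        using finite_distinct_list[OF C(1)] distinct_card by metis
      show ?thesis
      proof (rule step[of Cs])
        fix Y assume Y: "subring Y" "rad S \<subseteq> Y" "T \<subseteq> Y" "set Cs \<subseteq> Y"
        have "subring hull (rad (B e) \<union> C) \<subseteq> Y"
          by (rule hull_minimal) (use Y Cs radB in auto)
        then show "S \<subseteq> Y"
          using C(5) Y radU radV by (intro decomp) auto
      qed (use C Cs in \<open>auto simp: B_def\<close>)
    next
      case True
      then obtain u v0 where u: "u \<in> U" and v0: "v0 \<in> V" "u \<odot> v0 \<notin> rad (B e)"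
        by blast
      then have "\<not> nil (u \<odot> v0)"
        using local_rad_iff_nil[OF B uvB] by blast
      then obtain i where i: "pw (u \<odot> v0) (Suc i) = e"
        using local_pw_eq_unit[OF B uvB[OF u v0(1)]] by blast
      \<comment> \<open>An inverse of the unit u v0 is multiplied into \<open>v0\<close> to obtain u
        v = e. Now \<open>e\<close> is equivalent to the idempotent v u of \<open>T\<close>, so the
        components involving \<open>e\<close> are u T v, u T and T v, and \<open>T\<close> together
        with \<open>u\<close> and \<open>v\<close> generates everything.\<close>
      define v where "v = v0 \<odot> pw (u \<odot> v0) i"
      have "pw (u \<odot> v0) i \<in> B e"
        using subring_pw[OF srB uvB[OF u v0(1)]] .
      then have v: "v \<in> V"
        using v0(1) closS by (simp add: v_def V_def B_def assoc) (simp flip: assoc)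
      have uv: "u \<odot> v = e"
        using i by (simp add: v_def assoc)
      then have uvy: "u \<odot> (v \<odot> y) = e \<odot> y" for y
        by (simp flip: assoc)
      have uvS: "u \<in> S" "v \<in> S" "e \<odot> u = u" "u \<odot> e = 0" "e \<odot> v = 0" "v \<odot> e = v"
        using u v by (auto simp: U_def V_def)
      have nz: "u \<noteq> 0" "v \<noteq> 0"
        using uv local_unitD(3)[OF B] by auto
      show ?thesis
      proof (rule step[of "[u, v]"])
        fix Y assume Y: "subring Y" "rad S \<subseteq> Y" "T \<subseteq> Y" "set [u, v] \<subseteq> Y"
        have TY: "u \<odot> t \<in> Y" "t \<odot> v \<in> Y" "u \<odot> (t \<odot> v) \<in> Y" if "t \<in> T" for t
          using Y that by (auto intro!: subringD(3)[OF Y(1)])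
        show "S \<subseteq> Y"
        proof (rule decomp[OF Y(1) _ _ _ Y(3)])
          show "B e \<subseteq> Y"
          proof
            fix s assume s: "s \<in> B e"
            have "v \<odot> (s \<odot> u) \<in> T"
              using s uvS closS by (simp add: T_def B_def assoc) (simp flip: assoc)
            moreover have "s = u \<odot> ((v \<odot> (s \<odot> u)) \<odot> v)"
              using s by (simp add: assoc uv uvy B_def)
            ultimately show "s \<in> Y"
              using TY(3) by metis
          qed
          show "U \<subseteq> Y"
          proof
            fix s assume s: "s \<in> U"
            have "v \<odot> s \<in> T"
              using s uvS closS by (simp add: T_def U_def assoc) (simp flip: assoc)
            moreover have "s = u \<odot> (v \<odot> s)"
              using s by (simp add: uvy U_def)
            ultimately show "s \<in> Y"
              using TY(1) by metis
          qed
          show "V \<subseteq> Y"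
          proof
            fix s assume s: "s \<in> V"
            have "s \<odot> u \<in> T"
              using s uvS closS by (simp add: T_def V_def assoc) (simp flip: assoc)
            moreover have "s = (s \<odot> u) \<odot> v"
              using s by (simp add: assoc uv V_def)
            ultimately show "s \<in> Y"
              using TY(2) by metis
          qed
        qed
      qed (use c uvS nz in auto)
    qed
  qed
qed

end

section \<open>The radical as a nilpotent ring of its own\<close>

definition mult_restrict :: "'a set \<Rightarrow> ('a \<Rightarrow> 'a \<Rightarrow> 'a::zero) \<Rightarrow> 'a \<Rightarrow> 'a \<Rightarrow> 'a" where
  "mult_restrict J m x y = (if x \<in> J \<and> y \<in> J then m x y else 0)"

context ring_on
begin

text \<open>
  A nil ring acting on \<open>Y / Z\<close> annihilates a nonzero element, for instance any \<open>y\<close> with the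
  smallest \<open>G y + Z\<close>: if \<open>z = x y\<close> were nonzero modulo \<open>Z\<close>, then \<open>G z + Z\<close> would be smaller, as
  \<open>z = x' z\<close> modulo \<open>Z\<close> is impossible for nilpotent \<open>x'\<close>.
\<close>

lemma nil_annihilator:
  assumes nil: "\<And>x. x \<in> G \<Longrightarrow> nil x"
    and Z: "add_subgroup Z" "Z \<subseteq> G" "\<And>g z. g \<in> G \<Longrightarrow> z \<in> Z \<Longrightarrow> g \<odot> z \<in> Z"
    and Y: "Y \<subseteq> G" "\<And>g y. g \<in> G \<Longrightarrow> y \<in> Y \<Longrightarrow> g \<odot> y \<in> Y" "\<not> Y \<subseteq> Z"
  shows "\<exists>y\<in>Y - Z. \<forall>g\<in>G. g \<odot> y \<in> Z"
proof -
  define W where "W y = {w\<in>G. \<exists>x\<in>G. w - x \<odot> y \<in> Z}" for y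
  obtain y0 where "y0 \<in> Y - Z"
    using Y(3) by blast
  then have "\<exists>y. y \<in> Y - Z \<and> (\<forall>z. z \<in> Y - Z \<longrightarrow> card (W y) \<le> card (W z))"
    by (rule ex_has_least_nat)
  then obtain y where y: "y \<in> Y - Z" and min: "\<And>z. z \<in> Y - Z \<Longrightarrow> card (W y) \<le> card (W z)"
    by blast
  have "x \<odot> y \<in> Z" if x: "x \<in> G" for x
  proof (rule ccontr)
    assume z: "x \<odot> y \<notin> Z"
    define z where "z = x \<odot> y"
    have zY: "z \<in> Y - Z"
      using x y z Y(2) by (auto simp: z_def)
    have "W z \<subseteq> W y"
    proof
      fix w assume "w \<in> W z"
      then obtain x' where "w \<in> G" "x' \<in> G" "w - x' \<odot> z \<in> Z"
        by (auto simp: W_def)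
      then show "w \<in> W y"
        by (auto simp: W_def z_def simp flip: assoc intro!: bexI[of _ "x' \<odot> x"])
    qed
    moreover have "z \<in> W y"
      using x add_subgroup_zero[OF Z(1)] by (auto simp: W_def z_def intro!: bexI[of _ x])
    moreover have "z \<notin> W z"
    proof
      assume "z \<in> W z"
      then obtain x' where x': "x' \<in> G" "z - x' \<odot> z \<in> Z"
        by (auto simp: W_def)
      have zG: "z \<in> G"
        using zY Y(1) by blast
      have pw: "z - pw x' i \<odot> z \<in> Z" for i
      proof (induction i)
        case (Suc i)
        have "(z - x' \<odot> z) + x' \<odot> (z - pw x' i \<odot> z) \<in> Z"
          using Z x' Suc by (intro add_subgroup_add) auto
        also have "(z - x' \<odot> z) + x' \<odot> (z - pw x' i \<odot> z) = z - pw x' (Suc i) \<odot> z"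
          using x' zG by (simp add: assoc)
        finally show ?case .
      qed (use x' in simp)
      obtain i where "pw x' i = 0"
        using nil[OF x'(1)] unfolding nil_def by blast
      then show False
        using pw[of i] zY by simp
    qed
    ultimately have "W z \<subset> W y"
      by blast
    moreover have "finite (W y)"
      using fin by (simp add: W_def)
    ultimately have "card (W z) < card (W y)"
      by (rule psubset_card_mono[rotated])
    then show False
      using min[OF zY] by simp
  qed
  then show ?thesis
    using y by blast
qed

lemma ring_on_op: "ring_on G (\<lambda>x y. y \<odot> x)"
  by unfold_locales (auto simp: subgroup fin assoc outside)

text \<open>Take a largest ideal \<open>Z\<close> in which the condition of \<open>nilp\<close>
  holds. If Z \<noteq> G, applying \<open>nil_annihilator\<close> first on the left and then in the
  opposite ring gives an element outside \<open>Z\<close> that \<open>G\<close> multiplies into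
  \<open>Z\<close> from both sides. All such elements form an ideal Z', and any D \<subseteq> Z'
  with D \<subseteq> G D + D G already lies in \<open>Z\<close>; so Z' would be a larger
  choice.\<close>

lemma nil_imp_nilp:
  assumes nil: "\<And>x. x \<in> G \<Longrightarrow> nil x"
  shows "nilp G (\<odot>)"
proof -
  interpret op: ring_on G "\<lambda>x y. y \<odot> x"
    by (rule ring_on_op)
  have "op.pw x i = pw x i" for x i
    by (induction i) (simp_all add: pw_commute)
  then have op_nil: "op.nil x" if "x \<in> G" for x
    using nil[OF that] by (simp add: nil_def op.nil_def)
  define I where "I Z \<longleftrightarrow> add_subgroup Z \<and> Z \<subseteq> G \<and> (\<forall>g\<in>G. \<forall>z\<in>Z. g \<odot> z \<in> Z \<and> z \<odot> g \<in> Z)" for Z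
  define GD where "GD D = gen ((\<Union>x\<in>G. (\<odot>) x ` D) \<union> (\<Union>x\<in>G. (\<lambda>y. y \<odot> x) ` D))" for D
  define P where "P Z \<longleftrightarrow> I Z \<and> (\<forall>D. add_subgroup D \<and> D \<subseteq> Z \<and> D \<subseteq> GD D \<longrightarrow> D = {0})" for Z
  have "P {0}"
    using add_subgroup_zero by (auto simp: P_def I_def add_subgroup_singleton_0)
  moreover have "\<forall>Z. P Z \<longrightarrow> card Z < Suc (card G)"
    using card_mono[OF fin] by (simp add: P_def I_def le_imp_less_Suc)
  ultimately obtain Z where Z: "P Z" and max: "\<And>Z'. P Z' \<Longrightarrow> card Z' \<le> card Z"
    using ex_has_greatest_nat[of P "{0}" card "Suc (card G)"] by blast
  have I: "add_subgroup Z" "Z \<subseteq> G" "\<And>g z. g \<in> G \<Longrightarrow> z \<in> Z \<Longrightarrow> g \<odot> z \<in> Z" "\<And>g z. g \<in> G \<Longrightarrow> z \<in> Z \<Longrightarrow> z \<odot> g \<in> Z"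
    using Z by (auto simp: P_def I_def)
  have "G \<subseteq> Z"
  proof (rule ccontr)
    assume GZ: "\<not> G \<subseteq> Z"
    define Y where "Y = {y\<in>G. \<forall>g\<in>G. g \<odot> y \<in> Z}"
    obtain y1 where "y1 \<in> Y - Z"
      using nil_annihilator[OF nil I(1-3) subset_refl _ GZ] by (auto simp: Y_def)
    then have YZ: "\<not> Y \<subseteq> Z"
      by blast
    have "y \<odot> g \<in> Y" if "g \<in> G" "y \<in> Y" for g y
      using that I(4) by (auto simp: Y_def simp flip: assoc)
    then obtain y where y: "y \<in> Y - Z" "\<And>g. g \<in> G \<Longrightarrow> y \<odot> g \<in> Z"
      using op.nil_annihilator[OF op_nil I(1,2,4) _ _ YZ] by (auto simp: Y_def)
    define Z' where "Z' = {y\<in>G. \<forall>g\<in>G. g \<odot> y \<in> Z \<and> y \<odot> g \<in> Z}"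
    have ZZ': "Z \<subset> Z'"
      using y I by (auto simp: Z'_def Y_def)
    have I': "I Z'"
      unfolding I_def
    proof (intro conjI)
      show "add_subgroup Z'"
        by (rule add_subgroupI)
           (use I(1) in \<open>auto simp: Z'_def add_subgroup_zero add_subgroup_diff\<close>)
      show "\<forall>g\<in>G. \<forall>z\<in>Z'. g \<odot> z \<in> Z' \<and> z \<odot> g \<in> Z'"
        using I(3,4) ZZ' by (auto simp: Z'_def assoc)
    qed (auto simp: Z'_def)
    have "D = {0}" if D: "add_subgroup D" "D \<subseteq> Z'" "D \<subseteq> GD D" for D
    proof -
      have "GD D \<subseteq> Z"
        unfolding GD_def by (rule gen_least[OF _ I(1)]) (use D(2) in \<open>auto simp: Z'_def\<close>)
      then show ?thesis
        using Z D unfolding P_def by blast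
    qed
    then have "P Z'"
      using I' by (simp add: P_def)
    moreover have "finite Z'"
      using fin by (simp add: Z'_def)
    ultimately show False
      using max[of Z'] psubset_card_mono[OF _ ZZ'] by fastforce
  qed
  then have "Z = G"
    using I by blast
  then show ?thesis
    using Z unfolding P_def GD_def nilp_def by blast
qed

lemma ring_on_mult_restrict:
  assumes "subring J"
  shows "ring_on J (mult_restrict J (\<odot>))"
  by unfold_locales (use subringD[OF assms] in \<open>auto simp: mult_restrict_def assoc\<close>)

lemma nilp_mult_restrict_rad: "nilp (rad G) (mult_restrict (rad G) (\<odot>))"
proof -
  interpret J: ring_on "rad G" "mult_restrict (rad G) (\<odot>)"
    by (rule ring_on_mult_restrict[OF subring_rad[OF subring_G]])
  have "J.nil x" if x: "x \<in> rad G" for x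
  proof -
    have "pw x i \<in> rad G" for i
      using subring_pw[OF subring_rad[OF subring_G] x] .
    then have "J.pw x i = pw x i" for i
      by (induction i) (simp_all add: mult_restrict_def x)
    then show ?thesis
      using rad_nil[OF x] by (simp add: nil_def J.nil_def)
  qed
  then show ?thesis
    by (rule J.nil_imp_nilp)
qed

text \<open>The elements that have the same products in both rings form a subring \<open>T\<close>,
  by associativity. Elements of \<open>J\<close> need not belong to \<open>T\<close>, since only
  their products with each other are compared. But \<open>J\<close> is an ideal, so J + T is a
  subring containing all generators, and products of two sums j + t can be compared term by
  term.\<close>

lemma mult_eqI:
  assumes m': "ring_on G m'"
    and J: "add_subgroup J" "J \<subseteq> G" "\<And>g x. g \<in> G \<Longrightarrow> x \<in> J \<Longrightarrow> g \<odot> x \<in> J \<and> x \<odot> g \<in> J"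
    and gen: "X \<subseteq> G" "G \<subseteq> subring hull (J \<union> X)"
    and X: "\<And>x y. x \<in> X \<Longrightarrow> y \<in> G \<Longrightarrow> x \<odot> y = m' x y \<and> y \<odot> x = m' y x"
    and JJ: "\<And>x y. x \<in> J \<Longrightarrow> y \<in> J \<Longrightarrow> x \<odot> y = m' x y"
  shows "(\<odot>) = m'"
proof -
  interpret M: ring_on G m' by fact
  define T where "T = {h\<in>G. \<forall>y\<in>G. h \<odot> y = m' h y \<and> y \<odot> h = m' y h}"
  have T: "h \<odot> y = m' h y" "y \<odot> h = m' y h" if "h \<in> T" "y \<in> G" for h y
    using that by (auto simp: T_def)
  have TG: "T \<subseteq> G"
    by (auto simp: T_def)
  have aT: "add_subgroup T"
    by (rule add_subgroupI) (auto simp: T_def)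
  have mT: "g \<odot> h \<in> T" if "g \<in> T" "h \<in> T" for g h
  proof -
    have "(g \<odot> h) \<odot> y = m' (g \<odot> h) y \<and> y \<odot> (g \<odot> h) = m' y (g \<odot> h)" if y: "y \<in> G" for y
    proof
      have "(g \<odot> h) \<odot> y = g \<odot> m' h y"
        using T(1)[OF \<open>h \<in> T\<close> y] by (simp add: assoc)
      also have "\<dots> = m' (m' g h) y"
        using T(1)[OF \<open>g \<in> T\<close>, of "m' h y"] by (simp add: M.assoc)
      also have "m' g h = g \<odot> h"
        using T(1)[OF \<open>g \<in> T\<close>, of h] \<open>h \<in> T\<close> TG by auto
      finally show "(g \<odot> h) \<odot> y = m' (g \<odot> h) y" .
      have "y \<odot> (g \<odot> h) = m' y g \<odot> h"
        using T(2)[OF \<open>g \<in> T\<close> y] by (simp flip: assoc)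
      also have "\<dots> = m' y (m' g h)"
        using T(2)[OF \<open>h \<in> T\<close>, of "m' y g"] by (simp add: M.assoc)
      also have "m' g h = g \<odot> h"
        using T(1)[OF \<open>g \<in> T\<close>, of h] \<open>h \<in> T\<close> TG by auto
      finally show "y \<odot> (g \<odot> h) = m' y (g \<odot> h)" .
    qed
    then show ?thesis
      by (simp add: T_def)
  qed
  define W where "W = {j + t |j t. j \<in> J \<and> t \<in> T}"
  have "subring W"
    unfolding subring_def
  proof (intro conjI ballI)
    show "add_subgroup W"
    proof (rule add_subgroupI)
      show "0 \<in> W"
        using add_subgroup_zero[OF J(1)] add_subgroup_zero[OF aT] by (force simp: W_def)
      fix x y assume "x \<in> W" "y \<in> W"
      then obtain j t j' t' where "j \<in> J" "j' \<in> J" "t \<in> T" "t' \<in> T" "x = j + t" "y = j' + t'"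
        by (auto simp: W_def)
      moreover have "(j + t) - (j' + t') = (j - j') + (t - t')"
        by simp
      ultimately show "x - y \<in> W"
        using add_subgroup_diff[OF J(1)] add_subgroup_diff[OF aT] unfolding W_def by blast
    qed
    show "W \<subseteq> G"
      using J(2) TG by (auto simp: W_def subset_eq)
    fix x y assume "x \<in> W" "y \<in> W"
    then obtain j t j' t' where jt: "j \<in> J" "j' \<in> J" "t \<in> T" "t' \<in> T" "x = j + t" "y = j' + t'"
      by (auto simp: W_def)
    have "x \<odot> y = (j \<odot> (j' + t') + t \<odot> j') + t \<odot> t'"
      using jt J(2) TG by (simp add: subset_eq)
    moreover have "j \<odot> (j' + t') + t \<odot> j' \<in> J"
    proof (rule add_subgroup_add[OF J(1)])
      have "j' + t' \<in> G"
        using jt J(2) TG by (simp add: subset_eq)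
      then show "j \<odot> (j' + t') \<in> J"
        using J(3) jt(1) by blast
      show "t \<odot> j' \<in> J"
        using J(3) jt TG by blast
    qed
    ultimately show "x \<odot> y \<in> W"
      using mT jt unfolding W_def by blast
  qed
  moreover have "J \<subseteq> W" "X \<subseteq> W"
    using add_subgroup_zero[OF J(1)] add_subgroup_zero[OF aT] X gen(1)
    by (force simp: W_def T_def)+
  ultimately have "subring hull (J \<union> X) \<subseteq> W"
    by (intro hull_minimal) auto
  then have W: "G \<subseteq> W"
    using gen(2) by blast
  have "x \<odot> y = m' x y" if "x \<in> G" "y \<in> G" for x y
  proof -
    obtain j t where x: "j \<in> J" "t \<in> T" "x = j + t"
      using \<open>x \<in> G\<close> W by (auto simp: W_def)
    obtain j' t' where y: "j' \<in> J" "t' \<in> T" "y = j' + t'"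
      using \<open>y \<in> G\<close> W by (auto simp: W_def)
    have G: "j \<in> G" "t \<in> G" "j' \<in> G" "t' \<in> G"
      using x y J(2) TG by auto
    show ?thesis
      using x y G JJ[OF x(1) y(1)] T[OF x(2)] T[OF y(2)]
      by (simp add: M.add_left M.add_right)
  qed
  then show ?thesis
    using outside M.outside by (intro ext) metis
qed

end

section \<open>All multiplications on a fixed group\<close>

context prime_power_group
begin

lemma rank_prod_eq:
  assumes m: "ring_on G m" and x: "x \<in> G"
  shows "sub (m x ` G)" "sub ((\<lambda>y. m y x) ` G)"
    "ring_on.rank_prod G m x = p ^ (dm (m x ` G) + dm ((\<lambda>y. m y x) ` G))"
proof -
  interpret R: ring_on G m by fact
  show *: "sub (m x ` G)" "sub ((\<lambda>y. m y x) ` G)"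
    using x by (auto intro!: add_subgroup_image subgroup_G)
  show "R.rank_prod x = p ^ (dm (m x ` G) + dm ((\<lambda>y. m y x) ` G))"
    using card_sub[OF *(1)] card_sub[OF *(2)] by (simp add: R.rank_prod_def power_add)
qed

text \<open>The left and right ranks of \<epsilon> add up to at most 2 n, so those of the generators
  add up to at most 2 n c. As each generator contributes at least 1, this also bounds their number,
  and 0, which contributes nothing, pads them to a tuple of length 2 n c.\<close>

lemma ex_radical_generators:
  assumes m: "ring_on G m" and c: "p ^ n < 2 ^ (2 ^ c)" "2 \<le> c"
  shows "\<exists>J x. sub J \<and> ring_on J (mult_restrict J m) \<and> nilp J (mult_restrict J m) \<and>
    x \<in> {..<2 * n * c} \<rightarrow>\<^sub>E G \<and>
    (\<Sum>i<2 * n * c. dm (m (x i) ` G) + dm ((\<lambda>y. m y (x i)) ` G)) \<le> 2 * n * c \<and>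
    (\<forall>m'. ring_on G m' \<longrightarrow> (\<forall>i<2 * n * c. \<forall>y\<in>G. m (x i) y = m' (x i) y \<and> m y (x i) = m' y (x i)) \<longrightarrow>
       (\<forall>x\<in>J. \<forall>y\<in>J. m x y = m' x y) \<longrightarrow> m = m')"
proof -
  interpret R: ring_on G m by fact
  let ?J = "R.rad G"
  define g where "g = 2 * n * c"
  define w where "w x = dm (m x ` G) + dm ((\<lambda>y. m y x) ` G)" for x
  have rp: "R.rank_prod x = p ^ w x" if "x \<in> G" for x
    using rank_prod_eq[OF m that] by (simp add: w_def)
  obtain E \<epsilon> where E: "set E \<subseteq> G" "\<epsilon> \<in> G" "G \<subseteq> R.subring hull (?J \<union> set E)"
    "\<forall>x\<in>set E. R.rank_prod x > 1" "prod_list (map R.rank_prod E) \<le> R.rank_prod \<epsilon> ^ c"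
    using R.rad_generators[OF _ c(2) R.subring_G] c(1) card_G by metis
  have "prod_list (map R.rank_prod E) = p ^ sum_list (map w E)"
    using E(1) by (induction E) (simp_all add: rp power_add)
  moreover have "w \<epsilon> \<le> 2 * n"
    using dm_le[OF rank_prod_eq(1)[OF m E(2)]] dm_le[OF rank_prod_eq(2)[OF m E(2)]]
    by (simp add: w_def)
  then have "R.rank_prod \<epsilon> ^ c \<le> p ^ (2 * n * c)"
    using rp[OF E(2)] p_gt_1 by (simp flip: power_mult)
  ultimately have "p ^ sum_list (map w E) \<le> p ^ g"
    using E(5) by (simp add: g_def)
  then have sum: "sum_list (map w E) \<le> g"
    using p_gt_1 by simp
  have "w x \<ge> 1" if "x \<in> set E" for x
  proof -
    have "x \<in> G" "R.rank_prod x > 1"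
      using E(1,4) that by auto
    then show ?thesis
      using rp[of x] by (cases "w x") auto
  qed
  then have "length E \<le> sum_list (map w E)"
  proof (induction E)
    case (Cons a E)
    then have "1 \<le> w a" "length E \<le> sum_list (map w E)"
      by simp_all
    then show ?case
      by simp
  qed simp
  then have len: "length E \<le> g"
    using sum by simp
  define x where "x = (\<lambda>i\<in>{..<g}. if i < length E then E ! i else 0)"
  have x: "x \<in> {..<g} \<rightarrow>\<^sub>E G"
    using E(1) by (auto simp: x_def subset_iff)
  have xE: "set E \<subseteq> x ` {..<g}"
  proof
    fix e assume "e \<in> set E"
    then obtain i where "i < length E" "e = E ! i"
      by (metis in_set_conv_nth)
    then show "e \<in> x ` {..<g}"
      using len by (intro image_eqI[of _ _ i]) (auto simp: x_def)
  qed
  have w0: "w 0 = 0"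
  proof -
    have "m 0 ` G = {0}" "(\<lambda>y. m y 0) ` G = {0}"
      by (auto intro!: image_eqI[of _ _ 0])
    moreover have "dm {0} = 0"
    proof -
      have "p ^ dm {0} = 1"
        using card_sub[OF sub_0] by simp
      then show ?thesis
        using p_gt_1 by simp
    qed
    ultimately show ?thesis
      by (simp add: w_def)
  qed
  have "(\<Sum>i<g. w (x i)) = (\<Sum>i<length E. w (E ! i))"
    using len w0 by (intro sum.mono_neutral_cong_right) (auto simp: x_def)
  also have "\<dots> = sum_list (map w E)"
    by (simp add: sum_list_sum_nth atLeast0LessThan)
  finally have "(\<Sum>i<g. w (x i)) \<le> g"
    using sum by simp
  moreover have "m = m'" if m': "ring_on G m'"
    and X: "\<forall>i<g. \<forall>y\<in>G. m (x i) y = m' (x i) y \<and> m y (x i) = m' y (x i)"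
    and J: "\<forall>x\<in>?J. \<forall>y\<in>?J. m x y = m' x y" for m'
  proof (rule R.mult_eqI[OF m'])
    show "add_subgroup ?J" "?J \<subseteq> G"
      using R.subringD(1,2)[OF R.subring_rad[OF R.subring_G]] .
    show "m h y \<in> ?J \<and> m y h \<in> ?J" if "h \<in> G" "y \<in> ?J" for h y
      using R.rad_left[OF R.subring_G that(2,1)] R.rad_right[OF R.subring_G that(2,1)] by blast
    show "x ` {..<g} \<subseteq> G"
      using x by blast
    have "R.subring hull (?J \<union> set E) \<subseteq> R.subring hull (?J \<union> x ` {..<g})"
      using xE by (intro hull_mono) blast
    then show "G \<subseteq> R.subring hull (?J \<union> x ` {..<g})"
      using E(3) by blast
  qed (use X J in auto)
  ultimately show ?thesis
    using x R.subringD(1,2)[OF R.subring_rad[OF R.subring_G]] R.ring_on_mult_restrict[OF R.subring_rad[OF R.subring_G]]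
      R.nilp_mult_restrict_rad unfolding g_def w_def by (intro exI[of _ ?J] exI[of _ x]) simp
qed

text \<open>With g = 2 n c the digits are n g for the generators, 2 n g for their ranks, n^2 for a
  generating set of \<open>J\<close>, and 4 n g for the multiplications by the generators, whose
  ranks add up to at most \<open>g\<close>. The total 7 n g + n^2 is at most 15 c n^2; the
  multiplication on \<open>J\<close> is left to \<open>card_nilp\<close>.\<close>

theorem card_ring_on:
  assumes k: "1 \<le> k" "n \<le> k\<^sup>2" and c: "p ^ n < 2 ^ (2 ^ c)" "2 \<le> c"
  shows "finite {m. ring_on G m} \<and>
    card {m. ring_on G m} \<le> p ^ (15 * c * n\<^sup>2 + 13 * k * n\<^sup>2 + 4 * n ^ 3 div 27)"
proof -
  let ?M = "p ^ (13 * k * n\<^sup>2 + 4 * n ^ 3 div 27)"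
  define S where "S = {m. ring_on G m}"
  define g where "g = 2 * n * c"
  define w where "w m x = dm (m x ` G) + dm ((\<lambda>y. m y x) ` G)" for m and x :: 'a
  obtain \<gamma> where \<gamma>: "\<gamma> ` {..<n} \<subseteq> G" "G = gen (\<gamma> ` {..<n})"
    using ex_gens by blast
  have S: "ring_on G m" if "m \<in> S" for m
    using that by (simp add: S_def)
  define P where "P m J x \<longleftrightarrow> sub J \<and> ring_on J (mult_restrict J m) \<and> nilp J (mult_restrict J m) \<and>
    x \<in> {..<g} \<rightarrow>\<^sub>E G \<and> (\<Sum>i<g. w m (x i)) \<le> g \<and>
    (\<forall>m'. ring_on G m' \<longrightarrow> (\<forall>i<g. \<forall>y\<in>G. m (x i) y = m' (x i) y \<and> m y (x i) = m' y (x i)) \<longrightarrow>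
       (\<forall>x\<in>J. \<forall>y\<in>J. m x y = m' x y) \<longrightarrow> m = m')" for m J x
  have "\<forall>m\<in>S. \<exists>J x. P m J x"
    using ex_radical_generators[OF S c] unfolding P_def g_def w_def by blast
  then obtain J x where P: "\<And>m. m \<in> S \<Longrightarrow> P m (J m) (x m)"
    by metis
  have J: "sub (J m)" "ring_on (J m) (mult_restrict (J m) m)" "nilp (J m) (mult_restrict (J m) m)"
    and x: "x m \<in> {..<g} \<rightarrow>\<^sub>E G" "(\<Sum>i<g. w m (x m i)) \<le> g" if "m \<in> S" for m
    using P[OF that] unfolding P_def by blast+
  have eqI: "m = m'" if m: "m \<in> S" "m' \<in> S"
    and "\<And>i y. i < g \<Longrightarrow> y \<in> G \<Longrightarrow> m (x m i) y = m' (x m i) y \<and> m y (x m i) = m' y (x m i)"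
    and "\<And>x y. x \<in> J m \<Longrightarrow> y \<in> J m \<Longrightarrow> m x y = m' x y" for m m'
  proof -
    have "ring_on G m' \<longrightarrow> (\<forall>i<g. \<forall>y\<in>G. m (x m i) y = m' (x m i) y \<and> m y (x m i) = m' y (x m i)) \<longrightarrow>
       (\<forall>x\<in>J m. \<forall>y\<in>J m. m x y = m' x y) \<longrightarrow> m = m'"
      using P[OF m(1)] unfolding P_def by blast
    then show ?thesis
      using S[OF m(2)] that(3,4) by blast
  qed
  have "\<exists>j \<in> {..<n} \<rightarrow>\<^sub>E G. gen (insert 0 (j ` {..<n})) = J m" if "m \<in> S" for m
  proof -
    have Jm: "sub (J m)"
      using J(1) that .
    then have "{0} \<subseteq> J m" "dm (J m) \<le> dm {0} + n"
      using add_subgroup_zero dm_le by (auto intro: trans_le_add2)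
    then obtain j where j: "j ` {..<n} \<subseteq> J m" "J m = gen ({0} \<union> j ` {..<n})"
      using ex_generators[of "{0}" "J m" n] sub_0 Jm by blast
    then show ?thesis
      using Jm by (intro bexI[of _ "restrict j {..<n}"]) auto
  qed
  then obtain j where j: "\<And>m. m \<in> S \<Longrightarrow> j m \<in> {..<n} \<rightarrow>\<^sub>E G"
    "\<And>m. m \<in> S \<Longrightarrow> gen (insert 0 (j m ` {..<n})) = J m"
    by metis
  \<comment> \<open>The individual ranks belong to the code: only their sum is small, so each
    multiplication has to be charged at its own rank.\<close>
  define f where "f m = (x m, (\<lambda>i\<in>{..<g}. w m (x m i)), j m)" for m
  define B where "B = ({..<g} \<rightarrow>\<^sub>E G) \<times> ({..<g} \<rightarrow>\<^sub>E {..2 * n}) \<times> ({..<n} \<rightarrow>\<^sub>E G)"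
  have w_le: "w m y \<le> 2 * n" if "m \<in> S" "y \<in> G" for m y
    using dm_le[OF rank_prod_eq(1)[OF S that(2)]] dm_le[OF rank_prod_eq(2)[OF S that(2)]] that
    by (fastforce simp: w_def)
  have "f m \<in> B" if m: "m \<in> S" for m
  proof -
    have "x m i \<in> G" if "i < g" for i
      using x(1)[OF m] that by auto
    then show ?thesis
      using x(1)[OF m] j(1)[OF m] w_le[OF m] by (simp add: f_def B_def restrict_PiE_iff)
  qed
  then have fB: "f ` S \<subseteq> B"
    by blast
  have "2 * n + 1 \<le> p ^ (2 * n)"
  proof -
    have "2 * n + 1 \<le> 2 ^ (2 * n)"
      using less_exp[of "2 * n"] unfolding Suc_eq_plus1[symmetric] by (rule Suc_leI)
    also have "\<dots> \<le> p ^ (2 * n)"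
      using p_gt_1 by (intro power_mono) auto
    finally show ?thesis .
  qed
  then have "(2 * n + 1) ^ g \<le> p ^ (2 * n * g)"
    by (simp add: power_mono power_mult)
  then have "p ^ (n * g) * (2 * n + 1) ^ g * p ^ (n * n) \<le> p ^ (n * g) * p ^ (2 * n * g) * p ^ (n * n)"
    by simp
  moreover have "card B = p ^ (n * g) * (2 * n + 1) ^ g * p ^ (n * n)"
    by (simp add: B_def card_cartesian_product card_PiE card_G flip: power_mult)
  ultimately have B: "finite B" "card B \<le> p ^ (n * g + 2 * n * g + n * n)"
    by (simp_all only: power_add) (simp add: B_def finite_PiE finite_G)
  define N where "N = p ^ (4 * n * g) * ?M"
  have fibre: "finite {m\<in>S. f m = b} \<and> card {m\<in>S. f m = b} \<le> N" for b
  proof (cases "{m\<in>S. f m = b} = {}")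
    case False
    then obtain m0 where m0: "m0 \<in> S" "f m0 = b" by blast
    define S1 where "S1 = {m\<in>S. f m = b}"
    define x0 where "x0 = x m0"
    define w0 where "w0 i = w m0 (x0 i)" for i
    define J0 where "J0 = J m0"
    have x0G: "x0 i \<in> G" if "i < g" for i
      using x(1)[OF m0(1)] that by (auto simp: x0_def)
    have S1: "m \<in> S" "x m = x0" "J m = J0" if m: "m \<in> S1" for m
    proof -
      show mS: "m \<in> S"
        using m by (simp add: S1_def)
      have "f m = f m0"
        using m m0 by (simp add: S1_def)
      then show "x m = x0" "J m = J0"
        using j(2)[OF mS] j(2)[OF m0(1)] by (simp_all add: f_def x0_def J0_def)
    qed
    have wS1: "w m (x0 i) = w0 i" if m: "m \<in> S1" and i: "i < g" for m i
    proof -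
      have "f m = f m0"
        using m m0 by (simp add: S1_def)
      then have eq: "(\<lambda>i\<in>{..<g}. w m (x m i)) = (\<lambda>i\<in>{..<g}. w m0 (x m0 i))"
        unfolding f_def prod.inject by (elim conjE)
      show ?thesis
        using fun_cong[OF eq, of i] i S1(2)[OF m] by (simp add: w0_def x0_def)
    qed
    \<comment> \<open>Cosets of \<open>{0}\<close> bring the products themselves into the format of
      \<open>low_rank_maps\<close>.\<close>
    define h where "h m = ((\<lambda>i\<in>{..<g}. \<lambda>l\<in>{..<n}. coset {0} (m (x0 i) (\<gamma> l))),
      (\<lambda>i\<in>{..<g}. \<lambda>l\<in>{..<n}. coset {0} (m (\<gamma> l) (x0 i))))" for m :: "'a \<Rightarrow> 'a \<Rightarrow> 'a"
    define C where "C = (\<Pi>\<^sub>E i\<in>{..<g}. low_rank_maps {0} (w0 i)) \<times> (\<Pi>\<^sub>E i\<in>{..<g}. low_rank_maps {0} (w0 i))"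
    have "h m \<in> C" if m: "m \<in> S1" for m
    proof -
      have "(\<lambda>l\<in>{..<n}. coset {0} (m (x0 i) (\<gamma> l))) \<in> low_rank_maps {0} (w0 i)"
        "(\<lambda>l\<in>{..<n}. coset {0} (m (\<gamma> l) (x0 i))) \<in> low_rank_maps {0} (w0 i)" if i: "i < g" for i
      proof -
        note sub = rank_prod_eq(1,2)[OF S[OF S1(1)[OF m]] x0G[OF i]]
        have "dm (m (x0 i) ` G) \<le> w0 i" "dm ((\<lambda>y. m y (x0 i)) ` G) \<le> w0 i"
          using wS1[OF m i] by (auto simp: w_def)
        then show "(\<lambda>l\<in>{..<n}. coset {0} (m (x0 i) (\<gamma> l))) \<in> low_rank_maps {0} (w0 i)"
          "(\<lambda>l\<in>{..<n}. coset {0} (m (\<gamma> l) (x0 i))) \<in> low_rank_maps {0} (w0 i)"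
          using low_rank_map_mult[OF S[OF S1(1)[OF m]] \<gamma>(1) sub_0 x0G[OF i]] sub
          by (simp_all add: gen_insert_0 gen_eq)
      qed
      then show ?thesis
        unfolding h_def C_def by (intro SigmaI restrict_PiE_iff[THEN iffD2] ballI) auto
    qed
    then have hC: "h ` S1 \<subseteq> C"
      by blast
    have fin: "finite (\<Pi>\<^sub>E i\<in>{..<g}. low_rank_maps {0} (w0 i))"
      using card_low_rank_maps[OF sub_0] by (intro finite_PiE) auto
    have "card (\<Pi>\<^sub>E i\<in>{..<g}. low_rank_maps {0} (w0 i)) \<le> (\<Prod>i<g. p ^ (2 * n * w0 i))"
      using card_low_rank_maps[OF sub_0] by (auto simp: card_PiE intro!: prod_mono)
    also have "\<dots> = p ^ (2 * n * (\<Sum>i<g. w0 i))"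
      by (simp add: power_sum sum_distrib_left)
    also have "\<dots> \<le> p ^ (2 * n * g)"
      using x(2)[OF m0(1)] p_gt_1 by (simp add: w0_def x0_def)
    finally have "card C \<le> p ^ (2 * n * g) * p ^ (2 * n * g)"
      unfolding C_def card_cartesian_product by (intro mult_le_mono)
    also have "\<dots> = p ^ (4 * n * g)"
    proof -
      have "2 * n * g + 2 * n * g = 4 * n * g"
        by simp
      then show ?thesis
        by (simp only: flip: power_add)
    qed
    finally have C: "finite C" "card C \<le> p ^ (4 * n * g)"
      using fin by (simp_all add: C_def)
    interpret J0: prime_power_group p "dm J0" J0
      using J(1)[OF m0(1)] card_sub prime finite_sub by unfold_locales (auto simp: J0_def)
    have J0n: "dm J0 \<le> n"
      using dm_le[OF J(1)[OF m0(1)]] by (simp add: J0_def)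
    have "p ^ (13 * k * (dm J0)\<^sup>2 + 4 * dm J0 ^ 3 div 27) \<le> ?M"
      using p_gt_1 J0n by (intro power_increasing add_mono mult_le_mono div_le_mono power_mono) auto
    then have nil: "finite {m. ring_on J0 m \<and> nilp J0 m}"
      "card {m. ring_on J0 m \<and> nilp J0 m} \<le> ?M"
      using J0.card_nilp[of k] k J0n by auto
    have "finite {m\<in>S1. h m = a} \<and>
      card {m\<in>S1. h m = a} \<le> ?M" for a
    proof -
      have inj: "inj_on (mult_restrict J0) {m\<in>S1. h m = a}"
      proof (rule inj_onI)
        fix m m' assume m: "m \<in> {m\<in>S1. h m = a}" "m' \<in> {m\<in>S1. h m = a}"
          and eq: "mult_restrict J0 m = mult_restrict J0 m'"
        have S1m: "m \<in> S1" "m' \<in> S1"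
          using m by auto
        have "h m = h m'"
          using m by simp
        then have l: "(\<lambda>i\<in>{..<g}. \<lambda>l\<in>{..<n}. coset {0} (m (x0 i) (\<gamma> l)))
            = (\<lambda>i\<in>{..<g}. \<lambda>l\<in>{..<n}. coset {0} (m' (x0 i) (\<gamma> l)))"
          and r: "(\<lambda>i\<in>{..<g}. \<lambda>l\<in>{..<n}. coset {0} (m (\<gamma> l) (x0 i)))
            = (\<lambda>i\<in>{..<g}. \<lambda>l\<in>{..<n}. coset {0} (m' (\<gamma> l) (x0 i)))"
          by (simp_all add: h_def)
        have "m (x0 i) (\<gamma> l) = m' (x0 i) (\<gamma> l)" "m (\<gamma> l) (x0 i) = m' (\<gamma> l) (x0 i)"
          if "i < g" "l < n" for i l
          using fun_cong[OF fun_cong[OF l], of i l] fun_cong[OF fun_cong[OF r], of i l] that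
          by (simp_all add: coset_def)
        then have "m (x0 i) y = m' (x0 i) y \<and> m y (x0 i) = m' y (x0 i)" if "i < g" "y \<in> G" for i y
          using mult_eq_on_gens[OF S[OF S1(1)[OF S1m(1)]] S[OF S1(1)[OF S1m(2)]] \<gamma>(2) x0G[OF that(1)] that(2)]
            that by blast
        moreover have "m y z = m' y z" if "y \<in> J0" "z \<in> J0" for y z
          using fun_cong[OF fun_cong[OF eq], of y z] that by (simp add: mult_restrict_def)
        ultimately show "m = m'"
          using eqI[of m m'] S1[OF S1m(1)] S1[OF S1m(2)] by simp
      qed
      have "mult_restrict J0 ` {m\<in>S1. h m = a} \<subseteq> {m. ring_on J0 m \<and> nilp J0 m}"
        using J(2,3) S1 by fastforce
      then show ?thesis
        using inj nil by (meson card_inj_on_le inj_on_finite le_trans)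
    qed
    then have "finite S1 \<and> card S1 \<le> card C * ?M"
      by (intro card_le_fibers[OF C(1) hC]) auto
    moreover have "card C * ?M \<le> N"
      unfolding N_def by (rule mult_le_mono1[OF C(2)])
    ultimately show ?thesis
      by (simp add: S1_def)
  qed (auto simp del: Collect_empty_eq)
  have "finite S \<and> card S \<le> card B * N"
    by (rule card_le_fibers[OF _ fB]) (use B fibre in auto)
  moreover have "card B * N \<le> p ^ (15 * c * n\<^sup>2 + 13 * k * n\<^sup>2 + 4 * n ^ 3 div 27)"
  proof -
    have "card B * N \<le> p ^ (n * g + 2 * n * g + n * n) * N"
      by (rule mult_le_mono1[OF B(2)])
    also have "\<dots> = p ^ (7 * n * g + n * n + (13 * k * n\<^sup>2 + 4 * n ^ 3 div 27))"
    proof -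
      have "n * g + 2 * n * g + n * n + (4 * n * g + (13 * k * n\<^sup>2 + 4 * n ^ 3 div 27))
          = 7 * n * g + n * n + (13 * k * n\<^sup>2 + 4 * n ^ 3 div 27)"
        by simp
      then show ?thesis
        unfolding N_def by (simp only: flip: power_add)
    qed
    also have "\<dots> \<le> p ^ (15 * c * n\<^sup>2 + (13 * k * n\<^sup>2 + 4 * n ^ 3 div 27))"
    proof (rule power_increasing)
      have "7 * n * g = 14 * (c * (n * n))" "15 * c * n\<^sup>2 = 15 * (c * (n * n))"
        by (simp_all add: g_def power2_eq_square)
      moreover have "n * n \<le> c * (n * n)"
        using c(2) by (cases c) auto
      ultimately show "7 * n * g + n * n + (13 * k * n\<^sup>2 + 4 * n ^ 3 div 27)
          \<le> 15 * c * n\<^sup>2 + (13 * k * n\<^sup>2 + 4 * n ^ 3 div 27)"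
        by linarith
    qed (use p_gt_1 in simp)
    finally show ?thesis
      by (simp add: add.assoc)
  qed
  ultimately show ?thesis
    by (simp add: S_def)
qed

end

section \<open>Isomorphism classes of groups and rings\<close>

definition nmul :: "nat \<Rightarrow> 'a::ab_group_add \<Rightarrow> 'a" where
  "nmul k x = (((+) x) ^^ k) 0"

lemma nmul_0 [simp]: "nmul 0 x = 0"
  by (simp add: nmul_def)

lemma nmul_Suc [simp]: "nmul (Suc k) x = x + nmul k x"
  by (simp add: nmul_def)

lemma nmul_add: "nmul (k + l) x = nmul k x + nmul l x"
  by (induction k) (simp_all add: add.assoc)

lemma nmul_mult: "nmul (k * l) x = nmul k (nmul l x)"
  by (induction k) (simp_all add: nmul_add)

lemma nmul_diff: "l \<le> k \<Longrightarrow> nmul (k - l) x = nmul k x - nmul l x"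
  using nmul_add[of "k - l" l x] by simp

lemma nmul_mem: "add_subgroup G \<Longrightarrow> x \<in> G \<Longrightarrow> nmul k x \<in> G"
  by (induction k) (auto simp: add_subgroup_zero add_subgroup_add)

text \<open>Translation by \<open>x\<close> permutes \<open>G\<close>, so the sum of all x + y
  equals the sum of all y.\<close>

lemma nmul_card_eq_0:
  assumes "add_subgroup G" "finite G" "x \<in> G"
  shows "nmul (card G) x = 0"
proof -
  have "(\<Sum>y\<in>F. x + y) = nmul (card F) x + \<Sum>F" if "finite F" for F
    using that by (induction F) (simp_all add: algebra_simps)
  moreover have "bij_betw ((+) x) G G"
  proof (rule bij_betw_imageI)
    show "(+) x ` G = G"
    proof (intro Set.set_eqI iffI)
      fix y assume "y \<in> G"
      then have "y - x \<in> G" "y = x + (y - x)"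
        using assms by (simp_all add: add_subgroup_diff)
      then show "y \<in> (+) x ` G"
        by blast
    qed (use assms in \<open>auto simp: add_subgroup_add\<close>)
  qed auto
  then have "(\<Sum>y\<in>G. x + y) = \<Sum>G"
    by (rule sum.reindex_bij_betw)
  ultimately show ?thesis
    using assms(2) by simp
qed

section \<open>Building p-groups by extensions of index p\<close>

definition add_iso :: "('a::ab_group_add \<Rightarrow> 'b::ab_group_add) \<Rightarrow> 'a set \<Rightarrow> 'b set \<Rightarrow> bool" where
  "add_iso \<phi> U V \<longleftrightarrow> bij_betw \<phi> U V \<and> (\<forall>x\<in>U. \<forall>y\<in>U. \<phi> (x + y) = \<phi> x + \<phi> y)"

lemma add_iso_comp:
  "add_iso \<phi> U V \<Longrightarrow> add_iso \<psi> V W \<Longrightarrow> add_iso (\<psi> \<circ> \<phi>) U W"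
  by (auto simp: add_iso_def bij_betw_trans bij_betw_apply)

lemma add_iso_inv:
  assumes "add_iso \<phi> U V" "add_subgroup U"
  shows "add_iso (inv_into U \<phi>) V U"
proof -
  let ?g = "inv_into U \<phi>"
  have bij: "bij_betw \<phi> U V"
    using assms by (simp add: add_iso_def)
  have "?g (x + y) = ?g x + ?g y" if "x \<in> V" "y \<in> V" for x y
  proof -
    have "?g x \<in> U" "?g y \<in> U" "\<phi> (?g x) = x" "\<phi> (?g y) = y"
      using that bij by (auto simp: bij_betw_def inv_into_into f_inv_into_f)
    then have "\<phi> (?g x + ?g y) = x + y" "?g x + ?g y \<in> U"
      using assms by (simp_all add: add_iso_def add_subgroup_add)
    then show ?thesis
      using bij by (metis bij_betw_def inv_into_f_f)
  qed
  then show ?thesis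
    using bij_betw_inv_into[OF bij] by (simp add: add_iso_def)
qed

text \<open>An extension of \<open>H\<close> by a cyclic group of order \<open>p\<close>, with 0, g,
  ..., (p - 1) g as coset representatives. Up to isomorphism it is determined by \<open>H\<close>
  and the element p g of \<open>H\<close>.\<close>

definition extension :: "nat \<Rightarrow> 'a::ab_group_add set \<Rightarrow> 'a set \<Rightarrow> 'a \<Rightarrow> bool" where
  "extension p G H g \<longleftrightarrow> add_subgroup H \<and> nmul p g \<in> H \<and>
     bij_betw (\<lambda>(h, c). h + nmul c g) (H \<times> {..<p}) G"

text \<open>Adding h + c g and h' + c' g produces a carry p g into \<open>H\<close> when c + c'
  \<ge> p, and \<psi> preserves this carry.\<close>

lemma extension_iso:
  fixes g :: "'a::ab_group_add" and g' :: "'b::ab_group_add"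
  assumes E: "extension p G H g" and E': "extension p G' H' g'"
    and \<psi>: "add_iso \<psi> H H'" "\<psi> (nmul p g) = nmul p g'"
  shows "\<exists>\<Phi>. add_iso \<Phi> G G'"
proof -
  define \<beta> where "\<beta> = (\<lambda>(h, c). h + nmul c g)"
  define \<beta>' where "\<beta>' = (\<lambda>(h, c). h + nmul c g')"
  have \<beta>: "bij_betw \<beta> (H \<times> {..<p}) G" "bij_betw \<beta>' (H' \<times> {..<p}) G'"
    using E E' by (simp_all add: extension_def \<beta>_def \<beta>'_def)
  have H: "add_subgroup H" "nmul p g \<in> H"
    using E by (simp_all add: extension_def)
  define \<Phi> where "\<Phi> = \<beta>' \<circ> map_prod \<psi> id \<circ> inv_into (H \<times> {..<p}) \<beta>"
  have "bij_betw (map_prod \<psi> id) (H \<times> {..<p}) (H' \<times> {..<p})"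
    using \<psi>(1) by (intro bij_betw_map_prod) (auto simp: add_iso_def)
  then have bij: "bij_betw \<Phi> G G'"
    unfolding \<Phi>_def using \<beta> bij_betw_inv_into[OF \<beta>(1)] by (intro bij_betw_trans)
  have \<Phi>: "\<Phi> (h + nmul c g) = \<psi> h + nmul c g'" if "h \<in> H" "c < p" for h c
  proof -
    have "inv_into (H \<times> {..<p}) \<beta> (\<beta> (h, c)) = (h, c)"
      using \<beta>(1) that by (intro inv_into_f_f) (auto simp: bij_betw_def)
    then show ?thesis
      by (simp add: \<Phi>_def \<beta>_def \<beta>'_def)
  qed
  have "\<Phi> (x + y) = \<Phi> x + \<Phi> y" if xy: "x \<in> G" "y \<in> G" for x y
  proof -
    have "G = \<beta> ` (H \<times> {..<p})"
      using \<beta>(1) by (simp add: bij_betw_def)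
    then obtain h c h' c' where h: "h \<in> H" "c < p" "x = h + nmul c g" "h' \<in> H" "c' < p" "y = h' + nmul c' g"
      using xy by (auto simp: \<beta>_def)
    have sum: "h + h' \<in> H" "\<psi> (h + h') = \<psi> h + \<psi> h'"
      using h H \<psi>(1) by (simp_all add: add_subgroup_add add_iso_def)
    show ?thesis
    proof (cases "c + c' < p")
      case True
      have "x + y = (h + h') + nmul (c + c') g"
        by (simp add: h nmul_add)
      then have "\<Phi> (x + y) = \<psi> (h + h') + nmul (c + c') g'"
        using \<Phi> sum True by simp
      then show ?thesis
        using \<Phi> h sum by (simp add: nmul_add)
    next
      case False
      have "x + y = (h + h' + nmul p g) + nmul (c + c' - p) g"
        using False by (simp add: h nmul_diff nmul_add)
      moreover have "h + h' + nmul p g \<in> H" "\<psi> (h + h' + nmul p g) = \<psi> h + \<psi> h' + nmul p g'"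
        using sum H \<psi> by (simp_all add: add_subgroup_add add_iso_def)
      moreover have "c + c' - p < p"
        using h False by simp
      ultimately have "\<Phi> (x + y) = \<psi> h + \<psi> h' + nmul p g' + nmul (c + c' - p) g'"
        by (simp only: \<Phi>)
      then show ?thesis
        using \<Phi> h False by (simp add: nmul_diff nmul_add)
    qed
  qed
  then show ?thesis
    using bij by (auto simp: add_iso_def)
qed

text \<open>Let \<open>H\<close> be a proper subgroup of largest order and \<open>g\<close> a
  p-power multiple of an element outside \<open>H\<close>, stopped just before it enters
  \<open>H\<close>. Then H + {0, ..., p - 1} g is a subgroup larger than \<open>H\<close>, hence
  \<open>G\<close>. It has at most p |H| elements, so the index is exactly \<open>p\<close> and the
  representation is unique.\<close>

lemma ex_extension:
  fixes G :: "'a::ab_group_add set"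
  assumes "prime p" "add_subgroup G" "finite G" "card G = p ^ Suc n"
  shows "\<exists>H g. extension p G H g \<and> finite H \<and> card H = p ^ n"
proof -
  interpret prime_power_group p "Suc n" G
    using assms by unfold_locales
  define P where "P H \<longleftrightarrow> sub H \<and> H \<noteq> G" for H
  have "{0} \<noteq> G"
    using card_G p_gt_1 by (auto simp: card_insert_if)
  then have "P {0}"
    using sub_0 by (simp add: P_def)
  moreover have "\<forall>H. P H \<longrightarrow> card H < Suc (card G)"
    using card_mono[OF finite_G] by (simp add: P_def le_imp_less_Suc)
  ultimately obtain H where H: "P H" and max: "\<And>H'. P H' \<Longrightarrow> card H' \<le> card H"
    using ex_has_greatest_nat[of P "{0}" card "Suc (card G)"] by blast
  have sH: "sub H" "add_subgroup H"
    using H by (simp_all add: P_def)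
  obtain y where y: "y \<in> G" "y \<notin> H"
    using H by (auto simp: P_def)
  have "nmul (p ^ Suc n) y \<in> H"
    using nmul_card_eq_0[OF assms(2,3) y(1)] sH card_G by (simp add: add_subgroup_zero del: power_Suc)
  then obtain i where i: "nmul (p ^ i) y \<in> H" "\<And>j. j < i \<Longrightarrow> nmul (p ^ j) y \<notin> H"
    using exists_least_iff[of "\<lambda>i. nmul (p ^ i) y \<in> H"] by blast
  then obtain i' where i': "i = Suc i'"
    using y by (cases i) auto
  define g where "g = nmul (p ^ i') y"
  have g: "g \<in> G" "g \<notin> H" "nmul p g \<in> H"
    using i i' nmul_mem[OF assms(2) y(1)] by (auto simp: g_def simp flip: nmul_mult)
  define \<beta> where "\<beta> = (\<lambda>(h, c). h + nmul c g)"
  define X where "X = \<beta> ` (H \<times> {..<p})"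
  have X: "h + nmul c g \<in> X" if "h \<in> H" "c < p" for h c
    using that by (force simp: X_def \<beta>_def)
  have XG: "X \<subseteq> G"
    using sH g nmul_mem[OF assms(2) g(1)] by (auto simp: X_def \<beta>_def intro!: add_subgroup_add[OF assms(2)])
  have "add_subgroup X"
  proof (rule add_subgroupI)
    show "0 \<in> X"
      using X[of 0 0] add_subgroup_zero[OF sH(2)] p_gt_1 by simp
    fix u v assume "u \<in> X" "v \<in> X"
    then obtain h c h' c' where h: "h \<in> H" "c < p" "u = h + nmul c g" "h' \<in> H" "c' < p" "v = h' + nmul c' g"
      by (auto simp: X_def \<beta>_def)
    show "u - v \<in> X"
    proof (cases "c' \<le> c")
      case True
      have "u - v = (h - h') + nmul (c - c') g"
        using True by (simp add: h nmul_diff)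
      moreover have "(h - h') + nmul (c - c') g \<in> X"
        using h sH by (intro X add_subgroup_diff) auto
      ultimately show ?thesis
        by (simp only:)
    next
      case False
      \<comment> \<open>A borrow: \<open>p\<close> is added to the coefficient of \<open>g\<close>,
        and p g is subtracted inside \<open>H\<close>.\<close>
      have "u - v = (h - h' - nmul p g) + nmul (p + c - c') g"
        using False h by (simp add: nmul_diff nmul_add)
      moreover have "(h - h' - nmul p g) + nmul (p + c - c') g \<in> X"
        using h sH g False by (intro X add_subgroup_diff) auto
      ultimately show ?thesis
        by (simp only:)
    qed
  qed
  then have sX: "sub X"
    using XG by simp
  have "h \<in> X" if "h \<in> H" for h
    using X[OF that, of 0] p_gt_1 by simp
  moreover have "g \<in> X"
    using X[of 0 1] add_subgroup_zero[OF sH(2)] p_gt_1 by simp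
  ultimately have HX: "H \<subset> X"
    using g by blast
  then have "card H < card X"
    using finite_sub[OF XG] by (rule psubset_card_mono[rotated])
  then have XG: "X = G"
    using max[of X] sX unfolding P_def by linarith
  have "card X \<le> card (H \<times> {..<p})"
    unfolding X_def using finite_sub sH by (intro card_image_le) auto
  then have "p ^ Suc n \<le> p ^ Suc (dm H)"
    using card_sub[OF sH(1)] card_G XG by (simp add: card_cartesian_product mult.commute)
  then have "n \<le> dm H"
    using p_gt_1 by (simp del: power_Suc)
  moreover have "dm H < Suc n"
    using dm_strict[OF sH(1) sub_G] HX XG dm_G by simp
  ultimately have cH: "card H = p ^ n"
    using card_sub[OF sH(1)] by (simp add: le_antisym less_Suc_eq_le)
  have "inj_on \<beta> (H \<times> {..<p})"
    using XG X_def card_G cH finite_sub sH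
    by (intro eq_card_imp_inj_on) (auto simp: card_cartesian_product)
  then have "extension p G H g"
    using sH g XG by (simp add: extension_def bij_betw_def X_def \<beta>_def)
  then show ?thesis
    using cH finite_sub sH by blast
qed

text \<open>A group of order p^(n + 1) is determined by a representative of a subgroup of index
  \<open>p\<close> and by one of its p^n elements, the image of p g. This multiplies the bound by
  p^n, which stays below the growth from n^2 to (n + 1)^2 in the exponent.\<close>

lemma ex_group_representatives:
  fixes p n :: nat
  assumes p: "prime p"
  shows "\<exists>\<C> :: 'a set set. finite \<C> \<and> card \<C> \<le> p ^ (n * n) \<and>
    (\<forall>C\<in>\<C>. add_subgroup C \<and> finite C \<and> card C = p ^ n) \<and>
    (\<forall>G :: 'a set. add_subgroup G \<longrightarrow> finite G \<longrightarrow> card G = p ^ n \<longrightarrow>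
       (\<exists>C\<in>\<C>. \<exists>\<phi>. add_iso \<phi> (G :: 'a::ab_group_add set) C))"
proof (induction n)
  case 0
  have "\<exists>\<phi>. add_iso \<phi> G {0 :: 'a}" if "add_subgroup G" "card G = 1" for G :: "'a set"
  proof -
    have "G = {0}"
      using that add_subgroup_zero[of G] by (auto simp: card_1_singleton_iff)
    then show ?thesis
      by (auto simp: add_iso_def intro!: exI[of _ id])
  qed
  then show ?case
    by (intro exI[of _ "{{0}}"]) (auto simp: add_subgroup_singleton_0)
next
  case (Suc n)
  from Suc.IH obtain \<C> :: "'a set set" where *: "finite \<C> \<and> card \<C> \<le> p ^ (n * n) \<and>
    (\<forall>C\<in>\<C>. add_subgroup C \<and> finite C \<and> card C = p ^ n) \<and>
    (\<forall>G :: 'a set. add_subgroup G \<longrightarrow> finite G \<longrightarrow> card G = p ^ n \<longrightarrow>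
       (\<exists>C\<in>\<C>. \<exists>\<phi>. add_iso \<phi> G C))"
    by (elim exE)
  then have \<C>: "finite \<C>" "card \<C> \<le> p ^ (n * n)"
    "\<And>C. C \<in> \<C> \<Longrightarrow> add_subgroup C \<and> finite C \<and> card C = p ^ n"
    by simp_all
  have \<C>_ex: "\<exists>C\<in>\<C>. \<exists>\<phi>. add_iso \<phi> G C"
    if "add_subgroup G" "finite G" "card G = p ^ n" for G :: "'a set"
    using * that by metis
  define P where "P z G \<longleftrightarrow> add_subgroup G \<and> finite G \<and> card G = p ^ Suc n \<and>
    (\<exists>H g \<phi>. extension p G H g \<and> add_iso \<phi> H (fst z) \<and> \<phi> (nmul p g) = snd z)" for z :: "'a set \<times> 'a" and G :: "'a set"
  \<comment> \<open>Only pairs realised by a group inside the type \<open>'a\<close> are kept, since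
    the representatives have to live in that type.\<close>
  define I where "I = {z \<in> Sigma \<C> (\<lambda>C. C). \<exists>G. P z G}"
  define rep where "rep z = (SOME G. P z G)" for z
  have rep: "P z (rep z)" if "z \<in> I" for z
    using that someI_ex[of "P z"] by (auto simp: I_def rep_def)
  have Sig: "finite (Sigma \<C> (\<lambda>C. C))" "card (Sigma \<C> (\<lambda>C. C)) = card \<C> * p ^ n"
    using \<C>(1,3) by simp_all
  have "card (rep ` I) \<le> card \<C> * p ^ n"
    using Sig card_image_le[of I rep] card_mono[OF Sig(1), of I] finite_subset[OF _ Sig(1), of I]
    by (auto simp: I_def)
  also have "\<dots> \<le> p ^ (n * n) * p ^ n"
    using \<C>(2) by simp
  also have "\<dots> \<le> p ^ (Suc n * Suc n)"
    using prime_gt_1_nat[OF p] by (simp flip: power_add power_Suc add: power_increasing)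
  finally have card: "card (rep ` I) \<le> p ^ (Suc n * Suc n)" .
  have ex: "\<exists>C\<in>rep ` I. \<exists>\<phi>. add_iso \<phi> G C" if G: "add_subgroup G" "finite G" "card G = p ^ Suc n" for G :: "'a set"
  proof -
    obtain H g where H: "extension p G H g" "finite H" "card H = p ^ n"
      using ex_extension[OF p G] by blast
    have sH: "add_subgroup H" "nmul p g \<in> H"
      using H by (simp_all add: extension_def)
    obtain C \<phi> where C: "C \<in> \<C>" "add_iso \<phi> H C"
      using \<C>_ex[OF sH(1) H(2,3)] by blast
    define z where "z = (C, \<phi> (nmul p g))"
    have "\<phi> (nmul p g) \<in> C"
      using C(2) sH(2) by (auto simp: add_iso_def bij_betw_def)
    then have "z \<in> I"
      using G C H(1) by (auto simp: I_def z_def P_def)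
    from rep[OF this] obtain H' g' \<phi>' where H': "extension p (rep z) H' g'" "add_iso \<phi>' H' C"
      "\<phi>' (nmul p g') = \<phi> (nmul p g)"
      by (auto simp: P_def z_def)
    have sH': "add_subgroup H'" "nmul p g' \<in> H'"
      using H' by (simp_all add: extension_def)
    have "add_iso (inv_into H' \<phi>' \<circ> \<phi>) H H'"
      using add_iso_comp[OF C(2) add_iso_inv[OF H'(2) sH'(1)]] .
    moreover have "(inv_into H' \<phi>' \<circ> \<phi>) (nmul p g) = nmul p g'"
      using H'(2,3) sH'(2) by (simp add: add_iso_def bij_betw_def flip: H'(3))
    ultimately have "\<exists>\<Phi>. add_iso \<Phi> G (rep z)"
      using extension_iso[OF H(1) H'(1)] by blast
    then show ?thesis
      using \<open>z \<in> I\<close> by blast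
  qed
  show ?case
    using card ex rep finite_subset[OF _ Sig(1), of I]
    by (intro exI[of _ "rep ` I"]) (auto simp: P_def I_def)
qed

text \<open>
  The product of all abelian groups on sets of natural numbers: a single type in whose subgroups
  all finite abelian groups occur.
\<close>

typedef nat_groups = "{f :: nat monoid \<Rightarrow> nat.
    \<forall>K. if comm_group K then f K \<in> carrier K else f K = 0}"
  by (rule exI[of _ "\<lambda>K. if comm_group K then \<one>\<^bsub>K\<^esub> else 0"])
     (auto simp: comm_group_def group.is_monoid intro: monoid.one_closed)

lemma Rep_nat_groups_carrier: "comm_group K \<Longrightarrow> Rep_nat_groups f K \<in> carrier K"
  using Rep_nat_groups[of f] by (auto split: if_splits)

lemma Rep_nat_groups_outside: "\<not> comm_group K \<Longrightarrow> Rep_nat_groups f K = 0"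
  using Rep_nat_groups[of f] by (auto split: if_splits)

instantiation nat_groups :: ab_group_add
begin

definition zero_nat_groups where
  "0 = Abs_nat_groups (\<lambda>K. if comm_group K then \<one>\<^bsub>K\<^esub> else 0)"

definition plus_nat_groups where
  "f + g = Abs_nat_groups (\<lambda>K. if comm_group K then Rep_nat_groups f K \<otimes>\<^bsub>K\<^esub> Rep_nat_groups g K else 0)"

definition uminus_nat_groups where
  "- f = Abs_nat_groups (\<lambda>K. if comm_group K then inv\<^bsub>K\<^esub> Rep_nat_groups f K else 0)"

definition minus_nat_groups where
  "f - g = f + - (g :: nat_groups)"

lemma Rep_nat_groups_ops:
  "Rep_nat_groups 0 = (\<lambda>K. if comm_group K then \<one>\<^bsub>K\<^esub> else 0)"
  "Rep_nat_groups (f + g) = (\<lambda>K. if comm_group K then Rep_nat_groups f K \<otimes>\<^bsub>K\<^esub> Rep_nat_groups g K else 0)"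
  "Rep_nat_groups (- f) = (\<lambda>K. if comm_group K then inv\<^bsub>K\<^esub> Rep_nat_groups f K else 0)"
  unfolding zero_nat_groups_def plus_nat_groups_def uminus_nat_groups_def
  using Rep_nat_groups_carrier
  by (auto intro!: Abs_nat_groups_inverse simp: comm_group_def group.is_monoid monoid.one_closed
      monoid.m_closed group.inv_closed)

instance
proof
  fix a b c :: nat_groups
  show "(a + b) + c = a + (b + c)"
    by (auto simp: Rep_nat_groups_ops Rep_nat_groups_carrier simp flip: Rep_nat_groups_inject
        intro!: ext monoid.m_assoc comm_group.axioms(2)[THEN group.is_monoid])
  show "a + b = b + a"
    by (auto simp: Rep_nat_groups_ops Rep_nat_groups_carrier comm_group_def simp flip: Rep_nat_groups_inject
        intro!: ext comm_monoid.m_comm)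
  show "0 + a = a"
    by (auto simp: Rep_nat_groups_ops Rep_nat_groups_carrier Rep_nat_groups_outside comm_group_def
        group.is_monoid monoid.l_one simp flip: Rep_nat_groups_inject intro!: ext)
  show "- a + a = 0"
    by (auto simp: Rep_nat_groups_ops Rep_nat_groups_carrier comm_group_def group.l_inv
        simp flip: Rep_nat_groups_inject intro!: ext)
  show "a - b = a + - b"
    by (rule minus_nat_groups_def)
qed

end

lemma nat_groups_embedding:
  fixes K :: "nat monoid"
  assumes K: "comm_group K"
  obtains h :: "nat \<Rightarrow> nat_groups" where "inj_on h (carrier K)"
    "\<And>x y. x \<in> carrier K \<Longrightarrow> y \<in> carrier K \<Longrightarrow> h (x \<otimes>\<^bsub>K\<^esub> y) = h x + h y"
proof
  define F where "F x = (\<lambda>K'. if K' = K then x else if comm_group K' then \<one>\<^bsub>K'\<^esub> else 0)" for x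
  define h where "h x = Abs_nat_groups (F x)" for x
  have mon: "monoid L" if "comm_group L" for L :: "nat monoid"
    using that by (simp add: comm_group_def group.is_monoid)
  have Rep: "Rep_nat_groups (h x) = F x" if "x \<in> carrier K" for x
    unfolding h_def using that K mon
    by (intro Abs_nat_groups_inverse) (auto simp: F_def monoid.one_closed)
  show "inj_on h (carrier K)"
  proof (rule inj_onI)
    fix x y assume "x \<in> carrier K" "y \<in> carrier K" "h x = h y"
    then have "F x K = F y K"
      using Rep by metis
    then show "x = y"
      by (simp add: F_def)
  qed
  fix x y assume xy: "x \<in> carrier K" "y \<in> carrier K"
  then have "x \<otimes>\<^bsub>K\<^esub> y \<in> carrier K"
    using mon[OF K] by (simp add: monoid.m_closed)
  then show "h (x \<otimes>\<^bsub>K\<^esub> y) = h x + h y"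
    using xy K mon by (auto simp: Rep Rep_nat_groups_ops F_def monoid.l_one monoid.one_closed
        simp flip: Rep_nat_groups_inject intro!: ext)
qed

section \<open>Coding isomorphism classes of rings\<close>

lemma card_quotient_le_codes:
  assumes r: "equiv A r" and f: "f ` A \<subseteq> B" "finite B"
    and eq: "\<And>x y. x \<in> A \<Longrightarrow> y \<in> A \<Longrightarrow> f x = f y \<Longrightarrow> (x, y) \<in> r"
  shows "finite (A // r) \<and> card (A // r) \<le> card B"
proof -
  let ?g = "\<lambda>b. r `` {inv_into A f b}"
  have sub: "A // r \<subseteq> ?g ` B"
  proof
    fix X assume "X \<in> A // r"
    then obtain x where x: "x \<in> A" "X = r `` {x}"
      by (rule quotientE)
    then have "inv_into A f (f x) \<in> A" "f (inv_into A f (f x)) = f x"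
      by (auto intro: inv_into_into f_inv_into_f)
    then have "X = ?g (f x)"
      using equiv_class_eq[OF r eq] x by metis
    then show "X \<in> ?g ` B"
      using x f by blast
  qed
  then show ?thesis
    using f(2) card_mono[OF _ sub] card_image_le[OF f(2), of ?g] finite_subset[OF sub] by fastforce
qed

lemma ring_transport:
  fixes h :: "nat \<Rightarrow> 'a::ab_group_add"
  assumes R: "nonunital_ring R" "finite (carrier R)" and C: "add_subgroup C" "bij_betw h (carrier R) C"
    and h: "\<And>x y. x \<in> carrier R \<Longrightarrow> y \<in> carrier R \<Longrightarrow> h (x \<oplus>\<^bsub>R\<^esub> y) = h x + h y"
  shows "\<exists>m. ring_on C m \<and> (\<forall>x\<in>carrier R. \<forall>y\<in>carrier R. h (x \<otimes>\<^bsub>R\<^esub> y) = m (h x) (h y))"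
proof -
  interpret R: nonunital_ring R by fact
  define k where "k = inv_into (carrier R) h"
  define m where "m u v = (if u \<in> C \<and> v \<in> C then h (k u \<otimes>\<^bsub>R\<^esub> k v) else 0)" for u v
  have kh: "k (h x) = x" if "x \<in> carrier R" for x
    using that C by (simp add: k_def bij_betw_def)
  have hC: "h x \<in> C" if "x \<in> carrier R" for x
    using that C by (auto simp: bij_betw_def)
  have m: "m (h x) (h y) = h (x \<otimes>\<^bsub>R\<^esub> y)" if "x \<in> carrier R" "y \<in> carrier R" for x y
    using that by (simp add: m_def kh hC)
  have ex: "\<exists>x\<in>carrier R. u = h x" if "u \<in> C" for u
    using that C by (auto simp: bij_betw_def)
  have cancel: "(x \<ominus>\<^bsub>R\<^esub> y) \<oplus>\<^bsub>R\<^esub> y = x" if "x \<in> carrier R" "y \<in> carrier R" for x y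
    using that by (simp add: R.minus_eq R.a_assoc R.l_neg)
  have diff: "h x - h y = h (x \<ominus>\<^bsub>R\<^esub> y)" if "x \<in> carrier R" "y \<in> carrier R" for x y
    using h[of "x \<ominus>\<^bsub>R\<^esub> y" y] that by (simp add: cancel algebra_simps)
  have "ring_on C m"
  proof
    show "finite C"
      using R(2) C(2) bij_betw_finite by blast
    fix u v w assume u: "u \<in> C" and v: "v \<in> C" and w: "w \<in> C"
    then obtain x y z where x: "x \<in> carrier R" "u = h x" and y: "y \<in> carrier R" "v = h y"
      and z: "z \<in> carrier R" "w = h z"
      using ex by metis
    have "h ((x \<ominus>\<^bsub>R\<^esub> y) \<otimes>\<^bsub>R\<^esub> z) + h (y \<otimes>\<^bsub>R\<^esub> z) = h (x \<otimes>\<^bsub>R\<^esub> z)"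
      using x y z R.left_distrib[of "x \<ominus>\<^bsub>R\<^esub> y" y z] by (simp add: cancel R.mult_closed flip: h)
    then show "m (u - v) w = m u w - m v w"
      using x y z by (simp add: diff m algebra_simps)
    have "h (z \<otimes>\<^bsub>R\<^esub> (x \<ominus>\<^bsub>R\<^esub> y)) + h (z \<otimes>\<^bsub>R\<^esub> y) = h (z \<otimes>\<^bsub>R\<^esub> x)"
      using x y z R.right_distrib[of "x \<ominus>\<^bsub>R\<^esub> y" y z] by (simp add: cancel R.mult_closed flip: h)
    then show "m w (u - v) = m w u - m w v"
      using x y z by (simp add: diff m algebra_simps)
    show "m (m u v) w = m u (m v w)"
      using x y z by (simp add: m R.mult_closed R.mult_assoc)
  next
    fix u v assume "u \<in> C" "v \<in> C"
    then show "m u v \<in> C"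
      using ex hC m R.mult_closed by metis
  qed (auto simp: m_def C)
  then show ?thesis
    using m by auto
qed

text \<open>The code of a ring is a representative of its additive group with the multiplication
  carried over to it. Two rings with the same code are both isomorphic to the ring that it
  describes.\<close>

theorem num_rings_upper:
  assumes p: "prime p" and k: "1 \<le> k" "n \<le> k\<^sup>2" and c: "p ^ n < 2 ^ (2 ^ c)" "2 \<le> c"
  shows "finite (rings_of_card (p ^ n) // ring_iso_rel (p ^ n)) \<and>
    num_rings (p ^ n) \<le> p ^ (n * n + (15 * c * n\<^sup>2 + 13 * k * n\<^sup>2 + 4 * n ^ 3 div 27))"
proof -
  define N where "N = 15 * c * n\<^sup>2 + 13 * k * n\<^sup>2 + 4 * n ^ 3 div 27"
  obtain \<C> :: "nat_groups set set" where "finite \<C> \<and> card \<C> \<le> p ^ (n * n) \<and>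
    (\<forall>C\<in>\<C>. add_subgroup C \<and> finite C \<and> card C = p ^ n) \<and>
    (\<forall>G :: nat_groups set. add_subgroup G \<longrightarrow> finite G \<longrightarrow> card G = p ^ n \<longrightarrow>
       (\<exists>C\<in>\<C>. \<exists>\<phi>. add_iso \<phi> G C))"
    using ex_group_representatives[OF p, of n] by (elim exE)
  then have \<C>: "finite \<C>" "card \<C> \<le> p ^ (n * n)"
    "\<And>C. C \<in> \<C> \<Longrightarrow> add_subgroup C \<and> finite C \<and> card C = p ^ n"
    and \<C>_ex: "\<And>G :: nat_groups set. add_subgroup G \<Longrightarrow> finite G \<Longrightarrow> card G = p ^ n \<Longrightarrow>
       \<exists>C\<in>\<C>. \<exists>\<phi>. add_iso \<phi> G C"
    by simp_all
  define B where "B = Sigma \<C> (\<lambda>C. {m. ring_on C m})"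
  have rings: "finite {m. ring_on C m} \<and> card {m. ring_on C m} \<le> p ^ N" if "C \<in> \<C>" for C
  proof -
    interpret prime_power_group p n C
      using \<C>(3)[OF that] p by unfold_locales auto
    show ?thesis
      using card_ring_on[OF k c] by (simp add: N_def)
  qed
  have "card B = (\<Sum>C\<in>\<C>. card {m. ring_on C m})"
    unfolding B_def using \<C>(1) rings by (intro card_SigmaI) auto
  also have "\<dots> \<le> card \<C> * p ^ N"
    using sum_bounded_above[of \<C> "\<lambda>C. card {m. ring_on C m}" "p ^ N"] rings by simp
  also have "\<dots> \<le> p ^ (n * n) * p ^ N"
    using \<C>(2) by simp
  finally have B: "finite B" "card B \<le> p ^ (n * n + N)"
    using \<C>(1) rings by (auto simp: B_def power_add)
  define P where "P R z h \<longleftrightarrow> z \<in> B \<and> bij_betw h (carrier R) (fst z) \<and>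
    (\<forall>x\<in>carrier R. \<forall>y\<in>carrier R. h (x \<oplus>\<^bsub>R\<^esub> y) = h x + h y) \<and>
    (\<forall>x\<in>carrier R. \<forall>y\<in>carrier R. h (x \<otimes>\<^bsub>R\<^esub> y) = snd z (h x) (h y))"
    for R :: "nat ring" and z and h :: "nat \<Rightarrow> nat_groups"
  have "\<exists>z h. P R z h" if "R \<in> rings_of_card (p ^ n)" for R
  proof -
    have R: "nonunital_ring R" "finite (carrier R)" "card (carrier R) = p ^ n"
      using that by (simp_all add: rings_of_card_def)
    interpret R: nonunital_ring R by fact
    let ?K = "add_monoid R"
    obtain \<iota> :: "nat \<Rightarrow> nat_groups" where \<iota>0: "inj_on \<iota> (carrier ?K)"
      "\<And>x y. x \<in> carrier ?K \<Longrightarrow> y \<in> carrier ?K \<Longrightarrow> \<iota> (x \<otimes>\<^bsub>?K\<^esub> y) = \<iota> x + \<iota> y"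
      by (rule nat_groups_embedding[OF R.a_comm_group], rule that)
    have \<iota>: "inj_on \<iota> (carrier R)"
      "\<And>x y. x \<in> carrier R \<Longrightarrow> y \<in> carrier R \<Longrightarrow> \<iota> (x \<oplus>\<^bsub>R\<^esub> y) = \<iota> x + \<iota> y"
      using \<iota>0 by simp_all
    have "add_subgroup (\<iota> ` carrier R)"
    proof (rule add_subgroupI)
      have "\<iota> \<zero>\<^bsub>R\<^esub> = \<iota> \<zero>\<^bsub>R\<^esub> + \<iota> \<zero>\<^bsub>R\<^esub>"
        using \<iota>(2)[of "\<zero>\<^bsub>R\<^esub>" "\<zero>\<^bsub>R\<^esub>"] by simp
      then show "0 \<in> \<iota> ` carrier R"
        by (metis R.zero_closed add_cancel_right_right imageI)
      fix u v assume "u \<in> \<iota> ` carrier R" "v \<in> \<iota> ` carrier R"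
      then obtain x y where xy: "x \<in> carrier R" "y \<in> carrier R" "u = \<iota> x" "v = \<iota> y"
        by blast
      have "(x \<ominus>\<^bsub>R\<^esub> y) \<oplus>\<^bsub>R\<^esub> y = x"
        using xy by (simp add: R.minus_eq R.a_assoc R.l_neg)
      then have "u - v = \<iota> (x \<ominus>\<^bsub>R\<^esub> y)"
        using \<iota>(2)[of "x \<ominus>\<^bsub>R\<^esub> y" y] xy by (simp add: algebra_simps)
      then show "u - v \<in> \<iota> ` carrier R"
        using xy by simp
    qed
    then obtain C \<phi> where C: "C \<in> \<C>" "add_iso \<phi> (\<iota> ` carrier R) C"
      using \<C>_ex[of "\<iota> ` carrier R"] R card_image[OF \<iota>(1)] by auto
    have bij: "bij_betw (\<phi> \<circ> \<iota>) (carrier R) C"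
      using C(2) \<iota>(1) by (auto simp: add_iso_def intro: bij_betw_trans bij_betw_imageI)
    have add: "(\<phi> \<circ> \<iota>) (x \<oplus>\<^bsub>R\<^esub> y) = (\<phi> \<circ> \<iota>) x + (\<phi> \<circ> \<iota>) y" if "x \<in> carrier R" "y \<in> carrier R" for x y
      using that C(2) \<iota>(2) by (simp add: add_iso_def)
    obtain m where "ring_on C m"
      "\<forall>x\<in>carrier R. \<forall>y\<in>carrier R. (\<phi> \<circ> \<iota>) (x \<otimes>\<^bsub>R\<^esub> y) = m ((\<phi> \<circ> \<iota>) x) ((\<phi> \<circ> \<iota>) y)"
      using ring_transport[OF R(1,2) _ bij add] \<C>(3)[OF C(1)] by blast
    then have "P R (C, m) (\<phi> \<circ> \<iota>)"
      using C(1) bij add by (simp add: P_def B_def)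
    then show ?thesis
      by blast
  qed
  then obtain z h where P: "\<And>R. R \<in> rings_of_card (p ^ n) \<Longrightarrow> P R (z R) (h R)"
    by metis
  have "finite (rings_of_card (p ^ n) // ring_iso_rel (p ^ n)) \<and>
      card (rings_of_card (p ^ n) // ring_iso_rel (p ^ n)) \<le> card B"
  proof (rule card_quotient_le_codes[OF equiv_ring_iso_rel])
    show "z ` rings_of_card (p ^ n) \<subseteq> B"
      using P by (auto simp: P_def)
    fix R S assume RS: "R \<in> rings_of_card (p ^ n)" "S \<in> rings_of_card (p ^ n)" and eq: "z R = z S"
    interpret R: nonunital_ring R
      using RS by (simp add: rings_of_card_def)
    interpret S: nonunital_ring S
      using RS by (simp add: rings_of_card_def)
    define C where "C = fst (z R)"
    define m where "m = snd (z R)"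
    let ?f = "h R" and ?g = "h S" and ?k = "inv_into (carrier S) (h S)"
    have f: "bij_betw ?f (carrier R) C" "\<And>x y. x \<in> carrier R \<Longrightarrow> y \<in> carrier R \<Longrightarrow> ?f (x \<oplus>\<^bsub>R\<^esub> y) = ?f x + ?f y"
      "\<And>x y. x \<in> carrier R \<Longrightarrow> y \<in> carrier R \<Longrightarrow> ?f (x \<otimes>\<^bsub>R\<^esub> y) = m (?f x) (?f y)"
      using P[OF RS(1)] by (auto simp: P_def C_def m_def)
    have g: "bij_betw ?g (carrier S) C" "\<And>x y. x \<in> carrier S \<Longrightarrow> y \<in> carrier S \<Longrightarrow> ?g (x \<oplus>\<^bsub>S\<^esub> y) = ?g x + ?g y"
      "\<And>x y. x \<in> carrier S \<Longrightarrow> y \<in> carrier S \<Longrightarrow> ?g (x \<otimes>\<^bsub>S\<^esub> y) = m (?g x) (?g y)"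
      using P[OF RS(2)] eq by (auto simp: P_def C_def m_def)
    have k: "?k u \<in> carrier S" "?g (?k u) = u" if "u \<in> C" for u
      using that g(1) by (auto simp: bij_betw_def inv_into_into f_inv_into_f)
    have kg: "?k (?g x) = x" if "x \<in> carrier S" for x
      using that g(1) by (simp add: bij_betw_def)
    have fC: "?f x \<in> C" if "x \<in> carrier R" for x
      using that f(1) by (auto simp: bij_betw_def)
    have bij: "bij_betw (?k \<circ> ?f) (carrier R) (carrier S)"
      using bij_betw_trans[OF f(1) bij_betw_inv_into[OF g(1)]] .
    have "?k (?f x + ?f y) = ?k (?f x) \<oplus>\<^bsub>S\<^esub> ?k (?f y)"
      "?k (m (?f x) (?f y)) = ?k (?f x) \<otimes>\<^bsub>S\<^esub> ?k (?f y)" if "x \<in> carrier R" "y \<in> carrier R" for x y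
      using kg[of "?k (?f x) \<oplus>\<^bsub>S\<^esub> ?k (?f y)"] kg[of "?k (?f x) \<otimes>\<^bsub>S\<^esub> ?k (?f y)"]
        g(2,3)[of "?k (?f x)" "?k (?f y)"] k fC that S.mult_closed by auto
    then have "?k \<circ> ?f \<in> iso (add_monoid R) (add_monoid S)" "?k \<circ> ?f \<in> iso R S"
      using bij f k(1)[OF fC] by (auto simp: iso_def hom_def)
    then show "(R, S) \<in> ring_iso_rel (p ^ n)"
      using RS by (auto simp: ring_iso_rel_def nonunital_ring_isomorphic_def)
  qed (rule B)
  then show ?thesis
    using B(2) by (simp add: num_rings_def N_def)
qed

section \<open>Lower bound\<close>

definition digit_vectors :: "nat \<Rightarrow> nat \<Rightarrow> (nat \<Rightarrow> nat) set" where
  "digit_vectors p n = {..<n} \<rightarrow>\<^sub>E {..<p}"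

text \<open>The coordinates below \<open>r\<close> form V, the others W, and \<beta> holds the
  structure constants of a bilinear map from V \<times> V to W. Products depend only on the
  coordinates in V and have none there themselves, so all products of three elements vanish.\<close>

definition square_zero_ring ::
    "nat \<Rightarrow> nat \<Rightarrow> nat \<Rightarrow> (nat \<Rightarrow> nat \<Rightarrow> nat \<Rightarrow> nat) \<Rightarrow> (nat \<Rightarrow> nat) ring" where
  "square_zero_ring p n r \<beta> = \<lparr>carrier = digit_vectors p n,
     mult = (\<lambda>f g. \<lambda>k\<in>{..<n}. if k < r then 0 else (\<Sum>i<r. \<Sum>j<r. \<beta> i j k * f i * g j) mod p),
     one = undefined, zero = (\<lambda>k\<in>{..<n}. 0), add = (\<lambda>f g. \<lambda>k\<in>{..<n}. (f k + g k) mod p)\<rparr>"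

definition unit_digit :: "nat \<Rightarrow> nat \<Rightarrow> nat \<Rightarrow> nat" where
  "unit_digit n i = (\<lambda>k\<in>{..<n}. if k = i then 1 else 0)"

lemma card_digit_vectors: "finite (digit_vectors p n)" "card (digit_vectors p n) = p ^ n"
  by (simp_all add: digit_vectors_def finite_PiE card_PiE)

lemma digit_vectors_eqI:
  "f \<in> digit_vectors p n \<Longrightarrow> g \<in> digit_vectors p n \<Longrightarrow> (\<And>k. k < n \<Longrightarrow> f k = g k) \<Longrightarrow> f = g"
  unfolding digit_vectors_def by (rule PiE_ext) auto

lemma restrict_mem_digit_vectors: "p > 0 \<Longrightarrow> (\<And>k. k < n \<Longrightarrow> h k < p) \<Longrightarrow> (\<lambda>k\<in>{..<n}. h k) \<in> digit_vectors p n"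
  by (auto simp: digit_vectors_def)

lemma sum_mod_cong:
  fixes f g :: "'i \<Rightarrow> nat"
  assumes "\<And>i. i \<in> A \<Longrightarrow> f i mod p = g i mod p"
  shows "(\<Sum>i\<in>A. f i) mod p = (\<Sum>i\<in>A. g i) mod p"
proof -
  have "(\<Sum>i\<in>A. f i mod p) = (\<Sum>i\<in>A. g i mod p)"
    using assms by (rule sum.cong[OF refl])
  then show ?thesis
    by (metis mod_sum_eq)
qed

lemma nonunital_square_zero_ring:
  assumes p: "p > 1" and r: "r \<le> n"
  shows "nonunital_ring (square_zero_ring p n r \<beta>)" (is "nonunital_ring ?R")
proof -
  let ?V = "digit_vectors p n"
  have R: "carrier ?R = ?V"
    "f \<otimes>\<^bsub>?R\<^esub> g = (\<lambda>k\<in>{..<n}. if k < r then 0 else (\<Sum>i<r. \<Sum>j<r. \<beta> i j k * f i * g j) mod p)"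
    "\<zero>\<^bsub>?R\<^esub> = (\<lambda>k\<in>{..<n}. 0)"
    "f \<oplus>\<^bsub>?R\<^esub> g = (\<lambda>k\<in>{..<n}. (f k + g k) mod p)" for f g
    by (simp_all add: square_zero_ring_def)
  have lt: "f k < p" if "f \<in> ?V" "k < n" for f k
    using that by (auto simp: digit_vectors_def)
  have mem: "(\<lambda>k\<in>{..<n}. h k) \<in> ?V" if "\<And>k. k < n \<Longrightarrow> h k < p" for h
    using that p by (intro restrict_mem_digit_vectors) auto
  have "abelian_group ?R"
  proof (rule abelian_groupI, unfold R)
    fix x y z assume xyz: "x \<in> ?V" "y \<in> ?V" "z \<in> ?V"
    show "(\<lambda>k\<in>{..<n}. ((\<lambda>k\<in>{..<n}. (x k + y k) mod p) k + z k) mod p)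
        = (\<lambda>k\<in>{..<n}. (x k + (\<lambda>k\<in>{..<n}. (y k + z k) mod p) k) mod p)"
      by (auto simp: mod_simps add.assoc)
  next
    fix x assume x: "x \<in> ?V"
    show "(\<lambda>k\<in>{..<n}. ((\<lambda>k\<in>{..<n}. 0) k + x k) mod p) = x"
      using x lt p by (intro digit_vectors_eqI[of _ p n]) (auto intro!: mem)
    show "\<exists>y\<in>?V. (\<lambda>k\<in>{..<n}. (y k + x k) mod p) = (\<lambda>k\<in>{..<n}. 0)"
      using p lt[OF x] by (intro bexI[of _ "\<lambda>k\<in>{..<n}. (p - x k) mod p"])
        (auto intro!: mem simp: mod_simps less_imp_le)
  qed (use p in \<open>auto intro!: mem simp: add.commute\<close>)
  moreover have "nonunital_ring_axioms ?R"
  proof (rule nonunital_ring_axioms.intro, unfold R)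
    fix x y z assume xyz: "x \<in> ?V" "y \<in> ?V" "z \<in> ?V"
    let ?s = "\<lambda>f g k. \<Sum>i<r. \<Sum>j<r. \<beta> i j k * f i * g j"
    have "?s (\<lambda>k\<in>{..<n}. (x k + y k) mod p) z k mod p
        = (\<Sum>i<r. \<Sum>j<r. \<beta> i j k * (x i + y i) * z j) mod p" for k
    proof (intro sum_mod_cong)
      fix i j assume "i \<in> {..<r}" "j \<in> {..<r}"
      moreover have "\<beta> i j k * ((x i + y i) mod p) * z j mod p = \<beta> i j k * (x i + y i) * z j mod p"
        by (metis mod_mult_left_eq mod_mult_right_eq)
      ultimately show "\<beta> i j k * (\<lambda>k\<in>{..<n}. (x k + y k) mod p) i * z j mod p
          = \<beta> i j k * (x i + y i) * z j mod p"
        using r by simp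
    qed
    moreover have "(\<Sum>i<r. \<Sum>j<r. \<beta> i j k * (x i + y i) * z j) = ?s x z k + ?s y z k" for k
      by (simp add: algebra_simps sum.distrib)
    ultimately show "(\<lambda>k\<in>{..<n}. if k < r then 0 else ?s (\<lambda>k\<in>{..<n}. (x k + y k) mod p) z k mod p) =
       (\<lambda>k\<in>{..<n}. ((\<lambda>k\<in>{..<n}. if k < r then 0 else ?s x z k mod p) k +
         (\<lambda>k\<in>{..<n}. if k < r then 0 else ?s y z k mod p) k) mod p)"
      by (auto simp: mod_simps intro!: restrict_ext)
    have "?s z (\<lambda>k\<in>{..<n}. (x k + y k) mod p) k mod p
        = (\<Sum>i<r. \<Sum>j<r. \<beta> i j k * z i * (x j + y j)) mod p" for k
      using r by (intro sum_mod_cong) (simp add: mod_simps)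
    moreover have "(\<Sum>i<r. \<Sum>j<r. \<beta> i j k * z i * (x j + y j)) = ?s z x k + ?s z y k" for k
      by (simp add: algebra_simps sum.distrib)
    ultimately show "(\<lambda>k\<in>{..<n}. if k < r then 0 else ?s z (\<lambda>k\<in>{..<n}. (x k + y k) mod p) k mod p) =
       (\<lambda>k\<in>{..<n}. ((\<lambda>k\<in>{..<n}. if k < r then 0 else ?s z x k mod p) k +
         (\<lambda>k\<in>{..<n}. if k < r then 0 else ?s z y k mod p) k) mod p)"
      by (auto simp: mod_simps intro!: restrict_ext)
  qed (use p r in \<open>auto intro!: mem\<close>)
  ultimately show ?thesis
    by (rule nonunital_ring.intro)
qed

lemma unit_digit_mem: "p > 1 \<Longrightarrow> unit_digit n i \<in> digit_vectors p n"
  by (auto simp: unit_digit_def intro!: restrict_mem_digit_vectors)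

lemma mult_unit_digits:
  assumes "i < r" "j < r" "k < n" "\<not> k < r" "r \<le> n" "\<beta> i j k < p"
  shows "(unit_digit n i \<otimes>\<^bsub>square_zero_ring p n r \<beta>\<^esub> unit_digit n j) k = \<beta> i j k"
proof -
  have "(\<Sum>b<r. \<beta> a b k * unit_digit n i a * unit_digit n j b) = \<beta> a j k * unit_digit n i a" for a
  proof -
    have "(\<Sum>b<r. \<beta> a b k * unit_digit n i a * unit_digit n j b)
        = (\<Sum>b<r. if b = j then \<beta> a b k * unit_digit n i a else 0)"
      using assms by (intro sum.cong) (auto simp: unit_digit_def)
    then show ?thesis
      using assms by simp
  qed
  moreover have "(\<Sum>a<r. \<beta> a j k * unit_digit n i a) = (\<Sum>a<r. if a = i then \<beta> a j k else 0)"
    using assms by (intro sum.cong) (auto simp: unit_digit_def)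
  ultimately have "(\<Sum>a<r. \<Sum>b<r. \<beta> a b k * unit_digit n i a * unit_digit n j b) = \<beta> i j k"
    using assms by simp
  then show ?thesis
    using assms by (simp add: square_zero_ring_def)
qed

text \<open>Lowering a positive digit by one decreases the sum of the digits. The rule serves to
  show that an additive map is determined by the images of the unit digits.\<close>

lemma digit_vectors_induct [consumes 2, case_names zero add]:
  assumes "f \<in> digit_vectors p n" "p > 1"
    and zero: "P (\<lambda>k\<in>{..<n}. 0)"
    and add: "\<And>g i. g \<in> digit_vectors p n \<Longrightarrow> i < n \<Longrightarrow> P g \<Longrightarrow>
      P (\<lambda>k\<in>{..<n}. (g k + unit_digit n i k) mod p)"
  shows "P f"
  using assms(1)
proof (induction "\<Sum>k<n. f k" arbitrary: f rule: less_induct)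
  case less
  note f = less.prems
  show ?case
  proof (cases "\<exists>i<n. f i > 0")
    case False
    then have "f = (\<lambda>k\<in>{..<n}. 0)"
      using f assms(2) by (intro digit_vectors_eqI[of _ p n] restrict_mem_digit_vectors) auto
    then show ?thesis
      using zero by simp
  next
    case True
    then obtain i where i: "i < n" "f i > 0" by blast
    define g where "g = (\<lambda>k\<in>{..<n}. if k = i then f i - 1 else f k)"
    have lt: "f k < p" if "k < n" for k
      using f that by (auto simp: digit_vectors_def)
    have g: "g \<in> digit_vectors p n"
      using lt i assms(2) by (auto simp: g_def less_imp_diff_less intro!: restrict_mem_digit_vectors)
    have "(\<Sum>k<n. g k) < (\<Sum>k<n. f k)"
      using i by (intro sum_strict_mono_ex1) (auto simp: g_def)
    then have "P g"
      using less.hyps g by blast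
    moreover have "(\<lambda>k\<in>{..<n}. (g k + unit_digit n i k) mod p) = f"
      using f lt i assms(2)
      by (intro digit_vectors_eqI[of _ p n] restrict_mem_digit_vectors) (auto simp: g_def unit_digit_def)
    ultimately show ?thesis
      using add[OF g i(1)] by simp
  qed
qed

lemma nonunital_ring_isomorphicE:
  assumes "nonunital_ring_isomorphic R S"
  obtains h where "bij_betw h (carrier R) (carrier S)"
    "\<And>x y. x \<in> carrier R \<Longrightarrow> y \<in> carrier R \<Longrightarrow> h (x \<oplus>\<^bsub>R\<^esub> y) = h x \<oplus>\<^bsub>S\<^esub> h y"
    "\<And>x y. x \<in> carrier R \<Longrightarrow> y \<in> carrier R \<Longrightarrow> h (x \<otimes>\<^bsub>R\<^esub> y) = h x \<otimes>\<^bsub>S\<^esub> h y"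
proof -
  obtain h where "h \<in> iso (add_monoid R) (add_monoid S)" "h \<in> iso R S"
    using assms by (auto simp: nonunital_ring_isomorphic_def)
  then show ?thesis
    by (intro that[of h]) (auto simp: iso_def hom_def)
qed

text \<open>Fix a ring \<open>T\<close> in a class. An isomorphism from the ring of \<beta> to
  \<open>T\<close> is determined by the images of the \<open>n\<close> unit digits, for which there
  are p^(n n) choices. These images determine \<beta> in turn: \<beta> i j is read off the preimage
  of the product of the images of two unit digits. So at most p^(n n) of the \<beta> fall into one
  class.\<close>

theorem num_rings_lower:
  assumes p: "p > 1" and r: "r \<le> n"
    and fin: "finite (rings_of_card (p ^ n) // ring_iso_rel (p ^ n))"
  shows "p ^ (r * r * (n - r)) \<le> num_rings (p ^ n) * p ^ (n * n)"
proof -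
  let ?A = "rings_of_card (p ^ n)" and ?r = "ring_iso_rel (p ^ n)" and ?V = "digit_vectors p n"
  define R where "R = square_zero_ring p n r"
  define \<B> where "\<B> = {..<r} \<rightarrow>\<^sub>E ({..<r} \<rightarrow>\<^sub>E ({r..<n} \<rightarrow>\<^sub>E {..<p}))"
  have \<B>: "card \<B> = p ^ (r * r * (n - r))"
    by (simp add: \<B>_def card_PiE power_mult[symmetric] ac_simps)
  have \<B>1: "\<beta> i \<in> {..<r} \<rightarrow>\<^sub>E ({r..<n} \<rightarrow>\<^sub>E {..<p})" if "\<beta> \<in> \<B>" "i < r" for \<beta> i
    using that(2) PiE_mem[OF that(1)[unfolded \<B>_def], of i] by simp
  have \<B>2: "\<beta> i j \<in> {r..<n} \<rightarrow>\<^sub>E {..<p}" if "\<beta> \<in> \<B>" "i < r" "j < r" for \<beta> i j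
    using that(3) PiE_mem[OF \<B>1[OF that(1,2)], of j] by simp
  have \<B>3: "\<beta> i j k < p" if "\<beta> \<in> \<B>" "i < r" "j < r" "k < n" "\<not> k < r" for \<beta> i j k
    using that(4,5) PiE_mem[OF \<B>2[OF that(1-3)], of k] by simp
  have R: "carrier (R \<beta>) = ?V" "\<zero>\<^bsub>R \<beta>\<^esub> = (\<lambda>k\<in>{..<n}. 0)"
    "f \<oplus>\<^bsub>R \<beta>\<^esub> g = (\<lambda>k\<in>{..<n}. (f k + g k) mod p)" for \<beta> f g
    by (simp_all add: R_def square_zero_ring_def)
  have nonunital: "nonunital_ring (R \<beta>)" for \<beta>
    using nonunital_square_zero_ring[OF p r] by (simp add: R_def)
  have "\<exists>S\<in>?A. nonunital_ring_isomorphic (R \<beta>) S" for \<beta>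
    using ex_rings_of_card_isomorphic[OF nonunital, of \<beta>] by (simp add: R card_digit_vectors)
  then obtain S where S: "\<And>\<beta>. S \<beta> \<in> ?A" "\<And>\<beta>. nonunital_ring_isomorphic (R \<beta>) (S \<beta>)"
    by metis
  define F where "F \<beta> = ?r `` {S \<beta>}" for \<beta>
  have FQ: "F ` \<B> \<subseteq> ?A // ?r"
    using S(1) by (auto simp: F_def intro: quotientI)
  have fibre: "finite {\<beta>\<in>\<B>. F \<beta> = X} \<and> card {\<beta>\<in>\<B>. F \<beta> = X} \<le> p ^ (n * n)" if X: "X \<in> ?A // ?r" for X
  proof -
    obtain T where T: "T \<in> ?A" "X = ?r `` {T}"
      using X by (rule quotientE)
    interpret T: nonunital_ring T
      using T by (simp add: rings_of_card_def)
    define P where "P \<beta> h \<longleftrightarrow> bij_betw h ?V (carrier T) \<and>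
      (\<forall>x\<in>?V. \<forall>y\<in>?V. h (x \<oplus>\<^bsub>R \<beta>\<^esub> y) = h x \<oplus>\<^bsub>T\<^esub> h y) \<and>
      (\<forall>x\<in>?V. \<forall>y\<in>?V. h (x \<otimes>\<^bsub>R \<beta>\<^esub> y) = h x \<otimes>\<^bsub>T\<^esub> h y)" for \<beta> h
    have "\<exists>h. P \<beta> h" if \<beta>: "F \<beta> = X" for \<beta>
    proof -
      have "(S \<beta>, T) \<in> ?r"
        using \<beta> T S(1) eq_equiv_class[OF _ equiv_ring_iso_rel] by (metis F_def)
      then have "nonunital_ring_isomorphic (S \<beta>) T"
        by (simp add: ring_iso_rel_def)
      then obtain g where g: "bij_betw g (carrier (S \<beta>)) (carrier T)"
        "\<And>x y. x \<in> carrier (S \<beta>) \<Longrightarrow> y \<in> carrier (S \<beta>) \<Longrightarrow> g (x \<oplus>\<^bsub>S \<beta>\<^esub> y) = g x \<oplus>\<^bsub>T\<^esub> g y"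
        "\<And>x y. x \<in> carrier (S \<beta>) \<Longrightarrow> y \<in> carrier (S \<beta>) \<Longrightarrow> g (x \<otimes>\<^bsub>S \<beta>\<^esub> y) = g x \<otimes>\<^bsub>T\<^esub> g y"
        using nonunital_ring_isomorphicE by blast
      obtain f where f: "bij_betw f (carrier (R \<beta>)) (carrier (S \<beta>))"
        "\<And>x y. x \<in> carrier (R \<beta>) \<Longrightarrow> y \<in> carrier (R \<beta>) \<Longrightarrow> f (x \<oplus>\<^bsub>R \<beta>\<^esub> y) = f x \<oplus>\<^bsub>S \<beta>\<^esub> f y"
        "\<And>x y. x \<in> carrier (R \<beta>) \<Longrightarrow> y \<in> carrier (R \<beta>) \<Longrightarrow> f (x \<otimes>\<^bsub>R \<beta>\<^esub> y) = f x \<otimes>\<^bsub>S \<beta>\<^esub> f y"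
        using nonunital_ring_isomorphicE[OF S(2)[of \<beta>]] by blast
      have fS: "f x \<in> carrier (S \<beta>)" if "x \<in> ?V" for x
        using that f(1) by (auto simp: bij_betw_def R(1))
      have "P \<beta> (g \<circ> f)"
        using bij_betw_trans[OF f(1) g(1)] f(2,3) g(2,3) fS by (simp add: P_def R(1))
      then show ?thesis
        by blast
    qed
    then obtain h where h: "\<And>\<beta>. F \<beta> = X \<Longrightarrow> P \<beta> (h \<beta>)"
      by metis
    define E where "E \<beta> = (\<lambda>i\<in>{..<n}. h \<beta> (unit_digit n i))" for \<beta>
    have T_card: "finite (carrier T)" "card (carrier T) = p ^ n"
      using T by (simp_all add: rings_of_card_def)
    have inj: "inj_on E {\<beta>\<in>\<B>. F \<beta> = X}"
    proof (rule inj_onI)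
      fix \<beta> \<beta>' assume "\<beta> \<in> {\<beta>\<in>\<B>. F \<beta> = X}" "\<beta>' \<in> {\<beta>\<in>\<B>. F \<beta> = X}" and eq: "E \<beta> = E \<beta>'"
      then have \<beta>: "\<beta> \<in> \<B>" "\<beta>' \<in> \<B>" "P \<beta> (h \<beta>)" "P \<beta>' (h \<beta>')"
        using h by auto
      have unit: "h \<beta> (unit_digit n i) = h \<beta>' (unit_digit n i)" if "i < n" for i
        using fun_cong[OF eq, of i] that by (simp add: E_def)
      let ?z = "(\<lambda>k\<in>{..<n}. 0) :: nat \<Rightarrow> nat"
      have zV: "?z \<in> ?V"
        using p by (intro restrict_mem_digit_vectors) auto
      have h_zero: "h \<gamma> ?z = \<zero>\<^bsub>T\<^esub>" if "P \<gamma> (h \<gamma>)" for \<gamma>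
      proof -
        have hz: "h \<gamma> ?z \<in> carrier T"
          using that zV by (auto simp: P_def bij_betw_def)
        have "?z \<oplus>\<^bsub>R \<gamma>\<^esub> ?z = ?z"
          by (auto simp: R)
        then have "h \<gamma> ?z \<oplus>\<^bsub>T\<^esub> h \<gamma> ?z = h \<gamma> ?z"
          using that zV unfolding P_def by metis
        then show ?thesis
          using hz T.add.l_cancel_one by blast
      qed
      have hh: "h \<beta> f = h \<beta>' f" if "f \<in> ?V" for f
        using that p
      proof (induction rule: digit_vectors_induct)
        case zero
        then show ?case
          using h_zero[OF \<beta>(3)] h_zero[OF \<beta>(4)] by (simp only:)
      next
        case (add g i)
        have h_add: "h \<gamma> (\<lambda>k\<in>{..<n}. (g k + unit_digit n i k) mod p) = h \<gamma> g \<oplus>\<^bsub>T\<^esub> h \<gamma> (unit_digit n i)"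
          if "P \<gamma> (h \<gamma>)" for \<gamma>
          using that add unit_digit_mem[OF p] unfolding P_def R(3) by blast
        show ?case
          unfolding h_add[OF \<beta>(3)] h_add[OF \<beta>(4)] using unit add by simp
      qed
      show "\<beta> = \<beta>'"
      proof -
        have *: "\<beta> i j k = \<beta>' i j k" if ijk: "i < r" "j < r" "k < n" "\<not> k < r" for i j k
        proof -
          let ?e = "unit_digit n i" and ?e' = "unit_digit n j"
          have V: "?e \<in> ?V" "?e' \<in> ?V"
            using unit_digit_mem[OF p] by blast+
          have mV: "?e \<otimes>\<^bsub>R \<gamma>\<^esub> ?e' \<in> ?V" for \<gamma>
            using nonunital_ring.mult_closed[OF nonunital, of ?e \<gamma> ?e'] V by (simp add: R)
          have "h \<beta> (?e \<otimes>\<^bsub>R \<beta>\<^esub> ?e') = h \<beta>' (?e \<otimes>\<^bsub>R \<beta>'\<^esub> ?e')"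
            using \<beta>(3,4) V hh unfolding P_def by metis
          also have "\<dots> = h \<beta> (?e \<otimes>\<^bsub>R \<beta>'\<^esub> ?e')"
            using hh mV by simp
          finally have "?e \<otimes>\<^bsub>R \<beta>\<^esub> ?e' = ?e \<otimes>\<^bsub>R \<beta>'\<^esub> ?e'"
            using \<beta>(3) mV by (auto simp: P_def bij_betw_def dest: inj_onD)
          moreover have "\<beta> i j k < p" "\<beta>' i j k < p"
            using \<B>3 \<beta>(1,2) ijk by blast+
          ultimately show ?thesis
            using mult_unit_digits[of i r j k n \<beta> p] mult_unit_digits[of i r j k n \<beta>' p] ijk r
            by (simp add: R_def)
        qed
        show ?thesis
          using \<beta>(1,2) unfolding \<B>_def
        proof (rule PiE_ext)
          fix i assume i: "i \<in> {..<r}"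
          then have "\<beta> i \<in> {..<r} \<rightarrow>\<^sub>E ({r..<n} \<rightarrow>\<^sub>E {..<p})" "\<beta>' i \<in> {..<r} \<rightarrow>\<^sub>E ({r..<n} \<rightarrow>\<^sub>E {..<p})"
            using \<B>1 \<beta>(1,2) by auto
          then show "\<beta> i = \<beta>' i"
          proof (rule PiE_ext)
            fix j assume j: "j \<in> {..<r}"
            then have "\<beta> i j \<in> {r..<n} \<rightarrow>\<^sub>E {..<p}" "\<beta>' i j \<in> {r..<n} \<rightarrow>\<^sub>E {..<p}"
              using \<B>2 \<beta>(1,2) i by auto
            then show "\<beta> i j = \<beta>' i j"
              by (rule PiE_ext) (use * i j in auto)
          qed
        qed
      qed
    qed
    have img: "E ` {\<beta>\<in>\<B>. F \<beta> = X} \<subseteq> {..<n} \<rightarrow>\<^sub>E carrier T"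
      unfolding E_def
    proof (intro image_subsetI restrict_PiE_iff[THEN iffD2] ballI)
      fix \<beta> i assume "\<beta> \<in> {\<beta>\<in>\<B>. F \<beta> = X}"
      then have "bij_betw (h \<beta>) ?V (carrier T)"
        using h by (simp add: P_def)
      then show "h \<beta> (unit_digit n i) \<in> carrier T"
        using unit_digit_mem[OF p] by (rule bij_betw_apply)
    qed
    have *: "finite ({..<n} \<rightarrow>\<^sub>E carrier T)" "card ({..<n} \<rightarrow>\<^sub>E carrier T) = p ^ (n * n)"
      using T_card by (simp_all add: finite_PiE card_PiE power_mult)
    show ?thesis
      using inj_on_finite[OF inj img *(1)] card_inj_on_le[OF inj img *(1)] *(2) by simp
  qed
  have "card \<B> \<le> card (?A // ?r) * p ^ (n * n)"
    using card_le_fibers[OF fin FQ fibre] by simp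
  then show ?thesis
    by (simp add: \<B> num_rings_def)
qed

section \<open>The asymptotic formula\<close>

text \<open>For e = 2 n mod 3 and r = (2 n - e)/3 one has r^2 (n - r) = (4 n^3 - 3 n e^2 + e^3)/27.
  There is no term in n^2 e because 2 n/3 is a critical point of r^2 (n - r), so rounding costs only
  O(n).\<close>

lemma cubic_lower: "4 / 27 * real n ^ 3 - 2 * real n ^ 2 \<le>
    real ((2 * n div 3) * (2 * n div 3) * (n - 2 * n div 3)) - real (n * n)"
proof -
  define r where "r = 2 * n div 3"
  define e where "e = 2 * n mod 3"
  have "2 * n = 3 * r + e"
    by (simp add: r_def e_def)
  then have "2 * real n = 3 * real r + real e"
    by (metis of_nat_add of_nat_mult of_nat_numeral)
  then have rn: "real r = (2 * real n - real e) / 3"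
    by simp
  have "e < 3"
    by (simp add: e_def)
  then have e: "0 \<le> real e" "real e ^ 2 \<le> 4"
    using power_mono[of "real e" 2 2] by auto
  have "r \<le> n"
    by (simp add: r_def)
  then have "real (r * r * (n - r)) = real r * real r * (real n - real r)"
    by (simp add: of_nat_diff)
  also have "\<dots> = (4 * real n ^ 3 - 3 * real n * real e ^ 2 + real e ^ 3) / 27"
    unfolding rn by (simp add: power2_eq_square power3_eq_cube field_simps)
  also have "\<dots> \<ge> (4 * real n ^ 3 - 12 * real n) / 27"
  proof -
    have "3 * real n * real e ^ 2 \<le> 12 * real n"
      using mult_left_mono[OF e(2), of "3 * real n"] by simp
    then have "4 * real n ^ 3 - 12 * real n \<le> 4 * real n ^ 3 - 3 * real n * real e ^ 2"
      by (rule diff_left_mono)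
    also have "\<dots> \<le> 4 * real n ^ 3 - 3 * real n * real e ^ 2 + real e ^ 3"
      by simp
    finally show ?thesis
      by (rule divide_right_mono) simp
  qed
  finally have *: "(4 * real n ^ 3 - 12 * real n) / 27 \<le> real (r * r * (n - r))" .
  have "real n \<le> real n ^ 2"
    by (cases n) (auto simp: power2_eq_square)
  moreover have "0 \<le> real n ^ 2"
    by simp
  moreover have "(4 * real n ^ 3 - 12 * real n) / 27 = 4 / 27 * real n ^ 3 - 12 / 27 * real n"
    by (simp add: diff_divide_distrib)
  ultimately have "4 / 27 * real n ^ 3 - 2 * real n ^ 2 \<le> (4 * real n ^ 3 - 12 * real n) / 27 - real n ^ 2"
    by linarith
  also have "\<dots> \<le> real (r * r * (n - r)) - real (n * n)"
    using * by (simp add: power2_eq_square)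
  finally show ?thesis
    by (simp only: r_def)
qed

lemma num_rings_log_bounds:
  assumes p: "prime p" and n: "1 \<le> n"
  shows "num_rings (p ^ n) > 0"
    and "\<bar>log p (num_rings (p ^ n)) - 4 / 27 * real n ^ 3\<bar> \<le> 2 * (44 + 15 * real p) * real n powr (5 / 2)"
proof -
  define k where "k = nat \<lceil>sqrt n\<rceil>"
  \<comment> \<open>Chosen so that p n \<le> p k^2 < 2^p 2^k 2^k = 2^c, and therefore p^n \<le> 2^(p
    n) < 2^(2^c). A value of order log n would do, but any \<open>c\<close> of order \<surd>n fits
    the error term.\<close>
  define c where "c = 2 * k + p"
  have p1: "p > 1"
    using p prime_gt_1_nat by blast
  have s: "sqrt n \<ge> 1"
    using n by simp
  have k_ge: "sqrt n \<le> real k"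
    unfolding k_def by linarith
  have k_le: "real k \<le> 2 * sqrt n"
    using s unfolding k_def by linarith
  have k: "1 \<le> k" "n \<le> k\<^sup>2"
  proof -
    show "1 \<le> k"
      using s k_ge by linarith
    have "real n \<le> real k ^ 2"
      using k_ge by (metis of_nat_0_le_iff power_mono real_sqrt_ge_0_iff real_sqrt_pow2)
    then show "n \<le> k\<^sup>2"
      by (simp flip: of_nat_power)
  qed
  have c: "p ^ n < 2 ^ (2 ^ c)" "2 \<le> c"
  proof -
    have "p ^ n \<le> (2 ^ p) ^ n"
      by (intro power_mono less_imp_le[OF less_exp]) simp
    also have "\<dots> = 2 ^ (p * n)"
      by (simp add: power_mult)
    also have "\<dots> < 2 ^ (2 ^ c)"
    proof (rule power_strict_increasing)
      have "p * n \<le> p * (k * k)"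
        using k(2) by (simp add: power2_eq_square)
      also have "\<dots> < 2 ^ p * (2 ^ k * 2 ^ k)"
        using k(1) p1 by (intro mult_strict_mono less_exp) auto
      also have "\<dots> = 2 ^ c"
        by (simp add: c_def power_add mult_2)
      finally show "p * n < 2 ^ c" .
    qed simp
    finally show "p ^ n < 2 ^ (2 ^ c)" .
    show "2 \<le> c"
      using p1 by (simp add: c_def)
  qed
  define N where "N = num_rings (p ^ n)"
  note upper = num_rings_upper[OF p k c]
  have lower: "p ^ (r * r * (n - r)) \<le> N * p ^ (n * n)" if "r \<le> n" for r
    using num_rings_lower[OF p1 that] upper by (simp add: N_def)
  \<comment> \<open>The case r = 0 of \<open>lower\<close> reads 1 \<le> N p^(n n).\<close>
  have N: "N > 0"
    using lower[of 0] by (cases N) auto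
  then show "num_rings (p ^ n) > 0"
    by (simp add: N_def)
  have sq: "real n powr (5 / 2) = real n ^ 2 * sqrt n"
  proof -
    have "real n powr (5 / 2) = real n powr (2 + 1 / 2)"
      by simp
    also have "\<dots> = real n ^ 2 * sqrt n"
      using n by (simp only: powr_add) (simp add: powr_half_sqrt powr_realpow[of "real n" 2])
    finally show ?thesis .
  qed
  have n2: "real n ^ 2 \<le> real n ^ 2 * sqrt n"
    using s by simp
  have kn2: "real k * real n ^ 2 \<le> 2 * (real n ^ 2 * sqrt n)"
    using mult_right_mono[OF k_le, of "real n ^ 2"] by (simp add: ac_simps)
  have log_N: "log p (real N) \<le> real M" if "N \<le> p ^ M" for M
  proof -
    have "real N \<le> real p ^ M"
      using that by (metis of_nat_le_iff of_nat_power)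
    then show ?thesis
      using N p1 by (intro log_of_power_le) simp_all
  qed
  have "log p N \<le> real (n * n + (15 * c * n\<^sup>2 + 13 * k * n\<^sup>2 + 4 * n ^ 3 div 27))"
    using upper by (intro log_N) (simp add: N_def)
  also have "\<dots> \<le> real n ^ 2 + 15 * real c * real n ^ 2 + 13 * real k * real n ^ 2 + 4 / 27 * real n ^ 3"
  proof -
    have "real (4 * n ^ 3 div 27) \<le> 4 / 27 * real n ^ 3"
      using of_nat_div_le_of_nat[of "4 * n ^ 3" 27, where ?'a = real] by simp
    then show ?thesis
      by (simp add: power2_eq_square)
  qed
  \<comment> \<open>As c = 2 k + p, the coefficient 44 is 1 + 30 + 13; the terms n^2 and 15 p n^2
    are absorbed by means of k \<ge> 1.\<close>
  also have "\<dots> \<le> 4 / 27 * real n ^ 3 + (44 + 15 * real p) * (real k * real n ^ 2)"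
  proof -
    have "real n ^ 2 \<le> real k * real n ^ 2" "real p * real n ^ 2 \<le> real p * (real k * real n ^ 2)"
      using k(1) by (simp_all add: mult_le_cancel_right1 mult_left_mono)
    then show ?thesis
      by (simp add: c_def algebra_simps)
  qed
  also have "\<dots> \<le> 4 / 27 * real n ^ 3 + (44 + 15 * real p) * (2 * (real n ^ 2 * sqrt n))"
    using kn2 by (intro add_left_mono mult_left_mono) auto
  finally have up: "log p N - 4 / 27 * real n ^ 3 \<le> 2 * (44 + 15 * real p) * real n powr (5 / 2)"
    by (simp add: sq algebra_simps)
  define r where "r = 2 * n div 3"
  have "real p ^ (r * r * (n - r)) \<le> real N * real p ^ (n * n)"
    using lower[of r] by (simp add: r_def flip: of_nat_power of_nat_mult)
  then have "real (r * r * (n - r)) \<le> log p (real N * real p ^ (n * n))"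
    using p1 by (intro le_log_of_power) simp_all
  then have "real (r * r * (n - r)) \<le> log p N + real (n * n)"
    using N p1 by (simp add: log_mult log_nat_power)
  then have "4 / 27 * real n ^ 3 - log p N \<le> 2 * real n ^ 2"
    using cubic_lower[of n] unfolding r_def by linarith
  also have "\<dots> \<le> 2 * (44 + 15 * real p) * (real n ^ 2 * sqrt n)"
    using n2 by (intro mult_mono) auto
  finally show "\<bar>log p (num_rings (p ^ n)) - 4 / 27 * real n ^ 3\<bar>
      \<le> 2 * (44 + 15 * real p) * real n powr (5 / 2)"
    using up by (simp add: sq N_def abs_le_iff)
qed

theorem theorem3p6:
  fixes p :: nat
  assumes "prime p"
  shows "\<exists>\<delta> :: nat \<Rightarrow> real.
      (\<forall>n\<ge>1. real (num_rings (p ^ n)) = real p powr \<delta> n) \<and>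
      (\<exists>C :: real. \<forall>n\<ge>1. \<bar>\<delta> n - 4 / 27 * real n ^ 3\<bar> \<le> C * real n powr (5 / 2))"
proof (intro exI conjI allI impI)
  fix n :: nat assume n: "1 \<le> n"
  show "real (num_rings (p ^ n)) = real p powr log p (num_rings (p ^ n))"
    using num_rings_log_bounds(1)[OF assms n] prime_gt_1_nat[OF assms] by simp
  show "\<bar>log p (num_rings (p ^ n)) - 4 / 27 * real n ^ 3\<bar> \<le> 2 * (44 + 15 * real p) * real n powr (5 / 2)"
    by (rule num_rings_log_bounds(2)[OF assms n])
qed

end
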